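(* Let $T$ be a Calderón–Zygmund operator on $\mathbb{R}^n$, let $1<r<\infty$, $1<p<\infty$, and for a sequence $\mathbf{f}=\{f_j\}_{j\ge 1}$ of functions $f_j\in\mathcal{S}(\mathbb{R}^n)$ put $$\mathcal{T}_r(\mathbf{f})(x)=\Big(\sum_{j=1}^{\infty}|T(f_j)(x)|^r\Big)^{1/r}.$$ Then there is a constant $C$, depending only on $n,p,r$ and $T$, such that for every weight $w\in A_p$ $$\|\mathcal{T}_r\|_{L^p_{\ell^r}(w)\to L^p(w)}\le C\,[w]_{A_p}^{\max\{1,\frac{1}{p-1}\}}.$$
   Context: A Calderón–Zygmund operator on $\mathbb{R}^n$ is an $L^2(\mathbb{R}^n)$-bounded linear integral operator $T$ with a kernel $K(x,y)$, defined for $x\ne y$ (so $Tf(x)=\int K(x,y)f(y)\,dy$ for $x$ outside the support of a compactly supported $f\in L^2$), such that, for some constant $C_K$ and some $\alpha>0$: (i) $|K(x,y)|\le C_K|x-y|^{-n}$ for $x\neq y$; (ii) $|K(x,y)-K(x',y)|+|K(y,x)-K(y,x')|\le C_K\frac{|x-x'|^{\alpha}}{|x-y|^{n+\alpha}}$ whenever $|x-x'|<\frac{|x-y|}{2}$. $\mathcal{S}(\mathbb{R}^n)$ is the Schwartz class. A weight is an a.e. positive locally integrable function $w$ on $\mathbb{R}^n$; $w\in A_p$ means $[w]_{A_p}=\sup_Q\big(\frac1{|Q|}\int_Q w\big)\big(\frac1{|Q|}\int_Q w^{-1/(p-1)}\big)^{p-1}<\infty$, the supremum being over all cubes $Q\subset\mathbb{R}^n$.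 $L^p_{\ell^r}(w)$ is the space of sequences $\mathbf{f}=\{f_j\}$ of measurable functions with $\|\mathbf{f}\|_{L^p_{\ell^r}(w)}=\big(\int_{\mathbb{R}^n}\|\mathbf{f}(x)\|_{\ell^r}^p\,w(x)\,dx\big)^{1/p}<\infty$, where $\|\mathbf{f}(x)\|_{\ell^r}=(\sum_j|f_j(x)|^r)^{1/r}$. The norm $\|\mathcal{T}_r\|_{L^p_{\ell^r}(w)\to L^p(w)}$ is the least constant $A$ with $\|\mathcal{T}_r(\mathbf{f})\|_{L^p(w)}\le A\|\mathbf{f}\|_{L^p_{\ell^r}(w)}$ for all $\mathbf{f}=\{f_j\}\in L^p_{\ell^r}(w)$ with every $f_j\in\mathcal{S}(\mathbb{R}^n)$. *)

theory Defs
  imports "HOL-Analysis.Analysis"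
begin

section \<open>Schwartz functions\<close>

definition partial_deriv :: "'n::finite \<Rightarrow> (real^'n \<Rightarrow> complex) \<Rightarrow> real^'n \<Rightarrow> complex" where
  "partial_deriv i f x = vector_derivative (\<lambda>t. f (x + t *\<^sub>R axis i 1)) (at 0)"

text \<open>Multi-indices are represented by lists of coordinate directions; for smooth functions the
  order of the list is irrelevant.\<close>

definition iter_deriv :: "'n::finite list \<Rightarrow> (real^'n \<Rightarrow> complex) \<Rightarrow> real^'n \<Rightarrow> complex" where
  "iter_deriv is f = foldr partial_deriv is f"

text \<open>\<^const>\<open>vector_derivative\<close> is total, so existence of the derivatives is required
  separately.  Differentiability of every iterated partial derivative makes all of them exist and
  be continuous, which is \<open>f \<in> C\<^sup>\<infinity>\<close>.\<close>

definition smooth_fun :: "(real^'n::finite \<Rightarrow> complex) \<Rightarrow> bool" where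
  "smooth_fun f \<longleftrightarrow> (\<forall>is. iter_deriv is f differentiable_on UNIV)"

definition schwartz :: "(real^'n::finite \<Rightarrow> complex) set" where
  "schwartz = {f. smooth_fun f \<and>
     (\<forall>(\<beta> :: 'n \<Rightarrow> nat) is.
        bounded (range (\<lambda>x. (\<Prod>i\<in>UNIV. x $ i ^ \<beta> i) *\<^sub>R iter_deriv is f x)))}"


section \<open>Calderon-Zygmund operators\<close>

definition L2_fun :: "(real^'n::finite \<Rightarrow> complex) set" where
  "L2_fun = {f. f \<in> borel_measurable lebesgue \<and> integrable lebesgue (\<lambda>x. (cmod (f x))\<^sup>2)}"

definition L2_fun_norm :: "(real^'n::finite \<Rightarrow> complex) \<Rightarrow> real" where
  "L2_fun_norm f = sqrt (\<integral>x. (cmod (f x))\<^sup>2 \<partial>lebesgue)"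

text \<open>An operator on \<open>L\<^sup>2\<close> is a map on functions, where only the almost everywhere class of the
  output is relevant.  Linearity and boundedness together imply that functions that agree almost
  everywhere have images that agree almost everywhere.\<close>

definition L2_bounded_linear ::
    "((real^'n::finite \<Rightarrow> complex) \<Rightarrow> (real^'n \<Rightarrow> complex)) \<Rightarrow> bool" where
  "L2_bounded_linear T \<longleftrightarrow>
     (\<forall>f\<in>L2_fun. T f \<in> L2_fun) \<and>
     (\<forall>f\<in>L2_fun. \<forall>g\<in>L2_fun. AE x in lebesgue. T (\<lambda>y. f y + g y) x = T f x + T g x) \<and>
     (\<forall>c. \<forall>f\<in>L2_fun. AE x in lebesgue. T (\<lambda>y. c * f y) x = c * T f x) \<and>
     (\<exists>B. \<forall>f\<in>L2_fun. L2_fun_norm (T f) \<le> B * L2_fun_norm f)"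

text \<open>The support of an almost everywhere class: the complement of the largest open set on which
  the function vanishes almost everywhere.\<close>

definition ess_support :: "(real^'n::finite \<Rightarrow> complex) \<Rightarrow> (real^'n) set" where
  "ess_support f = {x. \<forall>U. open U \<and> x \<in> U \<longrightarrow> \<not> (AE y in lebesgue. y \<in> U \<longrightarrow> f y = 0)}"

definition CZ_kernel :: "(real^'n::finite \<Rightarrow> real^'n \<Rightarrow> complex) \<Rightarrow> real \<Rightarrow> real \<Rightarrow> bool" where
  "CZ_kernel K CK \<alpha> \<longleftrightarrow>
     (\<forall>x y. x \<noteq> y \<longrightarrow> cmod (K x y) \<le> CK * norm (x - y) powr (- real CARD('n))) \<and>
     (\<forall>x x' y. norm (x - x') < norm (x - y) / 2 \<longrightarrow>
        cmod (K x y - K x' y) + cmod (K y x - K y x')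
          \<le> CK * (norm (x - x') powr \<alpha> / norm (x - y) powr (real CARD('n) + \<alpha>)))"

text \<open>The values of \<open>K\<close> on the diagonal are arbitrary and play no role.\<close>

definition calderon_zygmund ::
    "((real^'n::finite \<Rightarrow> complex) \<Rightarrow> (real^'n \<Rightarrow> complex)) \<Rightarrow> bool" where
  "calderon_zygmund T \<longleftrightarrow>
     L2_bounded_linear T \<and>
     (\<exists>K CK \<alpha>. \<alpha> > 0 \<and> CZ_kernel K CK \<alpha> \<and>
        (\<forall>f\<in>L2_fun. compact (ess_support f) \<longrightarrow>
           (AE x in lebesgue. x \<notin> ess_support f \<longrightarrow> T f x = (\<integral>y. K x y * f y \<partial>lebesgue))))"


section \<open>Muckenhoupt weights\<close>

text \<open>Powers of extended nonnegative reals; only used with exponents \<open>a > 0\<close>.\<close>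

definition enn_powr :: "ennreal \<Rightarrow> real \<Rightarrow> ennreal" where
  "enn_powr x a = (if x = \<infinity> then \<infinity> else ennreal (enn2real x powr a))"

definition weight :: "(real^'n::finite \<Rightarrow> real) \<Rightarrow> bool" where
  "weight w \<longleftrightarrow> w \<in> borel_measurable lebesgue \<and> (AE x in lebesgue. w x > 0) \<and>
     (\<forall>S. compact S \<longrightarrow> set_integrable lebesgue S w)"

definition cubes :: "(real^'n::finite) set set" where
  "cubes = {cbox a (\<chi> i. a $ i + l) |a l. l > 0}"

definition average :: "(real^'n::finite) set \<Rightarrow> (real^'n \<Rightarrow> real) \<Rightarrow> ennreal" where
  "average Q g = (\<integral>\<^sup>+x\<in>Q. ennreal (g x) \<partial>lebesgue) / emeasure lebesgue Q"

definition Ap_const :: "real \<Rightarrow> (real^'n::finite \<Rightarrow> real) \<Rightarrow> ennreal" where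
  "Ap_const p w =
     (SUP Q\<in>cubes. average Q w * enn_powr (average Q (\<lambda>x. w x powr (- 1 / (p - 1)))) (p - 1))"

definition Ap_weights :: "real \<Rightarrow> (real^'n::finite \<Rightarrow> real) set" where
  "Ap_weights p = {w. weight w \<and> Ap_const p w < \<infinity>}"


section \<open>Vector-valued norms and operators\<close>

text \<open>All norms take values in \<^typ>\<open>ennreal\<close>, so that they are defined without assuming
  finiteness.  Sequences are indexed from \<open>0\<close>.\<close>

definition lr_norm :: "real \<Rightarrow> (nat \<Rightarrow> complex) \<Rightarrow> ennreal" where
  "lr_norm r a = enn_powr (\<Sum>j. ennreal (cmod (a j) powr r)) (1 / r)"

definition Lp_norm :: "real \<Rightarrow> (real^'n::finite \<Rightarrow> real) \<Rightarrow> (real^'n \<Rightarrow> ennreal) \<Rightarrow> ennreal" where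
  "Lp_norm p w F = enn_powr (\<integral>\<^sup>+x. enn_powr (F x) p * ennreal (w x) \<partial>lebesgue) (1 / p)"

definition Lp_lr_norm ::
    "real \<Rightarrow> real \<Rightarrow> (real^'n::finite \<Rightarrow> real) \<Rightarrow> (nat \<Rightarrow> real^'n \<Rightarrow> complex) \<Rightarrow> ennreal" where
  "Lp_lr_norm p r w f = Lp_norm p w (\<lambda>x. lr_norm r (\<lambda>j. f j x))"

definition Lp_lr_space ::
    "real \<Rightarrow> real \<Rightarrow> (real^'n::finite \<Rightarrow> real) \<Rightarrow> (nat \<Rightarrow> real^'n \<Rightarrow> complex) set" where
  "Lp_lr_space p r w =
     {f. (\<forall>j. f j \<in> borel_measurable lebesgue) \<and> Lp_lr_norm p r w f < \<infinity>}"

definition vv_op ::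
    "((real^'n::finite \<Rightarrow> complex) \<Rightarrow> (real^'n \<Rightarrow> complex)) \<Rightarrow> real \<Rightarrow>
     (nat \<Rightarrow> real^'n \<Rightarrow> complex) \<Rightarrow> real^'n \<Rightarrow> ennreal" where
  "vv_op T r f x = lr_norm r (\<lambda>j. T (f j) x)"

text \<open>The value is \<open>\<infinity>\<close> if there is no finite admissible constant.\<close>

definition vv_op_norm ::
    "((real^'n::finite \<Rightarrow> complex) \<Rightarrow> (real^'n \<Rightarrow> complex)) \<Rightarrow> real \<Rightarrow> real \<Rightarrow>
     (real^'n \<Rightarrow> real) \<Rightarrow> ennreal" where
  "vv_op_norm T p r w =
     Inf {A. \<forall>f \<in> Lp_lr_space p r w. (\<forall>j. f j \<in> schwartz) \<longrightarrow>
               Lp_norm p w (vv_op T r f) \<le> A * Lp_lr_norm p r w f}"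

end

theory Submission imports Defs
begin

text \<open>
  The inequality is deduced from pointwise domination by a sparse operator. Fix finitely many
  components and let \<open>N\<close> be their \<open>\<ell>\<^sup>r\<close> norm (\<open>fin_norm\<close>). The map \<open>(f\<^sub>j) \<mapsto> (T f\<^sub>j)\<close> has the same
  kernel as \<open>T\<close>, acting on vectors by scalars, so the Calderon-Zygmund method applies to it as
  soon as it is bounded on one space \<open>L\<^sup>s(\<ell>\<^sup>r)\<close> (\<open>strong_type\<close>). All constants obtained in this
  way are independent of the number of components.

  Sparse domination. If \<open>f\<close> is restricted to the triple \<open>3Q\<close> of a dyadic cube, \<open>weak_type\<close> says that
  \<open>N(T(f\<^bold>1\<^bsub>3Q\<^esub>))\<close> is at most a multiple of the mean of \<open>N f\<close> over \<open>3Q\<close> off a small set \<open>E\<close>. The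
  cubes \<open>P\<close> on which \<open>E\<close> has a substantial density cover almost all of \<open>E\<close> and occupy at most half of \<open>Q\<close>. Since \<open>P\<close>
  also contains points outside \<open>E\<close>, and since the part of \<open>f\<close> outside \<open>3P\<close> contributes a function that
  oscillates little on \<open>P\<close>, replacing \<open>3Q\<close> by \<open>3P\<close> costs only another multiple of the same mean
  (\<open>sparse_step\<close>). Iteration gives \<open>N(T f) \<le> C \<Sum>\<^sub>P \<langle>N f\<rangle>\<^bsub>3P\<^esub> \<^bold>1\<^sub>P\<close> almost everywhere, over a family in
  which every cube keeps half of its measure to itself (\<open>sparse_domination\<close>).

  Sharp weighted bound. Testing the sparse operator against a function leads to a bilinear form that
  is controlled, linearly in the \<open>A\<^sub>p\<close> constant if \<open>p \<ge> 2\<close>, by two maximal functions, one with respect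
  to the weight and one with respect to its dual (\<open>sparse_bilinear_ge2\<close>). For nested families the norms of
  these maximal functions do not depend on the measure (\<open>laminar_carleson_embedding\<close>). For \<open>p < 2\<close> the
  two weights are exchanged, which produces the exponent \<open>1/(p - 1)\<close>. Triples of dyadic cubes are not
  nested, but each lies in a comparable cube of one of \<open>2\<^sup>n\<close> shifted dyadic grids (\<open>one_third_trick\<close>).

  Bootstrap. The resulting \<open>weighted_bound\<close> is used twice. With a single component, \<open>s = 2\<close> and the
  weight \<open>1\<close> it turns the given \<open>L\<^sup>2\<close> bound into an \<open>L\<^sup>r\<close> bound of \<open>T\<close>. By summation the vector-valued operator
  is then bounded on \<open>L\<^sup>r(\<ell>\<^sup>r)\<close>, and with \<open>s = r\<close> the same theorem gives the weighted inequality for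
  finitely many bounded functions of bounded support. Cutting off Schwartz functions, Fatou's lemma
  and monotone convergence in the number of components complete the proof.
\<close>

section \<open>Conjugate exponents and finite sequence norms\<close>

lemma conj_exponent:
  fixes p q :: real
  assumes "1 < p" "1/p + 1/q = 1"
  shows "1 < q" "q = p / (p - 1)" "p / q = p - 1" "q * (p - 1) = p" "q - 1 = 1 / (p - 1)"
proof -
  have q0: "q \<noteq> 0" using assms by auto
  have e: "q + p = p * q" using assms q0 by (simp add: field_simps)
  then have e2: "q * (p - 1) = p" by (simp add: algebra_simps)
  show 2: "q = p / (p - 1)" using e2 assms by (simp add: field_simps)
  show 1: "1 < q" unfolding 2 using assms by (simp add: field_simps)
  show "q * (p - 1) = p" by (rule e2)
  show "p / q = p - 1" using e2 q0 by (metis nonzero_mult_div_cancel_left)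
  show "q - 1 = 1 / (p - 1)" unfolding 2 using assms by (simp add: field_simps)
qed

lemma Holder_integral:
  fixes u v :: "'a \<Rightarrow> real"
  assumes pq: "1 < p" "1/p + 1/q = 1"
    and [measurable]: "u \<in> borel_measurable M" "v \<in> borel_measurable M"
    and nn: "\<And>x. 0 \<le> u x" "\<And>x. 0 \<le> v x"
    and iu: "integrable M (\<lambda>x. u x powr p)" and iv: "integrable M (\<lambda>x. v x powr q)"
  shows "integrable M (\<lambda>x. u x * v x)"
    and "(\<integral>x. u x * v x \<partial>M) \<le> (\<integral>x. u x powr p \<partial>M) powr (1/p) * (\<integral>x. v x powr q \<partial>M) powr (1/q)"
proof -
  have q1: "1 < q" using conj_exponent[OF pq] by simp
  have Y: "a * b \<le> a powr p / p + b powr q / q" if "0 \<le> a" "0 \<le> b" for a b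
    using Youngs_inequality[OF pq(1) q1 pq(2)] that by auto
  show int: "integrable M (\<lambda>x. u x * v x)"
  proof (rule Bochner_Integration.integrable_bound[where f = "\<lambda>x. u x powr p / p + v x powr q / q"])
    show "integrable M (\<lambda>x. u x powr p / p + v x powr q / q)" using iu iv by auto
    show "AE x in M. norm (u x * v x) \<le> norm (u x powr p / p + v x powr q / q)"
      using Y nn pq q1 by (auto intro!: AE_I2 simp: abs_mult)
  qed auto
  define A where "A = (\<integral>x. u x powr p \<partial>M)"
  define B where "B = (\<integral>x. v x powr q \<partial>M)"
  have A0: "0 \<le> A" and B0: "0 \<le> B" unfolding A_def B_def by simp_all
  have zero: "(\<integral>x. u x * v x \<partial>M) = 0" if "A = 0 \<or> B = 0"
  proof -
    have "AE x in M. u x * v x = 0"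
    proof (cases "A = 0")
      case True
      then have "AE x in M. u x powr p = 0"
        using integral_nonneg_eq_0_iff_AE[OF iu] by (simp add: A_def)
      then show ?thesis by eventually_elim simp
    next
      case False
      then have "AE x in M. v x powr q = 0"
        using that integral_nonneg_eq_0_iff_AE[OF iv] by (simp add: B_def)
      then show ?thesis by eventually_elim simp
    qed
    then show ?thesis by (rule integral_eq_zero_AE)
  qed
  have "(\<integral>x. u x * v x \<partial>M) \<le> A powr (1/p) * B powr (1/q)"
  proof (cases "A = 0 \<or> B = 0")
    case True
    then show ?thesis using zero by simp
  next
    case False
    define a where "a = A powr (1/p)"
    define b where "b = B powr (1/q)"
    have ap: "a > 0" "b > 0" "a powr p = A" "b powr q = B"
      using False A0 B0 pq q1 by (auto simp: a_def b_def powr_powr)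
    have "(\<integral>x. u x * v x \<partial>M) \<le> (\<integral>x. a * b * ((u x powr p / A) / p + (v x powr q / B) / q) \<partial>M)"
    proof (rule integral_mono[OF int])
      show "integrable M (\<lambda>x. a * b * ((u x powr p / A) / p + (v x powr q / B) / q))"
        using iu iv by auto
      fix x
      have "u x / a * (v x / b) \<le> (u x / a) powr p / p + (v x / b) powr q / q"
        using nn ap by (intro Y) auto
      also have "\<dots> = (u x powr p / A) / p + (v x powr q / B) / q"
        using ap by (simp add: powr_divide)
      finally show "u x * v x \<le> a * b * ((u x powr p / A) / p + (v x powr q / B) / q)"
        using ap by (simp add: field_simps)
    qed
    also have "\<dots> = a * b * (A / A / p + B / B / q)"
      using iu iv by (simp add: A_def B_def)
    also have "\<dots> = a * b" using False pq by simp
    finally show ?thesis by (simp add: a_def b_def)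
  qed
  then show "(\<integral>x. u x * v x \<partial>M) \<le> (\<integral>x. u x powr p \<partial>M) powr (1/p) * (\<integral>x. v x powr q \<partial>M) powr (1/q)"
    by (simp add: A_def B_def)
qed

lemma Holder_sum:
  fixes u v :: "'i \<Rightarrow> real"
  assumes pq: "1 < p" "1/p + 1/q = 1" and "finite S"
    and nn: "\<And>x. x \<in> S \<Longrightarrow> 0 \<le> u x" "\<And>x. x \<in> S \<Longrightarrow> 0 \<le> v x"
  shows "(\<Sum>i\<in>S. u i * v i) \<le> (\<Sum>i\<in>S. u i powr p) powr (1/p) * (\<Sum>i\<in>S. v i powr q) powr (1/q)"
proof -
  have "(\<integral>i. \<bar>u i\<bar> * \<bar>v i\<bar> \<partial>count_space S) \<le>
     (\<integral>i. \<bar>u i\<bar> powr p \<partial>count_space S) powr (1/p) * (\<integral>i. \<bar>v i\<bar> powr q \<partial>count_space S) powr (1/q)"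
    using \<open>finite S\<close> by (intro Holder_integral(2)[OF pq]) (auto intro!: integrable_count_space)
  then show ?thesis
    using \<open>finite S\<close> nn by (simp add: lebesgue_integral_count_space_finite)
qed

definition fin_norm :: "nat \<Rightarrow> real \<Rightarrow> (nat \<Rightarrow> complex) \<Rightarrow> real" where
  "fin_norm J r a = (\<Sum>j<J. cmod (a j) powr r) powr (1/r)"

lemma fin_norm_nonneg [simp]: "0 \<le> fin_norm J r a"
  by (simp add: fin_norm_def)

lemma fin_norm_zero [simp]: "fin_norm J r (\<lambda>j. 0) = 0"
  by (simp add: fin_norm_def)

lemma fin_norm_powr: "r > 0 \<Longrightarrow> fin_norm J r a powr r = (\<Sum>j<J. cmod (a j) powr r)"
  by (simp add: fin_norm_def powr_powr sum_nonneg)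

lemma fin_norm_ge: assumes "r > 0" "j < J" shows "cmod (a j) \<le> fin_norm J r a"
proof -
  have "cmod (a j) powr r \<le> (\<Sum>j<J. cmod (a j) powr r)"
    using assms by (intro member_le_sum) auto
  then have "(cmod (a j) powr r) powr (1/r) \<le> fin_norm J r a"
    unfolding fin_norm_def using assms by (intro powr_mono2) auto
  then show ?thesis using assms by (simp add: powr_powr)
qed

lemma fin_norm_scale: "r > 0 \<Longrightarrow> fin_norm J r (\<lambda>j. c * a j) = cmod c * fin_norm J r a"
  by (simp add: fin_norm_def norm_mult powr_mult powr_powr flip: sum_distrib_left)

lemma fin_norm_cong: "(\<And>j. j < J \<Longrightarrow> a j = b j) \<Longrightarrow> fin_norm J r a = fin_norm J r b"
  by (simp add: fin_norm_def)

lemma fin_norm_mono: "r > 0 \<Longrightarrow> (\<And>j. j < J \<Longrightarrow> cmod (a j) \<le> cmod (b j)) \<Longrightarrow> fin_norm J r a \<le> fin_norm J r b"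
  unfolding fin_norm_def by (intro powr_mono2 sum_mono sum_nonneg) auto

lemma fin_norm_measurable [measurable]:
  "(\<And>j. f j \<in> borel_measurable M) \<Longrightarrow> (\<lambda>x. fin_norm J r (\<lambda>j. f j x)) \<in> borel_measurable M"
  unfolding fin_norm_def by measurable

text \<open>The norming functional from the equality case of Hoelder's inequality. Linearity of this functional
  yields Minkowski's inequality, both for sums and for integrals.\<close>

lemma fin_norm_dual:
  assumes r: "1 < r"
  obtains b where "Re (\<Sum>j<J. b j * a j) = fin_norm J r a"
    and "\<And>c. cmod (\<Sum>j<J. b j * c j) \<le> fin_norm J r c"
proof (cases "fin_norm J r a = 0")
  case True
  then show ?thesis by (intro that[of "\<lambda>_. 0"]) auto
next
  case False
  define N where "N = fin_norm J r a"
  have N: "N > 0" using False fin_norm_nonneg[of J r a] by (simp add: N_def less_le)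
  define q where "q = r / (r - 1)"
  have pq: "1 / q + 1 / r = 1" "1 < q" "q * (r - 1) = r"
    using r by (auto simp: q_def field_simps)
  define b where "b j = cnj (a j) * complex_of_real (cmod (a j) powr (r - 2) / N powr (r - 1))" for j
  have cb: "cmod (b j) = (cmod (a j) / N) powr (r - 1)" for j
  proof (cases "a j = 0")
    case False
    then have "cmod (a j) * cmod (a j) powr (r - 2) = cmod (a j) powr (r - 1)"
      by (subst powr_mult_base) (auto simp: algebra_simps)
    then show ?thesis by (simp add: b_def norm_mult powr_divide norm_divide)
  qed (simp add: b_def)
  have ba: "b j * a j = complex_of_real (cmod (a j) powr r / N powr (r - 1))" for j
  proof (cases "a j = 0")
    case False
    have "cnj (a j) * a j = complex_of_real (cmod (a j) powr 2)"
      using complex_norm_square[of "a j"] False by (simp add: mult.commute del: of_real_power)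
    then have "b j * a j = complex_of_real (cmod (a j) powr 2 * cmod (a j) powr (r - 2) / N powr (r - 1))"
      by (simp add: b_def algebra_simps)
    also have "cmod (a j) powr 2 * cmod (a j) powr (r - 2) = cmod (a j) powr r"
      by (simp del: powr_numeral add: powr_add[symmetric])
    finally show ?thesis .
  qed (simp add: b_def)
  have 1: "Re (\<Sum>j<J. b j * a j) = N"
  proof -
    have "Re (\<Sum>j<J. b j * a j) = (\<Sum>j<J. cmod (a j) powr r) / N powr (r - 1)"
      by (simp add: ba sum_divide_distrib)
    also have "\<dots> = N powr r / N powr (r - 1)"
      using r by (simp add: N_def fin_norm_powr)
    also have "\<dots> = N" using N by (simp flip: powr_diff)
    finally show ?thesis .
  qed
  have 2: "cmod (\<Sum>j<J. b j * c j) \<le> fin_norm J r c" for c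
  proof -
    have "cmod (\<Sum>j<J. b j * c j) \<le> (\<Sum>j<J. cmod (b j) * cmod (c j))"
      by (rule order_trans[OF norm_sum]) (simp add: norm_mult)
    also have "\<dots> \<le> (\<Sum>j<J. cmod (b j) powr q) powr (1/q) * (\<Sum>j<J. cmod (c j) powr r) powr (1/r)"
      by (rule Holder_sum) (use pq in auto)
    also have "(\<Sum>j<J. cmod (b j) powr q) = (\<Sum>j<J. cmod (a j) powr r) / N powr r"
      using pq by (simp add: cb powr_powr powr_divide mult.commute sum_divide_distrib)
    also have "\<dots> = 1" using N r by (simp add: N_def fin_norm_powr flip: fin_norm_powr)
    finally show ?thesis by (simp add: fin_norm_def)
  qed
  show ?thesis using 1 2 by (intro that[of b]) (auto simp: N_def)
qed

lemma fin_norm_triangle: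
  assumes r: "1 < r"
  shows "fin_norm J r (\<lambda>j. a j + b j) \<le> fin_norm J r a + fin_norm J r b"
proof -
  obtain d where d: "Re (\<Sum>j<J. d j * (a j + b j)) = fin_norm J r (\<lambda>j. a j + b j)"
    "\<And>c. cmod (\<Sum>j<J. d j * c j) \<le> fin_norm J r c"
    using fin_norm_dual[OF r] by metis
  have "fin_norm J r (\<lambda>j. a j + b j) = Re (\<Sum>j<J. d j * a j) + Re (\<Sum>j<J. d j * b j)"
    unfolding d(1)[symmetric] by (simp add: algebra_simps sum.distrib)
  also have "\<dots> \<le> fin_norm J r a + fin_norm J r b"
    by (intro add_mono order_trans[OF complex_Re_le_cmod] d(2))
  finally show ?thesis .
qed

lemma fin_norm_minus: "fin_norm J r (\<lambda>j. - a j) = fin_norm J r a"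
  by (simp add: fin_norm_def)

lemma fin_norm_diff_le:
  assumes "1 < r" shows "fin_norm J r (\<lambda>j. a j - b j) \<le> fin_norm J r a + fin_norm J r b"
  using fin_norm_triangle[OF assms, of J a "\<lambda>j. - b j"] by (simp add: fin_norm_minus)

lemma fin_norm_sum:
  assumes "1 < r" "finite I"
  shows "fin_norm J r (\<lambda>j. \<Sum>i\<in>I. a i j) \<le> (\<Sum>i\<in>I. fin_norm J r (a i))"
  using \<open>finite I\<close>
proof induction
  case (insert i I)
  then show ?case using fin_norm_triangle[OF assms(1), of J "a i" "\<lambda>j. \<Sum>i\<in>I. a i j"] by simp
qed simp

lemma fin_norm_integral:
  assumes r: "1 < r"
    and int: "\<And>j. integrable M (\<lambda>y. k y * f j y)"
    and intN: "integrable M h" and le: "\<And>y. cmod (k y) * fin_norm J r (\<lambda>j. f j y) \<le> h y"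
  shows "fin_norm J r (\<lambda>j. \<integral>y. k y * f j y \<partial>M) \<le> (\<integral>y. h y \<partial>M)"
proof -
  obtain d where d: "Re (\<Sum>j<J. d j * (\<integral>y. k y * f j y \<partial>M)) = fin_norm J r (\<lambda>j. \<integral>y. k y * f j y \<partial>M)"
    "\<And>c. cmod (\<Sum>j<J. d j * c j) \<le> fin_norm J r c"
    using fin_norm_dual[OF r] by metis
  have int2: "integrable M (\<lambda>y. \<Sum>j<J. d j * (k y * f j y))"
    by (intro Bochner_Integration.integrable_sum integrable_mult_right int)
  have "(\<Sum>j<J. d j * (\<integral>y. k y * f j y \<partial>M)) = (\<integral>y. (\<Sum>j<J. d j * (k y * f j y)) \<partial>M)"
    by (subst Bochner_Integration.integral_sum)
      (intro integrable_mult_right int, intro sum.cong refl integral_mult_right_zero[symmetric])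
  also have "Re \<dots> = (\<integral>y. Re (\<Sum>j<J. d j * (k y * f j y)) \<partial>M)"
    by (rule integral_Re[OF int2, symmetric])
  also have "\<dots> \<le> (\<integral>y. h y \<partial>M)"
  proof (rule integral_mono[OF _ intN])
    show "integrable M (\<lambda>y. Re (\<Sum>j<J. d j * (k y * f j y)))" using int2 by (rule integrable_Re)
    fix y
    have "Re (\<Sum>j<J. d j * (k y * f j y)) \<le> fin_norm J r (\<lambda>j. k y * f j y)"
      by (intro order_trans[OF complex_Re_le_cmod] d(2))
    also have "\<dots> \<le> h y" using le r by (simp add: fin_norm_scale)
    finally show "Re (\<Sum>j<J. d j * (k y * f j y)) \<le> h y" .
  qed
  finally show ?thesis using d(1) by simp
qed

section \<open>A maximal inequality for nested families\<close>

definition laminar_on :: "'i set \<Rightarrow> ('i \<Rightarrow> 'a set) \<Rightarrow> bool" where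
  "laminar_on S R \<longleftrightarrow> (\<forall>i\<in>S. \<forall>j\<in>S. R i \<subseteq> R j \<or> R j \<subseteq> R i \<or> R i \<inter> R j = {})"

text \<open>Doob's maximal inequality in differential form. The maximal function \<open>m\<close> is built by adding the sets
  in order of decreasing size. When a set \<open>R\<close> is added that contains no other, \<open>m\<close> has a constant
  value \<open>v\<close> on \<open>R\<close>, and it has to be raised there to the mean \<open>A\<close> of \<open>f\<close> if \<open>A > v\<close>. The integral of
  \<open>(p - 1) m\<^sup>p - p f m\<^bsup>p-1\<^esup>\<close> then changes by the measure of \<open>R\<close> times
  \<open>- A\<^sup>p - (p - 1) v\<^sup>p + p A v\<^bsup>p-1\<^esup>\<close>, which is nonpositive by Young's inequality, for every measure. The clause about sets \<open>D\<close> keeps track of where \<open>m\<close> is constant.\<close>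

lemma laminar_maximal_function:
  fixes f :: "'a \<Rightarrow> real" and p :: real
  assumes p: "1 < p" and fin: "finite S" and lam: "laminar_on S R"
    and R: "\<forall>i\<in>S. R i \<in> sets M \<and> emeasure M (R i) < \<infinity>"
    and f: "\<And>x. 0 \<le> f x" "integrable M f"
  shows "\<exists>m c. (\<forall>x. 0 \<le> m x \<and> m x \<le> c) \<and> m \<in> borel_measurable M \<and> (\<forall>x. x \<notin> \<Union>(R ` S) \<longrightarrow> m x = 0) \<and>
    (\<forall>i\<in>S. \<forall>x\<in>R i. (LINT y:R i|M. f y) / measure M (R i) \<le> m x) \<and>
    (\<forall>D. (\<forall>i\<in>S. D \<subseteq> R i \<or> D \<inter> R i = {}) \<longrightarrow> (\<exists>v. \<forall>x\<in>D. m x = v)) \<and>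
    integrable M (\<lambda>x. (p - 1) * m x powr p - p * (f x * m x powr (p - 1))) \<and>
    (\<integral>x. (p - 1) * m x powr p - p * (f x * m x powr (p - 1)) \<partial>M) \<le> 0"
  using fin lam R
proof (induction "card S" arbitrary: S)
  case 0
  then have "S = {}" by auto
  show ?case unfolding \<open>S = {}\<close> using p by (intro exI[of _ "\<lambda>_. 0"] exI[of _ 0]) simp
next
  case (Suc n S)
  have [measurable]: "f \<in> borel_measurable M" using f by auto
  have "S \<noteq> {}" using Suc by auto
  then obtain Q where Q: "Q \<in> R ` S" "\<And>Q'. Q' \<in> R ` S \<Longrightarrow> Q' \<subseteq> Q \<Longrightarrow> Q' = Q"
    using finite_has_minimal[of "R ` S"] Suc.prems by (metis finite_imageI image_is_empty)
  then obtain i where i: "i \<in> S" "Q = R i" by auto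
  define S' where "S' = S - {i}"
  have S: "S = insert i S'" "i \<notin> S'" "finite S'" "card S' = n"
    using i Suc by (auto simp: S'_def)
  have cutoff: "\<forall>j\<in>S'. R i \<subseteq> R j \<or> R i \<inter> R j = {}"
    using Suc.prems(2) Q(2) i unfolding laminar_on_def S(1) by (metis imageI insertCI order_refl)
  obtain m c where m: "\<And>x. 0 \<le> m x" "\<And>x. m x \<le> c" and [measurable]: "m \<in> borel_measurable M"
    and m0: "\<And>x. x \<notin> \<Union>(R ` S') \<Longrightarrow> m x = 0"
    and mA: "\<And>j x. j \<in> S' \<Longrightarrow> x \<in> R j \<Longrightarrow> (LINT y:R j|M. f y) / measure M (R j) \<le> m x"
    and mD: "\<And>D. (\<forall>j\<in>S'. D \<subseteq> R j \<or> D \<inter> R j = {}) \<Longrightarrow> (\<exists>v. \<forall>x\<in>D. m x = v)"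
    and mI: "integrable M (\<lambda>x. (p - 1) * m x powr p - p * (f x * m x powr (p - 1)))"
    and mle: "(\<integral>x. (p - 1) * m x powr p - p * (f x * m x powr (p - 1)) \<partial>M) \<le> 0"
  proof -
    have "laminar_on S' R" using Suc.prems(2) S(1) by (simp add: laminar_on_def)
    then have "\<exists>m c. (\<forall>x. 0 \<le> m x \<and> m x \<le> c) \<and> m \<in> borel_measurable M \<and> (\<forall>x. x \<notin> \<Union>(R ` S') \<longrightarrow> m x = 0) \<and>
      (\<forall>i\<in>S'. \<forall>x\<in>R i. (LINT y:R i|M. f y) / measure M (R i) \<le> m x) \<and>
      (\<forall>D. (\<forall>i\<in>S'. D \<subseteq> R i \<or> D \<inter> R i = {}) \<longrightarrow> (\<exists>v. \<forall>x\<in>D. m x = v)) \<and>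
      integrable M (\<lambda>x. (p - 1) * m x powr p - p * (f x * m x powr (p - 1))) \<and>
      (\<integral>x. (p - 1) * m x powr p - p * (f x * m x powr (p - 1)) \<partial>M) \<le> 0"
      using S Suc.prems by (intro Suc.hyps(1)) auto
    then show ?thesis using that by (elim exE conjE) blast
  qed
  define A where "A = (LINT y:R i|M. f y) / measure M (R i)"
  obtain v where v: "\<And>x. x \<in> R i \<Longrightarrow> m x = v" using mD[OF cutoff] by blast
  have Rm[measurable]: "R i \<in> sets M" and Rf: "emeasure M (R i) < \<infinity>" using Suc.prems i by auto
  show ?case
  proof (cases "R i = {} \<or> A \<le> v")
    case True
    have u: "A \<le> m x" if "x \<in> R i" for x using True that v by auto
    show ?thesis
    proof (intro exI[of _ m] exI[of _ c] conjI)
      show "\<forall>x. x \<notin> \<Union>(R ` S) \<longrightarrow> m x = 0" using m0 S by auto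
      show "\<forall>i\<in>S. \<forall>x\<in>R i. (LINT y:R i|M. f y) / measure M (R i) \<le> m x"
        using u mA unfolding S A_def by auto
      show "\<forall>D. (\<forall>i\<in>S. D \<subseteq> R i \<or> D \<inter> R i = {}) \<longrightarrow> (\<exists>v. \<forall>x\<in>D. m x = v)"
        using mD S by auto
    qed (use m mI mle in auto)
  next
    case False
    then have Av: "A > v" by simp
    obtain x0 where "x0 \<in> R i" using False by auto
    then have v0: "v \<ge> 0" using v m(1)[of x0] by simp
    define \<mu> where "\<mu> = measure M (R i)"
    have \<mu>: "\<mu> > 0"
    proof (rule ccontr)
      assume "\<not> \<mu> > 0"
      then have "\<mu> = 0" using measure_nonneg[of M "R i"] by (simp add: \<mu>_def)
      then show False using Av v0 by (simp add: A_def \<mu>_def)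
    qed
    have intR: "(LINT y:R i|M. f y) = \<mu> * A" using \<mu> by (simp add: A_def \<mu>_def)
    define m' where "m' x = m x + indicator (R i) x * (A - v)" for x
    have m'v: "x \<in> R i \<Longrightarrow> m' x = A" for x using v by (simp add: m'_def)
    have m'o: "x \<notin> R i \<Longrightarrow> m' x = m x" for x by (simp add: m'_def)
    define e where "e x = indicator (R i) x * ((p - 1) * (A powr p - v powr p)) -
        p * (A powr (p - 1) - v powr (p - 1)) * (indicator (R i) x *\<^sub>R f x)" for x
    have pt: "(p - 1) * m' x powr p - p * (f x * m' x powr (p - 1)) =
        ((p - 1) * m x powr p - p * (f x * m x powr (p - 1))) + e x" for x
      using m'v m'o v by (cases "x \<in> R i") (auto simp: e_def algebra_simps)
    have fi: "integrable M (\<lambda>x. indicator (R i) x *\<^sub>R f x)"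
      by (rule integrable_mult_indicator[OF Rm f(2)])
    have ei: "integrable M e" unfolding e_def
      using fi Rf by (intro Bochner_Integration.integrable_diff integrable_mult_right integrable_mult_left) auto
    have "(\<integral>x. e x \<partial>M) = \<mu> * ((p - 1) * (A powr p - v powr p)) - p * (A powr (p - 1) - v powr (p - 1)) * (\<mu> * A)"
      unfolding e_def using fi Rf intR
      by (subst Bochner_Integration.integral_diff) (auto simp: set_lebesgue_integral_def \<mu>_def)
    also have "\<dots> = \<mu> * (- (A powr p) - (p - 1) * v powr p + p * (A * v powr (p - 1)))"
    proof -
      have "A powr p = A * A powr (p - 1)" using Av v0 by (subst powr_mult_base) auto
      then show ?thesis by (simp add: algebra_simps)
    qed
    also have "\<dots> \<le> 0"
    proof -
      define q where "q = p / (p - 1)"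
      have pq: "1 / p + 1 / q = 1" "1 < q" "(p - 1) * q = p" "p / q = p - 1"
        using p by (auto simp: q_def field_simps)
      have "A * v powr (p - 1) \<le> A powr p / p + (v powr (p - 1)) powr q / q"
        using Av v0 pq p by (intro Youngs_inequality) auto
      then have "p * (A * v powr (p - 1)) \<le> p * (A powr p / p + v powr p / q)"
        using pq p by (intro mult_left_mono) (auto simp: powr_powr)
      also have "\<dots> = A powr p + (p / q) * v powr p" using p by (simp add: algebra_simps)
      finally have "p * (A * v powr (p - 1)) \<le> A powr p + (p - 1) * v powr p" unfolding pq .
      then show ?thesis using \<mu> by (intro mult_nonneg_nonpos) auto
    qed
    finally have ele: "(\<integral>x. e x \<partial>M) \<le> 0" .
    show ?thesis
    proof (intro exI[of _ m'] exI[of _ "max c A"] conjI)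
      show "\<forall>x. 0 \<le> m' x \<and> m' x \<le> max c A"
      proof
        fix x
        show "0 \<le> m' x \<and> m' x \<le> max c A"
          using m(1)[of x] m(2)[of x] m'v[of x] m'o[of x] Av v0 by (cases "x \<in> R i") auto
      qed
      show "m' \<in> borel_measurable M" unfolding m'_def by measurable
      show "\<forall>x. x \<notin> \<Union>(R ` S) \<longrightarrow> m' x = 0" using m0 m'o S by auto
      show "\<forall>j\<in>S. \<forall>x\<in>R j. (LINT y:R j|M. f y) / measure M (R j) \<le> m' x"
      proof (intro ballI)
        fix j x assume j: "j \<in> S" "x \<in> R j"
        have "m x \<le> m' x" using m'v m'o v Av by (cases "x \<in> R i") auto
        moreover have "j \<noteq> i \<Longrightarrow> (LINT y:R j|M. f y) / measure M (R j) \<le> m x"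
          using mA j S by auto
        ultimately show "(LINT y:R j|M. f y) / measure M (R j) \<le> m' x"
          using m'v j by (cases "j = i") (auto simp: A_def)
      qed
      show "\<forall>D. (\<forall>i\<in>S. D \<subseteq> R i \<or> D \<inter> R i = {}) \<longrightarrow> (\<exists>v. \<forall>x\<in>D. m' x = v)"
      proof (intro allI impI)
        fix D assume D: "\<forall>i\<in>S. D \<subseteq> R i \<or> D \<inter> R i = {}"
        then obtain v' where "\<forall>x\<in>D. m x = v'" using mD S by blast
        then show "\<exists>v. \<forall>x\<in>D. m' x = v" using D i m'v m'o by (metis disjoint_iff subsetD)
      qed
      show "integrable M (\<lambda>x. (p - 1) * m' x powr p - p * (f x * m' x powr (p - 1)))"
        unfolding pt using mI ei by auto
      show "(\<integral>x. (p - 1) * m' x powr p - p * (f x * m' x powr (p - 1)) \<partial>M) \<le> 0"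
        unfolding pt using mI ei mle ele by simp
    qed
  qed
qed

text \<open>On the disjoint sets \<open>E i\<close> the means are dominated by the maximal function, whose \<open>p\<close>-th power is
  bounded in mean by absorbing it into the differential form of Doob's inequality.\<close>

lemma laminar_carleson_embedding:
  fixes f :: "'a \<Rightarrow> real" and p :: real
  assumes p: "1 < p" and fin: "finite S" and lam: "laminar_on S R"
    and R: "\<And>i. i \<in> S \<Longrightarrow> R i \<in> sets M" "\<And>i. i \<in> S \<Longrightarrow> emeasure M (R i) < \<infinity>"
    and E: "\<And>i. i \<in> S \<Longrightarrow> E i \<in> sets M" "\<And>i. i \<in> S \<Longrightarrow> E i \<subseteq> R i" "disjoint_family_on E S"
    and f: "\<And>x. 0 \<le> f x" "integrable M f" "integrable M (\<lambda>x. f x powr p)"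
  shows "(\<Sum>i\<in>S. measure M (E i) * ((LINT y:R i|M. f y) / measure M (R i)) powr p)
     \<le> 2 powr p / (p - 1) * (\<integral>x. f x powr p \<partial>M)"
proof -
  obtain m c where m: "\<And>x. 0 \<le> m x" "\<And>x. m x \<le> c" and [measurable]: "m \<in> borel_measurable M"
    and m0: "\<And>x. x \<notin> \<Union>(R ` S) \<Longrightarrow> m x = 0"
    and mA: "\<And>j x. j \<in> S \<Longrightarrow> x \<in> R j \<Longrightarrow> (LINT y:R j|M. f y) / measure M (R j) \<le> m x"
    and mI: "integrable M (\<lambda>x. (p - 1) * m x powr p - p * (f x * m x powr (p - 1)))"
    and mle: "(\<integral>x. (p - 1) * m x powr p - p * (f x * m x powr (p - 1)) \<partial>M) \<le> 0"
  proof -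
    have R': "\<forall>i\<in>S. R i \<in> sets M \<and> emeasure M (R i) < \<infinity>" using R by blast
    obtain m c where m: "(\<forall>x. 0 \<le> m x \<and> m x \<le> c) \<and> m \<in> borel_measurable M \<and> (\<forall>x. x \<notin> \<Union>(R ` S) \<longrightarrow> m x = 0) \<and>
    (\<forall>i\<in>S. \<forall>x\<in>R i. (LINT y:R i|M. f y) / measure M (R i) \<le> m x) \<and>
    (\<forall>D. (\<forall>i\<in>S. D \<subseteq> R i \<or> D \<inter> R i = {}) \<longrightarrow> (\<exists>v. \<forall>x\<in>D. m x = v)) \<and>
    integrable M (\<lambda>x. (p - 1) * m x powr p - p * (f x * m x powr (p - 1))) \<and>
    (\<integral>x. (p - 1) * m x powr p - p * (f x * m x powr (p - 1)) \<partial>M) \<le> 0"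
      using laminar_maximal_function[OF p fin lam R' f(1,2)] by (elim exE) (erule that)
    show ?thesis by (rule that[of m c]) (use m in blast)+
  qed
  have [measurable]: "f \<in> borel_measurable M" using f by auto
  have Um[measurable]: "\<Union>(R ` S) \<in> sets M"
    using fin R by auto
  have Uf: "emeasure M (\<Union>(R ` S)) < \<infinity>"
  proof -
    have "emeasure M (\<Union>(R ` S)) \<le> (\<Sum>i\<in>S. emeasure M (R i))"
      using fin R by (intro emeasure_subadditive_finite) auto
    also have "\<dots> < \<infinity>" using fin R by (simp add: less_top[symmetric])
    finally show ?thesis .
  qed
  have mp: "integrable M (\<lambda>x. m x powr p)"
  proof (rule Bochner_Integration.integrable_bound[where f = "\<lambda>x. c powr p * indicator (\<Union>(R ` S)) x"])
    show "integrable M (\<lambda>x. c powr p * indicator (\<Union>(R ` S)) x)"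
      using Uf by (intro integrable_mult_right) auto
    show "AE x in M. norm (m x powr p) \<le> norm (c powr p * indicator (\<Union>(R ` S)) x)"
      using m m0 p by (intro AE_I2) (auto simp: indicator_def intro!: powr_mono2)
  qed auto
  define q where "q = p / (p - 1)"
  have pq: "1 / p + 1 / q = 1" "1 < q" "(p - 1) * q = p" "p / q = p - 1"
    using p by (auto simp: q_def field_simps)
  \<comment> \<open>With this factor Young's inequality leaves half of \<open>(p - 1) m\<^sup>p\<close>, which is absorbed.\<close>
  define k :: real where "k = 2 powr (1 / q)"
  have k: "k > 0" "k powr q = 2" "k powr p = 2 powr (p - 1)"
    using pq by (auto simp: k_def powr_powr)
  have Y: "p * (f x * m x powr (p - 1)) \<le> 2 powr (p - 1) * f x powr p + (p - 1) / 2 * m x powr p" for x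
  proof -
    have "(k * f x) * (m x powr (p - 1) / k) \<le> (k * f x) powr p / p + (m x powr (p - 1) / k) powr q / q"
      using pq p f(1) k by (intro Youngs_inequality) auto
    also have "(k * f x) powr p = 2 powr (p - 1) * f x powr p" by (simp add: powr_mult k)
    also have "(m x powr (p - 1) / k) powr q = m x powr p / 2"
      using pq by (simp add: powr_divide powr_powr k)
    finally have "p * (f x * m x powr (p - 1)) \<le> p * (2 powr (p - 1) * f x powr p / p + m x powr p / 2 / q)"
      using p k by (intro mult_left_mono) auto
    also have "\<dots> = 2 powr (p - 1) * f x powr p + (p / q) * (m x powr p / 2)"
      using p by (simp add: algebra_simps)
    finally show ?thesis unfolding pq by simp
  qed
  have "(\<integral>x. (p - 1) / 2 * m x powr p - 2 powr (p - 1) * f x powr p \<partial>M) \<le>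
        (\<integral>x. (p - 1) * m x powr p - p * (f x * m x powr (p - 1)) \<partial>M)"
  proof (rule integral_mono)
    show "integrable M (\<lambda>x. (p - 1) / 2 * m x powr p - 2 powr (p - 1) * f x powr p)"
      using mp f by (intro Bochner_Integration.integrable_diff integrable_mult_right)
    show "(p - 1) / 2 * m x powr p - 2 powr (p - 1) * f x powr p \<le>
        (p - 1) * m x powr p - p * (f x * m x powr (p - 1))" for x
      using Y[of x] by (simp add: field_simps)
  qed (rule mI)
  then have "(p - 1) / 2 * (\<integral>x. m x powr p \<partial>M) - 2 powr (p - 1) * (\<integral>x. f x powr p \<partial>M) \<le> 0"
    using mle mp f by simp
  moreover have "(2::real) powr p = 2 * 2 powr (p - 1)" by (subst powr_mult_base) auto
  ultimately have main: "(\<integral>x. m x powr p \<partial>M) \<le> 2 powr p / (p - 1) * (\<integral>x. f x powr p \<partial>M)"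
    using p by (simp add: field_simps)
  define A where "A i = (LINT y:R i|M. f y) / measure M (R i)" for i
  have A0: "0 \<le> A i" for i
    unfolding A_def set_lebesgue_integral_def
    by (intro divide_nonneg_nonneg Bochner_Integration.integral_nonneg) (auto simp: f)
  have Ef: "emeasure M (E i) < \<infinity>" if "i \<in> S" for i
    using emeasure_mono[OF E(2) R(1)] R(2) that by (meson order_le_less_trans)
  have "(\<Sum>i\<in>S. measure M (E i) * A i powr p) = (\<integral>x. (\<Sum>i\<in>S. indicator (E i) x * A i powr p) \<partial>M)"
    using E(1) Ef by (subst Bochner_Integration.integral_sum) (auto intro!: integrable_mult_left)
  also have "\<dots> \<le> (\<integral>x. m x powr p \<partial>M)"
  proof (rule integral_mono[OF _ mp])
    show "integrable M (\<lambda>x. \<Sum>i\<in>S. indicator (E i) x * A i powr p)"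
      using E(1) Ef by (intro Bochner_Integration.integrable_sum integrable_mult_left) auto
    fix x
    show "(\<Sum>i\<in>S. indicator (E i) x * A i powr p) \<le> m x powr p"
    proof (cases "\<exists>i\<in>S. x \<in> E i")
      case True
      then obtain i where i: "i \<in> S" "x \<in> E i" by auto
      have "(\<Sum>j\<in>S. indicator (E j) x * A j powr p) = (\<Sum>j\<in>{i}. indicator (E j) x * A j powr p)"
        using i fin E(3) by (intro sum.mono_neutral_right) (auto simp: disjoint_family_on_def indicator_def)
      also have "\<dots> \<le> m x powr p"
        using i A0 mA[of i x] E(2) p by (auto simp: A_def[symmetric] intro!: powr_mono2)
      finally show ?thesis .
    next
      case False
      then have "(\<Sum>i\<in>S. indicator (E i) x * A i powr p) = 0"
        by (intro sum.neutral) auto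
      then show ?thesis by simp
    qed
  qed
  finally show ?thesis using main by (simp add: A_def)
qed

section \<open>The sparse bilinear form\<close>

definition bilin_const :: "real \<Rightarrow> real \<Rightarrow> real" where
  "bilin_const p q = (2 powr p / (p - 1)) powr (1/p) * (2 powr q / (q - 1)) powr (1/q)"

lemma bilin_const_nonneg: "0 \<le> bilin_const p q"
  by (simp add: bilin_const_def)

text \<open>Write each term as the product of the \<open>s dx\<close>-mean of \<open>f\<close>, the \<open>w dx\<close>-mean of \<open>g\<close> and \<open>s(R) w(R) / |R|\<close>.
  The last factor is at most \<open>\<Lambda> |R|\<^bsup>p-1\<^esup> s(R)\<^bsup>2-p\<^esup>\<close>. As \<open>2 - p \<le> 0\<close>, here \<open>s(R)\<close> may be
  replaced by \<open>s(E)\<close>, and \<open>|R|\<close> by \<open>\<kappa> |E|\<close>, where \<open>|E| \<le> w(E)\<^bsup>1/p\<^esup> s(E)\<^bsup>1/q\<^esup>\<close> by Hoelder's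
  inequality. What remains is \<open>s(E)\<^bsup>1/p\<^esup> w(E)\<^bsup>1/q\<^esup>\<close>, which distributes over the two means, so that
  Hoelder's inequality for sums and the embedding theorem for the measures \<open>s dx\<close> and \<open>w dx\<close> apply.\<close>

lemma sparse_bilinear_ge2:
  fixes w s f g :: "'a \<Rightarrow> real"
  assumes p: "2 \<le> p" and pq: "1/p + 1/q = 1" and fin: "finite S" and lam: "laminar_on S R"
    and R: "\<And>i. i \<in> S \<Longrightarrow> R i \<in> sets M" "\<And>i. i \<in> S \<Longrightarrow> 0 < measure M (R i)"
    and E: "\<And>i. i \<in> S \<Longrightarrow> E i \<in> sets M" "\<And>i. i \<in> S \<Longrightarrow> E i \<subseteq> R i" "disjoint_family_on E S"
    and ER: "\<And>i. i \<in> S \<Longrightarrow> measure M (R i) \<le> \<kappa> * measure M (E i)"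
    and w: "w \<in> borel_measurable M" "\<And>x. 0 < w x" "\<And>i. i \<in> S \<Longrightarrow> set_integrable M (R i) w"
    and s: "s \<in> borel_measurable M" "\<And>x. 0 < s x" "\<And>i. i \<in> S \<Longrightarrow> set_integrable M (R i) s"
    and ws: "\<And>x. w x * s x powr (p - 1) = 1"
    and L: "0 \<le> \<Lambda>" and ap: "\<And>i. i \<in> S \<Longrightarrow>
      (LINT x:R i|M. w x) * (LINT x:R i|M. s x) powr (p - 1) \<le> \<Lambda> * measure M (R i) powr p"
    and f: "f \<in> borel_measurable M" "\<And>x. 0 \<le> f x" "integrable M (\<lambda>x. s x * f x)" "integrable M (\<lambda>x. s x * f x powr p)"
    and g: "g \<in> borel_measurable M" "\<And>x. 0 \<le> g x" "integrable M (\<lambda>x. w x * g x)" "integrable M (\<lambda>x. w x * g x powr q)"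
  shows "(\<Sum>i\<in>S. (LINT x:R i|M. s x * f x) * (LINT x:R i|M. w x * g x) / measure M (R i))
     \<le> bilin_const p q * \<kappa> powr (p - 1) * \<Lambda> *
       ((\<integral>x. s x * f x powr p \<partial>M) powr (1/p) * (\<integral>x. w x * g x powr q \<partial>M) powr (1/q))"
proof -
  note [measurable] = w(1) s(1) f(1) g(1)
  have p1: "1 < p" using p by simp
  note ce = conj_exponent[OF p1 pq]
  have q1: "1 < q" by (rule ce)
  have dens: "emeasure (density M h) A < \<infinity>" "measure (density M h) A = (LINT x:A|M. h x)"
    if h: "h \<in> borel_measurable M" "\<And>x. 0 < h x" "set_integrable M A h" "A \<in> sets M" for h :: "'a \<Rightarrow> real" and A
  proof -
    have "emeasure (density M h) A = (\<integral>\<^sup>+x. ennreal (h x) * indicator A x \<partial>M)"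
      using h by (simp add: emeasure_density)
    also have "\<dots> = (\<integral>\<^sup>+x. ennreal (indicator A x * h x) \<partial>M)"
      by (intro nn_integral_cong) (simp split: split_indicator)
    also have "\<dots> = ennreal (LINT x:A|M. h x)"
      using h unfolding set_integrable_def set_lebesgue_integral_def
      by (subst nn_integral_eq_integral) (auto intro!: AE_I2 simp: less_imp_le)
    finally have e: "emeasure (density M h) A = ennreal (LINT x:A|M. h x)" .
    then show "emeasure (density M h) A < \<infinity>" by simp
    have "0 \<le> (LINT x:A|M. h x)" unfolding set_lebesgue_integral_def
      using h by (intro Bochner_Integration.integral_nonneg) (auto simp: less_imp_le)
    with e show "measure (density M h) A = (LINT x:A|M. h x)" by (simp add: measure_def)
  qed
  have LI: "(LINT x:A|density M h. k x) = (LINT x:A|M. h x * k x)"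
    if "h \<in> borel_measurable M" "k \<in> borel_measurable M" "\<And>x. 0 < h x" "A \<in> sets M" for h k :: "'a \<Rightarrow> real" and A
    unfolding set_lebesgue_integral_def using that
    by (subst integral_density) (auto intro!: AE_I2 simp: less_imp_le mult_ac)
  define a where "a i = (LINT x:R i|M. s x * f x) / (LINT x:R i|M. s x)" for i
  define b where "b i = (LINT x:R i|M. w x * g x) / (LINT x:R i|M. w x)" for i
  define sE where "sE i = (LINT x:E i|M. s x)" for i
  define wE where "wE i = (LINT x:E i|M. w x)" for i
  have siE: "set_integrable M (E i) s" and wiE: "set_integrable M (E i) w" if "i \<in> S" for i
    using s(3)[OF that] w(3)[OF that] E(1,2)[OF that] by (auto intro: set_integrable_subset)
  have sEnn: "0 \<le> sE i" "0 \<le> wE i" for i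
    unfolding sE_def wE_def set_lebesgue_integral_def
    using w s by (auto intro!: Bochner_Integration.integral_nonneg simp: less_imp_le)
  have A: "(\<Sum>i\<in>S. sE i * a i powr p) \<le> 2 powr p / (p - 1) * (\<integral>x. s x * f x powr p \<partial>M)"
  proof -
    have "(\<Sum>i\<in>S. measure (density M s) (E i) * ((LINT y:R i|density M s. f y) / measure (density M s) (R i)) powr p)
     \<le> 2 powr p / (p - 1) * (\<integral>x. f x powr p \<partial>density M s)"
      using R E dens[OF s(1,2,3)] s(2) f
      by (intro laminar_carleson_embedding[OF p1 fin lam])
        (auto simp: integrable_density less_imp_le intro!: dens(1)[OF s(1,2,3)])
    also have "(\<integral>x. f x powr p \<partial>density M s) = (\<integral>x. s x * f x powr p \<partial>M)"
      using s(2) by (subst integral_density) (auto intro!: AE_I2 simp: less_imp_le)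
    also have "(\<Sum>i\<in>S. measure (density M s) (E i) * ((LINT y:R i|density M s. f y) / measure (density M s) (R i)) powr p)
       = (\<Sum>i\<in>S. sE i * a i powr p)"
      by (intro sum.cong refl)
        (simp add: sE_def a_def dens(2)[OF s(1,2) siE E(1)] dens(2)[OF s(1,2) s(3) R(1)] LI[OF s(1) f(1) s(2) R(1)])
    finally show ?thesis .
  qed
  have B: "(\<Sum>i\<in>S. wE i * b i powr q) \<le> 2 powr q / (q - 1) * (\<integral>x. w x * g x powr q \<partial>M)"
  proof -
    have "(\<Sum>i\<in>S. measure (density M w) (E i) * ((LINT y:R i|density M w. g y) / measure (density M w) (R i)) powr q)
     \<le> 2 powr q / (q - 1) * (\<integral>x. g x powr q \<partial>density M w)"
      using R E dens[OF w(1,2,3)] w(2) g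
      by (intro laminar_carleson_embedding[OF q1 fin lam])
        (auto simp: integrable_density less_imp_le intro!: dens(1)[OF w(1,2,3)])
    also have "(\<integral>x. g x powr q \<partial>density M w) = (\<integral>x. w x * g x powr q \<partial>M)"
      using w(2) by (subst integral_density) (auto intro!: AE_I2 simp: less_imp_le)
    also have "(\<Sum>i\<in>S. measure (density M w) (E i) * ((LINT y:R i|density M w. g y) / measure (density M w) (R i)) powr q)
       = (\<Sum>i\<in>S. wE i * b i powr q)"
      by (intro sum.cong refl)
        (simp add: wE_def b_def dens(2)[OF w(1,2) wiE E(1)] dens(2)[OF w(1,2) w(3) R(1)] LI[OF w(1) g(1) w(2) R(1)])
    finally show ?thesis .
  qed
  have ann: "0 \<le> a i" "0 \<le> b i" for i
    unfolding a_def b_def set_lebesgue_integral_def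
    using w s f g by (auto intro!: divide_nonneg_nonneg Bochner_Integration.integral_nonneg simp: less_imp_le)
  have tm: "(LINT x:R i|M. s x * f x) * (LINT x:R i|M. w x * g x) / measure M (R i)
      \<le> \<Lambda> * \<kappa> powr (p - 1) * ((a i * sE i powr (1/p)) * (b i * wE i powr (1/q)))" if i: "i \<in> S" for i
  proof -
    let ?S = "LINT x:R i|M. s x" and ?W = "LINT x:R i|M. w x" and ?r = "measure M (R i)" and ?e = "measure M (E i)"
    have [measurable]: "E i \<in> sets M" using E i by auto
    have r0: "0 < ?r" using R i by auto
    have e0: "0 < ?e" and k0: "0 < \<kappa>"
      using ER[OF i] r0 by (smt (verit) measure_nonneg mult_nonneg_nonpos mult_nonneg_nonneg mult_nonpos_nonneg)+
    have eH: "?e \<le> wE i powr (1/p) * sE i powr (1/q)"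
    proof -
      have p': "(x powr (1/p)) powr p = x" if "0 \<le> x" for x :: real using that p1 by (simp add: powr_powr)
      have q': "(x powr (1/q)) powr q = x" if "0 \<le> x" for x :: real using that q1 by (simp add: powr_powr)
      have 1: "(indicator (E i) x * w x powr (1/p)) * (indicator (E i) x * s x powr (1/q)) = indicator (E i) x" for x
      proof -
        have "(w x * s x powr (p - 1)) powr (1/p) = w x powr (1/p) * s x powr (1/q)"
          using p1 by (simp add: powr_mult powr_powr ce(2))
        then show ?thesis using ws[of x] by (simp split: split_indicator)
      qed
      have 2: "(indicator (E i) x * w x powr (1/p)) powr p = indicator (E i) x *\<^sub>R w x"
        "(indicator (E i) x * s x powr (1/q)) powr q = indicator (E i) x *\<^sub>R s x" for x
        using p' q' w(2)[of x] s(2)[of x] p1 q1 by (auto simp: less_imp_le split: split_indicator)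
      have "(\<integral>x. (indicator (E i) x * w x powr (1/p)) * (indicator (E i) x * s x powr (1/q)) \<partial>M)
        \<le> (\<integral>x. (indicator (E i) x * w x powr (1/p)) powr p \<partial>M) powr (1/p) *
          (\<integral>x. (indicator (E i) x * s x powr (1/q)) powr q \<partial>M) powr (1/q)"
        using siE[OF i] wiE[OF i] unfolding set_integrable_def
        by (intro Holder_integral[OF p1 pq]) (auto simp: 2)
      then show ?thesis unfolding 1 2 wE_def sE_def set_lebesgue_integral_def
        using E(1)[OF i] sets.sets_into_space[OF E(1)[OF i]] by (simp add: Int_absorb2)
    qed
    have sE0: "0 < sE i" and wE0: "0 < wE i"
      using order_less_le_trans[OF e0 eH] sEnn[of i] by (auto simp: less_le)
    have sES: "sE i \<le> ?S" and wEW: "wE i \<le> ?W"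
        unfolding sE_def wE_def set_lebesgue_integral_def
      using E(2)[OF i] s(2) w(2) s(3)[OF i] w(3)[OF i] siE[OF i] wiE[OF i] unfolding set_integrable_def
      by (auto intro!: integral_mono simp: less_imp_le indicator_def)
    have SW: "0 < ?S" "0 < ?W" using sE0 wE0 sES wEW by auto
    have "?S * ?W = (?W * ?S powr (p - 1)) * ?S powr (2 - p)"
    proof -
      have "?S powr (p - 1) * ?S powr (2 - p) = ?S" using SW by (simp flip: powr_add)
      then show ?thesis by (simp add: mult_ac)
    qed
    also have "\<dots> \<le> (\<Lambda> * ?r powr p) * sE i powr (2 - p)"
      using L sES sE0 p by (intro mult_mono[OF ap[OF i]] powr_mono2') auto
    finally have "?S * ?W / ?r \<le> \<Lambda> * ?r powr p / ?r * sE i powr (2 - p)"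
      using r0 by (simp add: divide_right_mono)
    also have "?r powr p / ?r = ?r powr (p - 1)" using r0 by (simp add: powr_diff)
    then have "\<Lambda> * ?r powr p / ?r * sE i powr (2 - p) = \<Lambda> * ?r powr (p - 1) * sE i powr (2 - p)"
      by (metis times_divide_eq_right)
    also have "\<dots> \<le> \<Lambda> * (\<kappa> * (wE i powr (1/p) * sE i powr (1/q))) powr (p - 1) * sE i powr (2 - p)"
      using L r0 p1 k0 order_trans[OF ER[OF i] mult_left_mono[OF eH]]
      by (intro mult_right_mono mult_left_mono powr_mono2) auto
    also have "\<dots> = \<Lambda> * \<kappa> powr (p - 1) * (wE i powr ((p - 1) / p) * (sE i powr ((p - 1) / q) * sE i powr (2 - p)))"
      by (simp add: powr_mult powr_powr mult_ac)
    also have "sE i powr ((p - 1) / q) * sE i powr (2 - p) = sE i powr (1/p)"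
    proof -
      have "(p - 1) / q + (2 - p) = 1/p" using p1 unfolding ce(2) by (simp add: field_simps power2_eq_square)
      then show ?thesis by (simp flip: powr_add)
    qed
    also have "(p - 1) / p = 1/q" using p1 by (simp add: ce(2))
    finally have main: "?S * ?W / ?r \<le> \<Lambda> * \<kappa> powr (p - 1) * (wE i powr (1/q) * sE i powr (1/p))" .
    have "(LINT x:R i|M. s x * f x) * (LINT x:R i|M. w x * g x) / ?r = a i * b i * (?S * ?W / ?r)"
      using SW by (simp add: a_def b_def)
    also have "\<dots> \<le> a i * b i * (\<Lambda> * \<kappa> powr (p - 1) * (wE i powr (1/q) * sE i powr (1/p)))"
      using ann by (intro mult_left_mono[OF main]) auto
    finally show ?thesis by (simp add: mult_ac)
  qed
  have "(\<Sum>i\<in>S. (LINT x:R i|M. s x * f x) * (LINT x:R i|M. w x * g x) / measure M (R i))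
      \<le> (\<Sum>i\<in>S. \<Lambda> * \<kappa> powr (p - 1) * ((a i * sE i powr (1/p)) * (b i * wE i powr (1/q))))"
    by (intro sum_mono tm)
  also have "\<dots> = \<Lambda> * \<kappa> powr (p - 1) * (\<Sum>i\<in>S. (a i * sE i powr (1/p)) * (b i * wE i powr (1/q)))"
    by (simp add: sum_distrib_left)
  also have "\<dots> \<le> \<Lambda> * \<kappa> powr (p - 1) * ((\<Sum>i\<in>S. (a i * sE i powr (1/p)) powr p) powr (1/p) *
      (\<Sum>i\<in>S. (b i * wE i powr (1/q)) powr q) powr (1/q))"
    using ann L by (intro mult_left_mono Holder_sum[OF p1 pq fin]) auto
  also have "(\<Sum>i\<in>S. (a i * sE i powr (1/p)) powr p) = (\<Sum>i\<in>S. sE i * a i powr p)"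
    using sEnn p1 by (simp add: powr_mult powr_powr mult.commute)
  also have "(\<Sum>i\<in>S. (b i * wE i powr (1/q)) powr q) = (\<Sum>i\<in>S. wE i * b i powr q)"
    using sEnn q1 by (simp add: powr_mult powr_powr mult.commute)
  also have "\<Lambda> * \<kappa> powr (p - 1) * ((\<Sum>i\<in>S. sE i * a i powr p) powr (1/p) * (\<Sum>i\<in>S. wE i * b i powr q) powr (1/q))
      \<le> \<Lambda> * \<kappa> powr (p - 1) * ((2 powr p / (p - 1) * (\<integral>x. s x * f x powr p \<partial>M)) powr (1/p) *
         (2 powr q / (q - 1) * (\<integral>x. w x * g x powr q \<partial>M)) powr (1/q))"
    using L p1 q1 sEnn by (intro mult_left_mono mult_mono powr_mono2 A B sum_nonneg) auto
  also have "\<dots> = bilin_const p q * \<kappa> powr (p - 1) * \<Lambda> *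
       ((\<integral>x. s x * f x powr p \<partial>M) powr (1/p) * (\<integral>x. w x * g x powr q \<partial>M) powr (1/q))"
    by (simp only: bilin_const_def powr_mult) (simp only: mult_ac)
  finally show ?thesis .
qed

text \<open>The form does not change if \<open>(p, w, f)\<close> and \<open>(q, s, g)\<close> are exchanged, while the condition on the weights
  becomes its dual with the constant \<open>\<Lambda>\<^bsup>q-1\<^esup>\<close>, where \<open>q - 1 = 1/(p - 1)\<close>.\<close>

lemma sparse_bilinear:
  fixes w s f g :: "'a \<Rightarrow> real"
  assumes p: "1 < p" and pq: "1/p + 1/q = 1" and fin: "finite S" and lam: "laminar_on S R"
    and R: "\<And>i. i \<in> S \<Longrightarrow> R i \<in> sets M" "\<And>i. i \<in> S \<Longrightarrow> 0 < measure M (R i)"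
    and E: "\<And>i. i \<in> S \<Longrightarrow> E i \<in> sets M" "\<And>i. i \<in> S \<Longrightarrow> E i \<subseteq> R i" "disjoint_family_on E S"
    and ER: "\<And>i. i \<in> S \<Longrightarrow> measure M (R i) \<le> \<kappa> * measure M (E i)"
    and w: "w \<in> borel_measurable M" "\<And>x. 0 < w x" "\<And>i. i \<in> S \<Longrightarrow> set_integrable M (R i) w"
    and s: "s \<in> borel_measurable M" "\<And>x. 0 < s x" "\<And>i. i \<in> S \<Longrightarrow> set_integrable M (R i) s"
    and ws: "\<And>x. w x * s x powr (p - 1) = 1"
    and L: "0 \<le> \<Lambda>" and ap: "\<And>i. i \<in> S \<Longrightarrow>
      (LINT x:R i|M. w x) * (LINT x:R i|M. s x) powr (p - 1) \<le> \<Lambda> * measure M (R i) powr p"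
    and f: "f \<in> borel_measurable M" "\<And>x. 0 \<le> f x" "integrable M (\<lambda>x. s x * f x)" "integrable M (\<lambda>x. s x * f x powr p)"
    and g: "g \<in> borel_measurable M" "\<And>x. 0 \<le> g x" "integrable M (\<lambda>x. w x * g x)" "integrable M (\<lambda>x. w x * g x powr q)"
  shows "(\<Sum>i\<in>S. (LINT x:R i|M. s x * f x) * (LINT x:R i|M. w x * g x) / measure M (R i))
     \<le> bilin_const p q * \<kappa> powr (max p q - 1) * \<Lambda> powr (max 1 (1 / (p - 1))) *
       ((\<integral>x. s x * f x powr p \<partial>M) powr (1/p) * (\<integral>x. w x * g x powr q \<partial>M) powr (1/q))"
proof (cases "2 \<le> p")
  case True
  have "q \<le> 2" unfolding conj_exponent(2)[OF p pq] using True by (simp add: field_simps)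
  then have "max p q = p" "max 1 (1 / (p - 1)) = 1"
    using True by (auto simp: max_def field_simps)
  then show ?thesis
    using sparse_bilinear_ge2[OF True pq fin lam R E ER w s ws L ap f g] L by simp
next
  case False
  note ce = conj_exponent[OF p pq]
  have q2: "2 \<le> q" unfolding ce(2) using False p by (simp add: field_simps)
  have m: "max p q = q" "max 1 (1 / (p - 1)) = q - 1"
    using False q2 ce(5) by (auto simp: max_def)
  have qp: "1/q + 1/p = 1" using pq by simp
  have pp: "(p - 1) * (q - 1) = 1" "p * (q - 1) = q" using ce(5) ce(2) p by auto
  have 1: "s x * w x powr (q - 1) = 1" for x
  proof -
    have "(w x * s x powr (p - 1)) powr (q - 1) = 1" using ws by simp
    then show ?thesis using s(2)[of x] pp by (simp add: powr_mult powr_powr mult.commute)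
  qed
  have 2: "(LINT x:R i|M. s x) * (LINT x:R i|M. w x) powr (q - 1) \<le> \<Lambda> powr (q - 1) * measure M (R i) powr q"
    if i: "i \<in> S" for i
  proof -
    have nn: "0 \<le> (LINT x:R i|M. w x)" "0 \<le> (LINT x:R i|M. s x)"
      unfolding set_lebesgue_integral_def
      using w s by (auto intro!: Bochner_Integration.integral_nonneg simp: less_imp_le)
    have "((LINT x:R i|M. w x) * (LINT x:R i|M. s x) powr (p - 1)) powr (q - 1)
        \<le> (\<Lambda> * measure M (R i) powr p) powr (q - 1)"
      using nn ce(1) by (intro powr_mono2 ap i) auto
    then show ?thesis using nn pp by (simp add: powr_mult powr_powr mult.commute)
  qed
  have "(\<Sum>i\<in>S. (LINT x:R i|M. w x * g x) * (LINT x:R i|M. s x * f x) / measure M (R i))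
     \<le> bilin_const q p * \<kappa> powr (q - 1) * \<Lambda> powr (q - 1) *
       ((\<integral>x. w x * g x powr q \<partial>M) powr (1/q) * (\<integral>x. s x * f x powr p \<partial>M) powr (1/p))"
    by (rule sparse_bilinear_ge2[OF q2 qp fin lam R E ER s w 1 _ 2 g f]) auto
  then show ?thesis unfolding m by (simp add: mult_ac bilin_const_def)
qed

section \<open>Dyadic cubes\<close>

lemma nn_integral_disjoint_UN:
  fixes f :: "'a \<Rightarrow> ennreal"
  assumes [measurable]: "f \<in> borel_measurable M" and "countable P"
    and A: "\<And>p. p \<in> P \<Longrightarrow> A p \<in> sets M" and "disjoint_family_on A P"
  shows "(\<integral>\<^sup>+x\<in>\<Union>(A ` P). f x \<partial>M) = (\<integral>\<^sup>+p. (\<integral>\<^sup>+x\<in>A p. f x \<partial>M) \<partial>count_space P)"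
proof -
  have U: "\<Union>(A ` P) \<in> sets M" using assms by (intro sets.countable_UN') auto
  have "(\<integral>\<^sup>+x\<in>\<Union>(A ` P). f x \<partial>M) = emeasure (density M f) (\<Union>(A ` P))"
    using U by (simp add: emeasure_density)
  also have "\<dots> = (\<integral>\<^sup>+p. emeasure (density M f) (A p) \<partial>count_space P)"
    using assms by (intro emeasure_UN_countable) auto
  also have "\<dots> = (\<integral>\<^sup>+p. (\<integral>\<^sup>+x\<in>A p. f x \<partial>M) \<partial>count_space P)"
    using A by (intro nn_integral_cong) (simp add: emeasure_density)
  finally show ?thesis .
qed

lemma nn_integral_disjoint_UN_mono:
  fixes f g :: "'a \<Rightarrow> ennreal"
  assumes "f \<in> borel_measurable M" "g \<in> borel_measurable M" "countable P"
    and "\<And>p. p \<in> P \<Longrightarrow> A p \<in> sets M" "disjoint_family_on A P"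
    and "\<And>p. p \<in> P \<Longrightarrow> (\<integral>\<^sup>+x\<in>A p. f x \<partial>M) \<le> (\<integral>\<^sup>+x\<in>A p. g x \<partial>M)"
  shows "(\<integral>\<^sup>+x\<in>\<Union>(A ` P). f x \<partial>M) \<le> (\<integral>\<^sup>+x\<in>\<Union>(A ` P). g x \<partial>M)"
proof -
  have eq: "(\<integral>\<^sup>+x\<in>\<Union>(A ` P). h x \<partial>M) = (\<integral>\<^sup>+p. (\<integral>\<^sup>+x\<in>A p. h x \<partial>M) \<partial>count_space P)"
    if "h \<in> borel_measurable M" for h :: "'a \<Rightarrow> ennreal"
    using assms that by (intro nn_integral_disjoint_UN) auto
  show ?thesis unfolding eq[OF assms(1)] eq[OF assms(2)]
    using assms(6) by (rule nn_integral_mono) simp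
qed

lemma emeasure_UN_le_count:
  assumes P: "countable P" and A: "\<And>p. p \<in> P \<Longrightarrow> A p \<in> sets M"
  shows "emeasure M (\<Union>(A ` P)) \<le> (\<integral>\<^sup>+p. emeasure M (A p) \<partial>count_space P)"
proof -
  have U: "\<Union>(A ` P) \<in> sets M" using assms by (intro sets.countable_UN') auto
  have "emeasure M (\<Union>(A ` P)) = (\<integral>\<^sup>+x. indicator (\<Union>(A ` P)) x \<partial>M)" using U by simp
  also have "\<dots> \<le> (\<integral>\<^sup>+x. (\<integral>\<^sup>+p. indicator (A p) x \<partial>count_space P) \<partial>M)"
  proof (intro nn_integral_mono)
    fix x
    show "(indicator (\<Union>(A ` P)) x :: ennreal) \<le> (\<integral>\<^sup>+p. indicator (A p) x \<partial>count_space P)"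
    proof (cases "\<exists>p\<in>P. x \<in> A p")
      case True
      then obtain p where "p \<in> P" "x \<in> A p" by auto
      then show ?thesis
        using nn_integral_ge_point[of p P "\<lambda>p. indicator (A p) x"]
        by (auto simp: indicator_def)
    next
      case False
      then have "x \<notin> \<Union>(A ` P)" by auto
      then show ?thesis by simp
    qed
  qed
  also have "\<dots> = (\<integral>\<^sup>+p. (\<integral>\<^sup>+x. indicator (A p) x \<partial>M) \<partial>count_space P)"
    using assms by (intro nn_integral_count_space_nn_integral) auto
  also have "\<dots> = (\<integral>\<^sup>+p. emeasure M (A p) \<partial>count_space P)"
    using A by (intro nn_integral_cong) simp
  finally show ?thesis .
qed

type_synonym 'n gidx = "nat \<times> ('n \<Rightarrow> int)"

text \<open>Cubes are addressed by their generation and integer coordinates. The addresses form a countable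
  type, and passing to a coarser generation is integer division of the coordinates.\<close>

locale dyadic_grid =
  fixes L :: real and z :: "real^'n::finite"
  assumes L_pos: "0 < L"
begin

definition idx :: "nat \<Rightarrow> real^'n \<Rightarrow> 'n gidx" where
  "idx k x = (k, \<lambda>i. \<lfloor>2^k * (x$i / L - z$i)\<rfloor>)"

definition cube :: "'n gidx \<Rightarrow> (real^'n) set" where
  "cube p = {x. idx (fst p) x = p}"

definition triple :: "'n gidx \<Rightarrow> (real^'n) set" where
  "triple p = {x. \<forall>i. \<bar>snd (idx (fst p) x) i - snd p i\<bar> \<le> 1}"

definition side :: "'n gidx \<Rightarrow> real" where
  "side p = L / 2 ^ fst p"

definition vol :: "'n gidx \<Rightarrow> real" where
  "vol p = side p ^ CARD('n)"

definition corner :: "'n gidx \<Rightarrow> real^'n" where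
  "corner p = (\<chi> i. L * (z$i + of_int (snd p i) / 2 ^ fst p))"

lemma fst_idx [simp]: "fst (idx k x) = k" by (simp add: idx_def)

lemma side_pos [simp]: "0 < side p" using L_pos by (simp add: side_def)

lemma side_nn [simp]: "0 \<le> side p" using side_pos less_imp_le by blast

lemma vol_pos [simp]: "0 < vol p" by (simp add: vol_def)

lemma vol_nn [simp]: "0 \<le> vol p" using vol_pos less_imp_le by blast

lemma mem_cube_idx [simp]: "x \<in> cube (idx k x)" by (simp add: cube_def)

lemma cube_eq: "x \<in> cube p \<Longrightarrow> idx (fst p) x = p" by (simp add: cube_def)

lemma coord_floor:
  "2^k * (t / L - s) \<ge> of_int m \<longleftrightarrow> L * (s + of_int m / 2^k) \<le> (t::real)"
  "2^k * (t / L - s) < of_int m \<longleftrightarrow> t < L * (s + of_int m / 2^k)"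
proof -
  have "2^k * (t / L - s) \<ge> of_int m \<longleftrightarrow> of_int m / 2^k \<le> t / L - s" by (simp add: field_simps)
  also have "\<dots> \<longleftrightarrow> (s + of_int m / 2^k) \<le> t / L" by linarith
  also have "\<dots> \<longleftrightarrow> L * (s + of_int m / 2^k) \<le> t" using L_pos
    by (simp add: pos_le_divide_eq mult.commute)
  finally show 1: "2^k * (t / L - s) \<ge> of_int m \<longleftrightarrow> L * (s + of_int m / 2^k) \<le> t" .
  then show "2^k * (t / L - s) < of_int m \<longleftrightarrow> t < L * (s + of_int m / 2^k)" by linarith
qed

lemma cube_iff: "x \<in> cube p \<longleftrightarrow> (\<forall>i. corner p $ i \<le> x $ i \<and> x $ i < corner p $ i + side p)"
proof -
  have "x \<in> cube p \<longleftrightarrow> (\<forall>i. \<lfloor>2^fst p * (x$i / L - z$i)\<rfloor> = snd p i)"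
    by (auto simp: cube_def idx_def prod_eq_iff fun_eq_iff)
  also have "\<dots> \<longleftrightarrow> (\<forall>i. of_int (snd p i) \<le> 2^fst p * (x$i / L - z$i) \<and> 2^fst p * (x$i / L - z$i) < of_int (snd p i + 1))"
    by (simp add: floor_eq_iff)
  also have "\<dots> \<longleftrightarrow> (\<forall>i. corner p $ i \<le> x $ i \<and> x $ i < corner p $ i + side p)"
    unfolding coord_floor by (simp add: corner_def side_def algebra_simps add_divide_distrib)
  finally show ?thesis .
qed

lemma triple_iff: "x \<in> triple p \<longleftrightarrow> (\<forall>i. corner p $ i - side p \<le> x $ i \<and> x $ i < corner p $ i + 2 * side p)"
proof -
  have "x \<in> triple p \<longleftrightarrow> (\<forall>i. snd p i - 1 \<le> \<lfloor>2^fst p * (x$i / L - z$i)\<rfloor> \<and> \<lfloor>2^fst p * (x$i / L - z$i)\<rfloor> < snd p i + 2)"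
    unfolding triple_def idx_def by (auto simp: abs_le_iff) (smt (verit))+
  also have "\<dots> \<longleftrightarrow> (\<forall>i. of_int (snd p i - 1) \<le> 2^fst p * (x$i / L - z$i) \<and> 2^fst p * (x$i / L - z$i) < of_int (snd p i + 2))"
    by (simp only: le_floor_iff floor_less_iff)
  also have "\<dots> \<longleftrightarrow> (\<forall>i. corner p $ i - side p \<le> x $ i \<and> x $ i < corner p $ i + 2 * side p)"
    unfolding coord_floor by (simp add: corner_def side_def algebra_simps add_divide_distrib diff_divide_distrib)
  finally show ?thesis .
qed

lemma cube_subset_triple: "cube p \<subseteq> triple p"
  by (auto simp: cube_def triple_def)

lemma idx_coarser:
  assumes "j \<le> k" shows "snd (idx j x) i = snd (idx k x) i div 2^(k - j)"
proof -
  have "2^k = (2::real)^j * 2^(k-j)" using assms by (simp flip: power_add)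
  then have "2^j * (x$i / L - z$i) = (2^k * (x$i / L - z$i)) / real_of_int (2^(k-j))" by simp
  then show ?thesis unfolding idx_def snd_conv by (simp only: floor_divide_real_eq_div zero_le_power zero_le_numeral)
qed

lemma idx_coarser_cong:
  assumes "j \<le> k" "idx k x = idx k y" shows "idx j x = idx j y"
  using idx_coarser[OF assms(1), of x] idx_coarser[OF assms(1), of y] assms(2)
  by (auto simp: prod_eq_iff fun_eq_iff)

lemma cube_nested:
  assumes "x \<in> cube p" "x \<in> cube q" "fst p \<le> fst q"
  shows "cube q \<subseteq> cube p"
proof
  fix y assume "y \<in> cube q"
  then have "idx (fst q) x = idx (fst q) y" using assms by (simp add: cube_def)
  then have "idx (fst p) x = idx (fst p) y" using assms(3) idx_coarser_cong by blast
  then show "y \<in> cube p" using assms by (simp add: cube_def)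
qed

lemma triple_nested:
  assumes "x \<in> cube p" "x \<in> cube q" "fst p \<le> fst q"
  shows "triple q \<subseteq> triple p"
proof
  fix y assume y: "y \<in> triple q"
  let ?d = "2^(fst q - fst p) :: int"
  have xp: "snd p i = snd q i div ?d" for i
    using idx_coarser[OF assms(3), of x i] assms(1,2) by (simp add: cube_def)
  have D: "?d \<ge> 1" by simp
  have aux: "a div ?d \<le> b div ?d + 1" if "a \<le> b + 1" for a b
  proof -
    have "a div ?d \<le> (b + ?d) div ?d" using that D by (intro zdiv_mono1) linarith+
    then show ?thesis by simp
  qed
  show "y \<in> triple p" unfolding triple_def
  proof (clarsimp)
    fix i
    have "\<bar>snd (idx (fst q) y) i - snd q i\<bar> \<le> 1" using y by (simp add: triple_def)
    then have "snd (idx (fst q) y) i \<le> snd q i + 1" "snd q i \<le> snd (idx (fst q) y) i + 1" by linarith+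
    from this[THEN aux] show "\<bar>snd (idx (fst p) y) i - snd p i\<bar> \<le> 1"
      unfolding xp idx_coarser[OF assms(3), of y] by linarith
  qed
qed

lemma cubes_disjoint_or_eq:
  assumes "x \<in> cube p" "x \<in> cube q" "fst p = fst q" shows "p = q"
  using assms by (metis cube_eq)

lemma cube_laminar: "laminar_on S cube"
  unfolding laminar_on_def using cube_nested by (metis disjoint_iff nle_le)

lemma box_cube_cbox:
  "box (corner p) (\<chi> i. corner p $ i + side p) \<subseteq> cube p" "cube p \<subseteq> cbox (corner p) (\<chi> i. corner p $ i + side p)"
  by (auto simp: cube_iff mem_box_cart less_imp_le)

lemma vol_neq_0 [simp]: "vol p \<noteq> 0" using vol_pos[of p] by linarith

lemma measurable_halfopen: "{x::real^'n. \<forall>i. a $ i \<le> x $ i \<and> x $ i < b $ i} \<in> sets lebesgue"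
proof -
  have "{x::real^'n. \<forall>i. a $ i \<le> x $ i \<and> x $ i < b $ i} = (\<Inter>i. {x. a $ i \<le> x $ i} \<inter> {x. x $ i < b $ i})" by auto
  also have "\<dots> \<in> sets borel"
    by (intro sets.countable_INT'' sets.Int borel_closed borel_open closed_halfspace_component_ge_cart open_halfspace_component_lt_cart) auto
  finally show ?thesis by simp
qed

lemma cube_measurable [measurable, simp]: "cube p \<in> sets lebesgue"
proof -
  have "cube p = {x. \<forall>i. corner p $ i \<le> x $ i \<and> x $ i < (\<chi> i. corner p $ i + side p) $ i}"
    by (auto simp: cube_iff)
  then show ?thesis using measurable_halfopen by (rule ssubst)
qed

lemma triple_measurable [measurable, simp]: "triple p \<in> sets lebesgue"
proof -
  have "triple p = {x. \<forall>i. (\<chi> i. corner p $ i - side p) $ i \<le> x $ i \<and> x $ i < (\<chi> i. corner p $ i + 2 * side p) $ i}"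
    by (auto simp: triple_iff)
  then show ?thesis using measurable_halfopen by (rule ssubst)
qed

lemma bounded_triple: "bounded (triple p)"
proof (rule bounded_subset[OF bounded_cbox])
  show "triple p \<subseteq> cbox (\<chi> i. corner p $ i - side p) (\<chi> i. corner p $ i + 2 * side p)"
    by (auto simp: triple_iff mem_box_cart less_imp_le)
qed

lemma bounded_cube: "bounded (cube p)"
  using bounded_subset[OF bounded_triple cube_subset_triple] .

lemma emeasure_cube_side:
  fixes a :: "real^'n" assumes "0 \<le> l"
  shows "emeasure lebesgue (cbox a (\<chi> i. a $ i + l)) = ennreal (l ^ CARD('n))"
    "emeasure lebesgue (box a (\<chi> i. a $ i + l)) = ennreal (l ^ CARD('n))"
proof -
  have P: "(\<Prod>b\<in>Basis. ((\<chi> i. a $ i + l) - a) \<bullet> b) = l ^ CARD('n)"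
  proof -
    have "(\<Prod>b\<in>Basis. ((\<chi> i. a $ i + l) - a) \<bullet> b) = (\<Prod>b\<in>(Basis :: (real^'n) set). l)"
      by (intro prod.cong) (auto simp: Basis_vec_def inner_axis algebra_simps)
    then show ?thesis by simp
  qed
  have le: "a \<bullet> b \<le> (\<chi> i. a $ i + l) \<bullet> b" if "b \<in> Basis" for b :: "real^'n"
    using that assms by (auto simp: Basis_vec_def inner_axis)
  show "emeasure lebesgue (cbox a (\<chi> i. a $ i + l)) = ennreal (l ^ CARD('n))"
    using le P by (simp add: emeasure_lborel_cbox_eq)
  show "emeasure lebesgue (box a (\<chi> i. a $ i + l)) = ennreal (l ^ CARD('n))"
    using le P by (simp add: emeasure_lborel_box_eq)
qed

lemma emeasure_cube: "emeasure lebesgue (cube p) = ennreal (vol p)"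
proof (rule antisym)
  show "emeasure lebesgue (cube p) \<le> ennreal (vol p)"
    using emeasure_mono[OF box_cube_cbox(2)[of p], of lebesgue] emeasure_cube_side(1)[of "side p" "corner p"]
    by (simp add: vol_def)
  show "ennreal (vol p) \<le> emeasure lebesgue (cube p)"
    using emeasure_mono[OF box_cube_cbox(1)[of p], of lebesgue] emeasure_cube_side(2)[of "side p" "corner p"]
    by (simp add: vol_def)
qed

lemma measure_cube [simp]: "measure lebesgue (cube p) = vol p"
  by (simp add: measure_def emeasure_cube)

lemma norm_cube:
  assumes "x \<in> cube p" "y \<in> cube p" shows "norm (x - y) \<le> real CARD('n) * side p"
proof -
  have "norm (x - y) \<le> (\<Sum>i\<in>UNIV. \<bar>(x - y) $ i\<bar>)" by (rule norm_le_l1_cart)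
  also have "\<dots> \<le> (\<Sum>i\<in>(UNIV::'n set). side p)"
  proof (rule sum_mono)
    fix i
    have "corner p $ i \<le> x $ i \<and> x $ i < corner p $ i + side p" "corner p $ i \<le> y $ i \<and> y $ i < corner p $ i + side p"
      using assms by (simp_all add: cube_iff)
    then show "\<bar>(x - y) $ i\<bar> \<le> side p" unfolding vector_minus_component by linarith
  qed
  finally show ?thesis by simp
qed

lemma corner_mem [simp]: "corner p \<in> cube p" by (simp add: cube_iff)

lemma norm_off_triple:
  assumes "x \<in> cube p" "y \<notin> triple p" shows "side p \<le> norm (x - y)"
proof -
  obtain i where i: "\<not> (corner p $ i - side p \<le> y $ i \<and> y $ i < corner p $ i + 2 * side p)"
    using assms(2) by (auto simp: triple_iff)
  have "corner p $ i \<le> x $ i \<and> x $ i < corner p $ i + side p" using assms(1) by (simp add: cube_iff)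
  then have "side p \<le> \<bar>(x - y) $ i\<bar>" using i side_pos[of p] unfolding vector_minus_component by linarith
  also have "\<dots> \<le> norm (x - y)" by (rule component_le_norm_cart)
  finally show ?thesis .
qed

lemma norm_triple:
  assumes "x \<in> triple p" "y \<in> triple p" shows "norm (x - y) \<le> real CARD('n) * (3 * side p)"
proof -
  have "norm (x - y) \<le> (\<Sum>i\<in>UNIV. \<bar>(x - y) $ i\<bar>)" by (rule norm_le_l1_cart)
  also have "\<dots> \<le> (\<Sum>i\<in>(UNIV::'n set). 3 * side p)"
  proof (rule sum_mono)
    fix i
    have "corner p $ i - side p \<le> x $ i \<and> x $ i < corner p $ i + 2 * side p"
      "corner p $ i - side p \<le> y $ i \<and> y $ i < corner p $ i + 2 * side p"
      using assms by (simp_all add: triple_iff)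
    then show "\<bar>(x - y) $ i\<bar> \<le> 3 * side p" unfolding vector_minus_component by linarith
  qed
  finally show ?thesis by simp
qed

text \<open>A point is sent to the first generation at which its cube satisfies \<open>G\<close>. All points of that cube
  share the same coarser cubes and hence the same stopping generation, so the selected cubes are disjoint.\<close>

lemma stopping_family:
  obtains P where "\<And>p. p \<in> P \<Longrightarrow> G p \<and> k0 \<le> fst p \<and> (\<exists>x\<in>cube p. \<forall>j\<ge>k0. j < fst p \<longrightarrow> \<not> G (idx j x))"
    and "disjoint_family_on cube P" and "\<Union>(cube ` P) = {x. \<exists>k\<ge>k0. G (idx k x)}"
proof -
  define Om where "Om = {x. \<exists>k\<ge>k0. G (idx k x)}"
  define \<kappa> where "\<kappa> x = (LEAST k. k \<ge> k0 \<and> G (idx k x))" for x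
  define P where "P = (\<lambda>x. idx (\<kappa> x) x) ` Om"
  have \<kappa>: "\<kappa> x \<ge> k0" "G (idx (\<kappa> x) x)" "\<And>j. j \<ge> k0 \<Longrightarrow> j < \<kappa> x \<Longrightarrow> \<not> G (idx j x)" if "x \<in> Om" for x
  proof -
    have ex: "\<exists>k. k \<ge> k0 \<and> G (idx k x)" using that by (auto simp: Om_def)
    show "\<kappa> x \<ge> k0" "G (idx (\<kappa> x) x)" using LeastI_ex[OF ex] by (auto simp: \<kappa>_def)
    show "\<not> G (idx j x)" if "j \<ge> k0" "j < \<kappa> x" for j
      using not_less_Least[of j "\<lambda>k. k \<ge> k0 \<and> G (idx k x)"] that by (auto simp: \<kappa>_def)
  qed
  have same: "\<kappa> y = \<kappa> x" "y \<in> Om" if x: "x \<in> Om" and y: "y \<in> cube (idx (\<kappa> x) x)" for x y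
  proof -
    have e: "idx (\<kappa> x) y = idx (\<kappa> x) x" using y by (simp add: cube_def)
    have ej: "idx j y = idx j x" if "j \<le> \<kappa> x" for j using idx_coarser_cong[OF that e] .
    show yO: "y \<in> Om" using \<kappa>[OF x] e by (auto simp: Om_def intro!: exI[of _ "\<kappa> x"])
    show "\<kappa> y = \<kappa> x"
    proof (rule antisym)
      show "\<kappa> y \<le> \<kappa> x" using \<kappa>(3)[OF yO, of "\<kappa> x"] \<kappa>(1,2)[OF x] e by (metis not_le)
      show "\<kappa> x \<le> \<kappa> y" using \<kappa>(3)[OF x, of "\<kappa> y"] \<kappa>(1,2)[OF yO] ej by (metis not_le less_imp_le)
    qed
  qed
  show thesis
  proof (rule that[of P])
    fix p assume "p \<in> P"
    then obtain x where x: "x \<in> Om" "p = idx (\<kappa> x) x" by (auto simp: P_def)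
    then show "G p \<and> k0 \<le> fst p \<and> (\<exists>x\<in>cube p. \<forall>j\<ge>k0. j < fst p \<longrightarrow> \<not> G (idx j x))"
      using \<kappa>[OF x(1)] by (auto intro!: bexI[of _ x])
  next
    show "disjoint_family_on cube P" unfolding disjoint_family_on_def
    proof (intro ballI impI)
      fix p q assume "p \<in> P" "q \<in> P" "p \<noteq> q"
      then obtain x y where xy: "x \<in> Om" "p = idx (\<kappa> x) x" "y \<in> Om" "q = idx (\<kappa> y) y" by (auto simp: P_def)
      show "cube p \<inter> cube q = {}"
      proof (rule ccontr)
        assume "cube p \<inter> cube q \<noteq> {}"
        then obtain u where u: "u \<in> cube p" "u \<in> cube q" by auto
        have kx: "\<kappa> u = \<kappa> x" using same(1)[OF xy(1)] u(1) xy(2) by blast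
        have ky: "\<kappa> u = \<kappa> y" using same(1)[OF xy(3)] u(2) xy(4) by blast
        have "fst p = \<kappa> u" using xy(2) kx by (metis fst_idx)
        moreover have "fst q = \<kappa> u" using xy(4) ky by (metis fst_idx)
        ultimately have "p = q" using u by (intro cubes_disjoint_or_eq) auto
        then show False using \<open>p \<noteq> q\<close> by simp
      qed
    qed
  next
    show "\<Union>(cube ` P) = {x. \<exists>k\<ge>k0. G (idx k x)}"
      unfolding Om_def[symmetric]
    proof
      show "\<Union>(cube ` P) \<subseteq> Om" using same(2) by (auto simp: P_def)
      show "Om \<subseteq> \<Union>(cube ` P)" using mem_cube_idx by (fastforce simp: P_def)
    qed
  qed
qed

lemma cube_small_in_open:
  assumes "open U" "x \<in> U" obtains k where "k \<ge> k0" "cube (idx k x) \<subseteq> U"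
proof -
  obtain e where e: "e > 0" "ball x e \<subseteq> U" using assms open_contains_ball by blast
  obtain k where k: "real CARD('n) * L / e < 2 ^ k" using real_arch_pow[of 2] by auto
  let ?k = "max k k0"
  have "(2::real) ^ k \<le> 2 ^ ?k" by (intro power_increasing) auto
  then have "real CARD('n) * L / e < 2 ^ ?k" using k by linarith
  then have "real CARD('n) * (L / 2 ^ ?k) < e" using e by (simp add: field_simps)
  then have s: "real CARD('n) * side (idx ?k x) < e" by (simp add: side_def)
  have "cube (idx ?k x) \<subseteq> ball x e"
  proof
    fix y assume "y \<in> cube (idx ?k x)"
    then have "norm (x - y) \<le> real CARD('n) * side (idx ?k x)" by (intro norm_cube) auto
    then show "y \<in> ball x e" using s by (simp add: dist_norm)
  qed
  then show thesis using e by (intro that[of ?k]) auto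
qed

text \<open>The part of Lebesgue's differentiation theorem that the stopping argument needs. Cover \<open>B\<close> by an open set \<open>U\<close>
  of almost the same measure and consider the first dyadic cubes inside \<open>U\<close> that meet \<open>B\<close>. They cover \<open>B\<close>,
  and the mean of \<open>F\<close> over each of them is at most \<open>lam\<close>, although \<open>F\<close> exceeds \<open>lam\<close> by \<open>\<epsilon>\<close> on \<open>B\<close>.\<close>

lemma dyadic_density_null:
  fixes F :: "real^'n \<Rightarrow> ennreal"
  assumes [measurable]: "F \<in> borel_measurable lebesgue" "B \<in> sets lebesgue"
    and fin: "emeasure lebesgue B < \<infinity>" and lam0: "0 < lam" and eps: "0 < \<epsilon>"
    and avg: "\<And>x k. x \<in> B \<Longrightarrow> k \<ge> k0 \<Longrightarrow> (\<integral>\<^sup>+y\<in>cube (idx k x). F y \<partial>lebesgue) \<le> ennreal (lam * vol (idx k x))"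
    and big: "\<And>x. x \<in> B \<Longrightarrow> ennreal (lam + \<epsilon>) \<le> F x"
  shows "emeasure lebesgue B = 0"
proof -
  define b where "b = measure lebesgue B"
  have b: "emeasure lebesgue B = ennreal b" using fin by (simp add: b_def emeasure_eq_ennreal_measure)
  have b0: "0 \<le> b" by (simp add: b_def)
  have key: "(lam + \<epsilon>) * b \<le> lam * (b + \<delta>)" if \<delta>: "\<delta> > 0" for \<delta>
  proof -
    obtain U where U: "open U" "B \<subseteq> U" "emeasure lebesgue (U - B) < ennreal \<delta>"
      by (rule sets_lebesgue_outer_open[OF assms(2) \<delta>]) (rule that)
    define G where "G p \<longleftrightarrow> cube p \<subseteq> U \<and> cube p \<inter> B \<noteq> {}" for p
    obtain P where P': "\<And>p. p \<in> P \<Longrightarrow> G p \<and> k0 \<le> fst p \<and> (\<exists>x\<in>cube p. \<forall>j\<ge>k0. j < fst p \<longrightarrow> \<not> G (idx j x))"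
      and dis: "disjoint_family_on cube P" and Un: "\<Union>(cube ` P) = {x. \<exists>k\<ge>k0. G (idx k x)}"
      by (rule stopping_family[of G k0]) (rule that)
    have P: "cube p \<subseteq> U" "cube p \<inter> B \<noteq> {}" "k0 \<le> fst p" if "p \<in> P" for p
      using P'[OF that] by (auto simp: G_def)
    have cP: "countable P" by (rule countable_subset[OF subset_UNIV]) simp
    have BU: "B \<subseteq> \<Union>(cube ` P)"
    proof
      fix x assume x: "x \<in> B"
      then have "x \<in> U" using U by auto
      then obtain k where "k \<ge> k0" "cube (idx k x) \<subseteq> U" by (rule cube_small_in_open[OF U(1)])
      then show "x \<in> \<Union>(cube ` P)" unfolding Un G_def using x mem_cube_idx by blast
    qed
    have [measurable]: "\<Union>(cube ` P) \<in> sets lebesgue" using cP by (intro sets.countable_UN') auto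
    have "ennreal ((lam + \<epsilon>) * b) = (\<integral>\<^sup>+x. ennreal (lam + \<epsilon>) * indicator B x \<partial>lebesgue)"
      using lam0 eps b0 by (simp add: nn_integral_cmult_indicator b ennreal_mult)
    also have "\<dots> \<le> (\<integral>\<^sup>+x\<in>\<Union>(cube ` P). F x \<partial>lebesgue)"
      using big BU by (intro nn_integral_mono) (auto simp: indicator_def)
    also have "\<dots> \<le> (\<integral>\<^sup>+x\<in>\<Union>(cube ` P). ennreal lam \<partial>lebesgue)"
    proof (rule nn_integral_disjoint_UN_mono[OF _ _ cP _ dis])
      fix p assume p: "p \<in> P"
      then obtain x where x: "x \<in> cube p" "x \<in> B" using P by blast
      then have "(\<integral>\<^sup>+y\<in>cube p. F y \<partial>lebesgue) \<le> ennreal (lam * vol p)"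
        using avg[OF x(2), of "fst p"] P[OF p] x(1) by (simp add: cube_def)
      then show "(\<integral>\<^sup>+y\<in>cube p. F y \<partial>lebesgue) \<le> (\<integral>\<^sup>+y\<in>cube p. ennreal lam \<partial>lebesgue)"
        using lam0 by (simp add: nn_integral_cmult_indicator emeasure_cube ennreal_mult)
    qed auto
    also have "\<dots> = ennreal lam * emeasure lebesgue (\<Union>(cube ` P))" by (simp add: nn_integral_cmult_indicator)
    also have "\<dots> \<le> ennreal lam * emeasure lebesgue U"
      using P(1) U(1) by (intro mult_left_mono emeasure_mono) auto
    also have "emeasure lebesgue U = emeasure lebesgue B + emeasure lebesgue (U - B)"
      using U(1,2) by (subst plus_emeasure) (auto simp: Un_absorb1)
    also have "ennreal lam * \<dots> \<le> ennreal lam * (ennreal b + ennreal \<delta>)"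
      using U(3) by (intro mult_left_mono add_mono) (auto simp: b)
    also have "\<dots> = ennreal (lam * (b + \<delta>))"
      using lam0 b0 \<delta> by (simp add: ennreal_mult[symmetric] ennreal_plus[symmetric] del: ennreal_plus)
    finally show ?thesis using lam0 b0 \<delta> by (subst (asm) ennreal_le_iff) auto
  qed
  have "b = 0"
  proof (rule ccontr)
    assume "b \<noteq> 0"
    then have "b > 0" using b0 by simp
    then have "(lam + \<epsilon>) * b \<le> lam * (b + \<epsilon> * b / (2 * lam))" using eps lam0 by (intro key) auto
    also have "\<dots> = lam * b + \<epsilon> * b / 2" using lam0 by (simp add: field_simps)
    finally have "\<epsilon> * b \<le> 0" by (simp add: algebra_simps)
    then show False using eps \<open>b > 0\<close> by (simp add: mult_le_0_iff)
  qed
  then show ?thesis using b by simp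
qed

text \<open>The cubes at which the mean of \<open>F\<close> first exceeds \<open>lam\<close>. The factor \<open>2\<^sup>n\<close> is the ratio of the volume of
  the parent, which was not selected, to that of the cube.\<close>

lemma calderon_zygmund_cubes:
  fixes F :: "real^'n \<Rightarrow> ennreal"
  assumes [measurable]: "F \<in> borel_measurable lebesgue" and lam0: "0 < lam"
    and top: "\<And>x. (\<integral>\<^sup>+y\<in>cube (idx k0 x). F y \<partial>lebesgue) \<le> ennreal (lam * vol (idx k0 x))"
  obtains P where "\<And>p. p \<in> P \<Longrightarrow> k0 < fst p"
    and "\<And>p. p \<in> P \<Longrightarrow> ennreal (lam * vol p) < (\<integral>\<^sup>+y\<in>cube p. F y \<partial>lebesgue)"
    and "\<And>p. p \<in> P \<Longrightarrow> (\<integral>\<^sup>+y\<in>cube p. F y \<partial>lebesgue) \<le> ennreal (2 ^ CARD('n) * lam * vol p)"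
    and "disjoint_family_on cube P"
    and "AE x in lebesgue. x \<notin> \<Union>(cube ` P) \<longrightarrow> F x \<le> ennreal lam"
proof -
  define G where "G p \<longleftrightarrow> ennreal (lam * vol p) < (\<integral>\<^sup>+y\<in>cube p. F y \<partial>lebesgue)" for p
  obtain P where P: "\<And>p. p \<in> P \<Longrightarrow> G p \<and> k0 \<le> fst p \<and> (\<exists>x\<in>cube p. \<forall>j\<ge>k0. j < fst p \<longrightarrow> \<not> G (idx j x))"
    and dis: "disjoint_family_on cube P" and Un: "\<Union>(cube ` P) = {x. \<exists>k\<ge>k0. G (idx k x)}"
    by (rule stopping_family[of G k0]) (rule that)
  have cP: "countable P" by (rule countable_subset[OF subset_UNIV]) simp
  have [measurable]: "\<Union>(cube ` P) \<in> sets lebesgue" using cP by (intro sets.countable_UN') auto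
  have gt: "k0 < fst p" if "p \<in> P" for p
  proof -
    have "fst p \<noteq> k0"
    proof
      assume e: "fst p = k0"
      obtain x where "x \<in> cube p" using P[OF \<open>p \<in> P\<close>] by auto
      then have "p = idx k0 x" using e by (simp add: cube_def)
      then show False using P[OF \<open>p \<in> P\<close>] leD[OF top[of x]] by (simp add: G_def)
    qed
    then show ?thesis using P[OF that] by simp
  qed
  show thesis
  proof (rule that[of P])
    show "ennreal (lam * vol p) < (\<integral>\<^sup>+y\<in>cube p. F y \<partial>lebesgue)" if "p \<in> P" for p
      using P[OF that] by (simp add: G_def)
    show "(\<integral>\<^sup>+y\<in>cube p. F y \<partial>lebesgue) \<le> ennreal (2 ^ CARD('n) * lam * vol p)" if pP: "p \<in> P" for p
    proof -
      obtain x where x: "x \<in> cube p" "\<forall>j\<ge>k0. j < fst p \<longrightarrow> \<not> G (idx j x)" using P[OF pP] by auto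
      let ?q = "idx (fst p - 1) x"
      have lt: "k0 \<le> fst p - 1" "fst p - 1 < fst p" using gt[OF pP] by auto
      have "(\<integral>\<^sup>+y\<in>cube p. F y \<partial>lebesgue) \<le> (\<integral>\<^sup>+y\<in>cube ?q. F y \<partial>lebesgue)"
        using cube_nested[of x ?q p] x(1) by (intro nn_integral_mono) (auto simp: indicator_def)
      also have "\<dots> \<le> ennreal (lam * vol ?q)" using x(2) lt by (auto simp: G_def not_less)
      also have "vol ?q = 2 ^ CARD('n) * vol p"
      proof -
        have "side ?q = 2 * side p" using lt power_Suc[of "2::real" "fst p - 1"] by (simp add: side_def)
        then show ?thesis by (simp add: vol_def power_mult_distrib)
      qed
      finally show ?thesis by (simp add: mult_ac)
    qed
    show "AE x in lebesgue. x \<notin> \<Union>(cube ` P) \<longrightarrow> F x \<le> ennreal lam"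
    proof -
      define B where "B p i = {x \<in> cube p. x \<notin> \<Union>(cube ` P) \<and> ennreal (lam + inverse (real (Suc i))) \<le> F x}" for p i
      have Bm: "B p i \<in> sets lebesgue" for p i unfolding B_def by measurable
      have "emeasure lebesgue (B p i) = 0" for p i
      proof (rule dyadic_density_null[OF _ Bm _ lam0, where \<epsilon> = "inverse (real (Suc i))"])
        have "emeasure lebesgue (B p i) \<le> emeasure lebesgue (cube p)" by (intro emeasure_mono) (auto simp: B_def)
        then show "emeasure lebesgue (B p i) < \<infinity>" by (simp add: emeasure_cube le_less_trans[OF _ ennreal_less_top])
        show "(\<integral>\<^sup>+y\<in>cube (idx k x). F y \<partial>lebesgue) \<le> ennreal (lam * vol (idx k x))" if "x \<in> B p i" "k \<ge> k0" for x k
          using that unfolding B_def Un by (auto simp: G_def not_less)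
      qed (auto simp: B_def)
      then have "B p i \<in> null_sets lebesgue" for p i using Bm by (simp add: null_sets_def)
      then have "AE x in lebesgue. x \<notin> B p i" for p i by (rule AE_not_in)
      then have "AE x in lebesgue. \<forall>p i. x \<notin> B p i" by (simp add: AE_all_countable)
      then show ?thesis
      proof eventually_elim
        case (elim x)
        show ?case
        proof (intro impI, rule ccontr)
          assume x: "x \<notin> \<Union>(cube ` P)" "\<not> F x \<le> ennreal lam"
          obtain i where "ennreal (lam + inverse (real (Suc i))) \<le> F x"
          proof (cases "F x")
            case (real r)
            then have "r - lam > 0" using x(2) lam0 by (simp add: not_le)
            then obtain i where "inverse (real (Suc i)) < r - lam" using reals_Archimedean by blast
            then show ?thesis using real by (intro that[of i]) (auto intro!: ennreal_leI)
          qed (auto intro: that)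
          then have "x \<in> B (idx 0 x) i" using x by (simp add: B_def)
          then show False using elim by blast
        qed
      qed
    qed
  qed (use gt dis in auto)
qed

end

section \<open>Shifted grids\<close>

text \<open>As 3 does not divide \<open>2\<^sup>k\<close>, the lattices \<open>\<int>\<close> and \<open>\<int> + 2\<^sup>k/3\<close> have distance \<open>1/3\<close>, and an interval of length
  \<open>3/16\<close> cannot meet both of them.\<close>

lemma third_shift_1d:
  fixes c :: real
  obtains t where "t = 0 \<or> t = 1/3" "\<And>u. c \<le> u \<Longrightarrow> u < c + 3/16 \<Longrightarrow> \<lfloor>u - 2^k * t\<rfloor> = \<lfloor>c - 2^k * t\<rfloor>"
proof (cases "\<forall>u. c \<le> u \<longrightarrow> u < c + 3/16 \<longrightarrow> \<lfloor>u\<rfloor> = \<lfloor>c\<rfloor>")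
  case True
  show ?thesis
  proof (rule that[of 0])
    show "\<lfloor>u - 2^k * 0\<rfloor> = \<lfloor>c - 2^k * 0\<rfloor>" if "c \<le> u" "u < c + 3/16" for u
      using True that unfolding mult_zero_right diff_zero by blast
  qed simp
next
  case False
  then obtain v where v: "c \<le> v" "v < c + 3/16" "\<lfloor>v\<rfloor> \<noteq> \<lfloor>c\<rfloor>" by auto
  define e where "e = \<lfloor>v\<rfloor>"
  have "\<lfloor>c\<rfloor> < e" using v floor_mono[OF v(1)] by (simp add: e_def)
  then have ce: "c < of_int e" by (simp add: floor_less_iff)
  have ev: "of_int e \<le> v" by (simp add: e_def)
  define a b where "a = (2::int)^k div 3" and "b = (2::int)^k mod 3"
  have b: "b = 1 \<or> b = 2"
  proof -
    have "\<not> 3 dvd (2::int)^k"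
    proof
      assume "3 dvd (2::int)^k"
      then have "3 dvd (2::int)" by (rule prime_dvd_power[rotated]) simp
      then show False by simp
    qed
    then have "b \<noteq> 0" by (simp add: b_def dvd_eq_mod_eq_0)
    moreover have "0 \<le> b" "b < 3" by (auto simp: b_def)
    ultimately show ?thesis by linarith
  qed
  have ab: "(2::real)^k = 3 * of_int a + of_int b"
  proof -
    have "(2::int)^k = 3 * a + b" by (simp add: a_def b_def)
    then have "real_of_int (2^k) = real_of_int (3 * a + b)" by (rule arg_cong)
    then show ?thesis by simp
  qed
  have fl: "\<lfloor>u - 2^k * (1/3)\<rfloor> = e - a - 1" if "c \<le> u" "u < c + 3/16" for u
  proof -
    have "\<bar>u - of_int e\<bar> < 3/16" using that v ce ev by (auto simp: abs_if)
    moreover have "(2::real)^k * (1/3) = of_int a + of_int b / 3" unfolding ab by simp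
    moreover have "real_of_int b = 1 \<or> real_of_int b = 2" using b by auto
    ultimately have "real_of_int (e - a - 1) \<le> u - 2^k * (1/3)" "u - 2^k * (1/3) < real_of_int (e - a - 1) + 1"
      unfolding of_int_diff of_int_1 by linarith+
    then show ?thesis by (simp only: floor_eq_iff)
  qed
  show ?thesis by (rule that[of "1/3"]) (use fl[of c] fl in auto)
qed

definition third_shift :: "('n::finite \<Rightarrow> bool) \<Rightarrow> real^'n" where
  "third_shift t = (\<chi> i. if t i then 1/3 else 0)"

text \<open>In units of the grid of scale \<open>16 L\<close> the triple of a cube has side \<open>3/16\<close>, so in each coordinate separately
  one of the two shifts \<open>0\<close> and \<open>1/3\<close> avoids the faces of that grid.\<close>

lemma one_third_trick:
  fixes z :: "real^'n::finite"
  assumes "0 < L"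
  obtains t m where "dyadic_grid.triple L z p \<subseteq> dyadic_grid.cube (16 * L) (third_shift t) (fst p, m)"
proof -
  interpret A: dyadic_grid L z using assms by unfold_locales
  interpret B: dyadic_grid "16 * L" "third_shift t" for t :: "'n \<Rightarrow> bool" using assms by unfold_locales auto
  define c where "c i = (real_of_int (snd p i) - 1 + 2 ^ fst p * z $ i) / 16" for i
  have "\<exists>t. (t = 0 \<or> t = 1/3) \<and> (\<forall>u. c i \<le> u \<longrightarrow> u < c i + 3/16 \<longrightarrow> \<lfloor>u - 2^fst p * t\<rfloor> = \<lfloor>c i - 2^fst p * t\<rfloor>)" for i
    using third_shift_1d[of "c i" "fst p"] by metis
  then obtain \<tau> where \<tau>: "\<And>i. \<tau> i = 0 \<or> \<tau> i = 1/3"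
    "\<And>i u. c i \<le> u \<Longrightarrow> u < c i + 3/16 \<Longrightarrow> \<lfloor>u - 2^fst p * \<tau> i\<rfloor> = \<lfloor>c i - 2^fst p * \<tau> i\<rfloor>"
    by metis
  define t where "t i \<longleftrightarrow> \<tau> i = 1/3" for i
  have t: "third_shift t $ i = \<tau> i" for i using \<tau>(1)[of i] by (auto simp: third_shift_def t_def)
  show ?thesis
  proof (rule that[of t "\<lambda>i. \<lfloor>c i - 2^fst p * \<tau> i\<rfloor>"], rule subsetI)
    fix x assume x: "x \<in> A.triple p"
    have "\<lfloor>2 ^ fst p * (x $ i / (16 * L) - \<tau> i)\<rfloor> = \<lfloor>c i - 2^fst p * \<tau> i\<rfloor>" for i
    proof -
      define u where "u = 2 ^ fst p * (x $ i / (16 * L))"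
      have "\<bar>\<lfloor>2 ^ fst p * (x $ i / L - z $ i)\<rfloor> - snd p i\<bar> \<le> 1"
        using x by (simp add: A.triple_def A.idx_def)
      moreover have "2 ^ fst p * (x $ i / L - z $ i) = 16 * u - 2 ^ fst p * z $ i"
        using assms by (simp add: u_def field_simps)
      ultimately have "\<bar>\<lfloor>16 * u - 2 ^ fst p * z $ i\<rfloor> - snd p i\<bar> \<le> 1" by simp
      then have "snd p i - 1 \<le> \<lfloor>16 * u - 2 ^ fst p * z $ i\<rfloor>" "\<lfloor>16 * u - 2 ^ fst p * z $ i\<rfloor> < snd p i + 2" by linarith+
      then have "real_of_int (snd p i) - 1 \<le> 16 * u - 2 ^ fst p * z $ i" "16 * u - 2 ^ fst p * z $ i < real_of_int (snd p i) + 2"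
        by (simp_all add: le_floor_iff floor_less_iff)
      then have "c i \<le> u" "u < c i + 3/16" by (simp_all add: c_def field_simps)
      from \<tau>(2)[OF this] show ?thesis by (simp add: u_def right_diff_distrib)
    qed
    then show "x \<in> B.cube t (fst p, \<lambda>i. \<lfloor>c i - 2^fst p * \<tau> i\<rfloor>)"
      by (simp add: B.cube_def B.idx_def t fun_eq_iff)
  qed
qed

section \<open>The Poisson-type kernel\<close>

lemma emeasure_ball_le:
  fixes x :: "real^'n::finite"
  assumes "0 < R" shows "emeasure lebesgue (ball x R) \<le> ennreal ((2 * R) ^ CARD('n))"
proof -
  interpret dyadic_grid 1 "0 :: real^'n" by unfold_locales auto
  have "ball x R \<subseteq> cbox (\<chi> i. x $ i - R) (\<chi> i. (\<chi> i. x $ i - R) $ i + 2 * R)"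
  proof
    fix y assume y: "y \<in> ball x R"
    have "\<bar>x $ i - y $ i\<bar> < R" for i
      using component_le_norm_cart[of "x - y" i] y by (simp add: dist_norm)
    then show "y \<in> cbox (\<chi> i. x $ i - R) (\<chi> i. (\<chi> i. x $ i - R) $ i + 2 * R)"
      by (auto simp: mem_box_cart abs_if split: if_splits) (smt (verit))+
  qed
  then have "emeasure lebesgue (ball x R) \<le> emeasure lebesgue (cbox (\<chi> i. x $ i - R) (\<chi> i. (\<chi> i. x $ i - R) $ i + 2 * R))"
    by (intro emeasure_mono) auto
  also have "\<dots> = ennreal ((2 * R) ^ CARD('n))" using assms by (intro emeasure_cube_side) auto
  finally show ?thesis .
qed

text \<open>An integrable kernel of Poisson type at scale \<open>l\<close>. It majorises the oscillation of \<open>K\<close> at this scale, and convolution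
  with it plays the part of the Hardy-Littlewood maximal function.\<close>

definition bump :: "real \<Rightarrow> real \<Rightarrow> real^'n::finite \<Rightarrow> real" where
  "bump \<alpha> l v = l powr \<alpha> / (l + norm v) powr (real CARD('n) + \<alpha>)"

lemma bump_nonneg [simp]: "0 \<le> bump \<alpha> l v" by (simp add: bump_def)

lemma bump_measurable [measurable]: "bump \<alpha> l \<in> borel_measurable borel"
  unfolding bump_def[abs_def] by measurable

text \<open>Comparability of the kernel at points whose distances from the origin are comparable up to an error of
  order \<open>l\<close>.\<close>

lemma bump_mono:
  fixes u v :: "real^'n::finite"
  assumes l: "0 < l" and al: "0 < \<alpha>" and c: "1 \<le> c" and le: "norm u \<le> c * norm v + (c - 1) * l"
  shows "bump \<alpha> l v \<le> c powr (real CARD('n) + \<alpha>) * bump \<alpha> l u"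
proof -
  have "(l + norm u) powr (real CARD('n) + \<alpha>) \<le> (c * (l + norm v)) powr (real CARD('n) + \<alpha>)"
    using l al le c by (intro powr_mono2) (auto simp: algebra_simps)
  also have "\<dots> = c powr (real CARD('n) + \<alpha>) * (l + norm v) powr (real CARD('n) + \<alpha>)" by (simp add: powr_mult)
  finally have le2: "(l + norm u) powr (real CARD('n) + \<alpha>) \<le> c powr (real CARD('n) + \<alpha>) * (l + norm v) powr (real CARD('n) + \<alpha>)" .
  have pos: "0 < (l + norm v) powr (real CARD('n) + \<alpha>)" "0 < (l + norm u) powr (real CARD('n) + \<alpha>)"
    using add_pos_nonneg[OF l norm_ge_zero, of v] add_pos_nonneg[OF l norm_ge_zero, of u] by auto
  have aux: "x / B \<le> k * (x / A)" if "A \<le> k * B" "0 < A" "0 < B" "0 \<le> x" for x A B k :: real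
  proof -
    have "x * A \<le> x * (k * B)" using that by (intro mult_left_mono) auto
    then show ?thesis using that by (simp add: divide_simps mult_ac)
  qed
  show ?thesis unfolding bump_def by (rule aux[OF le2 pos(2,1)]) simp
qed

text \<open>Decompose space into the shells on which \<open>l + |x - y|\<close> lies between \<open>2\<^sup>k l\<close> and \<open>2\<^bsup>k+1\<^esup> l\<close>. The
  \<open>k\<close>-th shell contributes a multiple of \<open>2\<^bsup>-k\<alpha>\<^esup>\<close>, whatever \<open>l\<close> is.\<close>

lemma bump_integral_bound:
  assumes al: "0 < \<alpha>"
  obtains C where "0 < C" "\<And>l (x::real^'n::finite). 0 < l \<Longrightarrow> (\<integral>\<^sup>+y. ennreal (bump \<alpha> l (x - y)) \<partial>lebesgue) \<le> ennreal C"
proof -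
  let ?N = "CARD('n)"
  define \<rho> where "\<rho> = (2::real) powr (- \<alpha>)"
  have \<rho>: "0 < \<rho>" "\<rho> < 1" using al by (auto simp: \<rho>_def powr_less_one)
  define C where "C = 4 ^ ?N / (1 - \<rho>)"
  have "(\<integral>\<^sup>+y. ennreal (bump \<alpha> l (x - y)) \<partial>lebesgue) \<le> ennreal C" if l: "0 < l" for l and x :: "real^'n"
  proof -
    define a where "a k = 1 / (l ^ ?N * (2 ^ k) powr (real ?N + \<alpha>))" for k :: nat
    have a0: "0 \<le> a k" for k using l by (simp add: a_def)
    have pt: "ennreal (bump \<alpha> l (x - y)) \<le> (\<Sum>k. ennreal (a k) * indicator (ball x (2 * 2^k * l)) y)" for y
    proof -
      define t where "t = (l + norm (x - y)) / l"
      have t1: "1 \<le> t" using l by (simp add: t_def)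
      define k where "k = nat \<lfloor>log 2 t\<rfloor>"
      have kk: "real_of_int \<lfloor>log 2 t\<rfloor> = real k" using t1 by (simp add: k_def)
      have "2 powr real k \<le> t \<and> t < 2 powr (real k + 1)"
        using floor_log_eq_powr_iff[of t 2 "\<lfloor>log 2 t\<rfloor>"] t1 kk by simp
      then have k: "2 ^ k \<le> t" "t < 2 * 2 ^ k" by (simp_all add: powr_realpow powr_add)
      have lt: "l + norm (x - y) = l * t" using l by (simp add: t_def)
      have "bump \<alpha> l (x - y) = l powr \<alpha> / (l powr (real ?N + \<alpha>) * t powr (real ?N + \<alpha>))"
        unfolding bump_def lt by (simp add: powr_mult)
      also have "\<dots> = 1 / (l ^ ?N * t powr (real ?N + \<alpha>))"
        using l by (simp add: powr_add powr_realpow)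
      also have "\<dots> \<le> a k" unfolding a_def
        using l k t1 al by (intro divide_left_mono mult_left_mono powr_mono2) auto
      finally have 1: "bump \<alpha> l (x - y) \<le> a k" .
      have "norm (x - y) < l * (2 * 2 ^ k)"
      proof -
        have "norm (x - y) < l * t" using lt l by linarith
        also have "\<dots> < l * (2 * 2 ^ k)" using k l by (intro mult_strict_left_mono)
        finally show ?thesis .
      qed
      then have "y \<in> ball x (2 * 2^k * l)" by (simp add: dist_norm mult_ac)
      then have "ennreal (bump \<alpha> l (x - y)) \<le> ennreal (a k) * indicator (ball x (2 * 2^k * l)) y"
        using 1 by (simp add: ennreal_leI)
      also have "\<dots> = (\<Sum>k\<in>{k}. ennreal (a k) * indicator (ball x (2 * 2^k * l)) y)" by (subst sum.insert) auto
      also have "\<dots> \<le> (\<Sum>k. ennreal (a k) * indicator (ball x (2 * 2^k * l)) y)"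
        by (rule sum_le_suminf) auto
      finally show ?thesis .
    qed
    have "(\<integral>\<^sup>+y. ennreal (bump \<alpha> l (x - y)) \<partial>lebesgue)
        \<le> (\<integral>\<^sup>+y. (\<Sum>k. ennreal (a k) * indicator (ball x (2 * 2^k * l)) y) \<partial>lebesgue)"
      by (intro nn_integral_mono pt)
    also have "\<dots> = (\<Sum>k. \<integral>\<^sup>+y. ennreal (a k) * indicator (ball x (2 * 2^k * l)) y \<partial>lebesgue)"
      by (intro nn_integral_suminf borel_measurable_times_ennreal borel_measurable_const borel_measurable_indicator fmeasurableD lmeasurable_ball)
    also have "\<dots> \<le> (\<Sum>k. ennreal (4 ^ ?N * \<rho> ^ k))"
    proof (intro suminf_le)
      fix k
      have "(\<integral>\<^sup>+y. ennreal (a k) * indicator (ball x (2 * 2^k * l)) y \<partial>lebesgue) = ennreal (a k) * emeasure lebesgue (ball x (2 * 2^k * l))"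
        by (simp add: nn_integral_cmult_indicator)
      also have "\<dots> \<le> ennreal (a k) * ennreal ((2 * (2 * 2^k * l)) ^ ?N)"
        using l by (intro mult_left_mono emeasure_ball_le) auto
      also have "\<dots> = ennreal (a k * (2 * (2 * 2^k * l)) ^ ?N)" using a0 l by (intro ennreal_mult[symmetric]) auto
      also have "2 * (2 * 2^k * l) = 4 * 2^k * l" by simp
      also have "a k * (4 * 2^k * l) ^ ?N = 4 ^ ?N * \<rho> ^ k"
      proof -
        have "(2 ^ k) powr \<alpha> = ((2::real) powr real k) powr \<alpha>" by (simp add: powr_realpow)
        also have "\<dots> = (2 powr \<alpha>) powr real k" by (rule powr_powr_swap)
        also have "\<dots> = (2 powr \<alpha>) ^ k" by (rule powr_realpow) simp
        finally have 1: "(2 ^ k) powr \<alpha> = ((2::real) powr \<alpha>) ^ k" .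
        have 2: "((2::real) ^ k) powr (real ?N + \<alpha>) = (2 ^ k) ^ ?N * (2 powr \<alpha>) ^ k"
          by (simp only: powr_add 1) (simp add: powr_realpow)
        have 3: "\<rho> ^ k = 1 / (2 powr \<alpha>) ^ k"
          by (simp add: \<rho>_def powr_minus_divide power_one_over)
        show ?thesis using l unfolding a_def 2 3 power_mult_distrib by simp
      qed
      finally show "(\<integral>\<^sup>+y. ennreal (a k) * indicator (ball x (2 * 2^k * l)) y \<partial>lebesgue) \<le> ennreal (4 ^ ?N * \<rho> ^ k)" .
    qed auto
    also have "\<dots> = ennreal C"
    proof (rule suminf_ennreal_eq)
      show "(\<lambda>k. 4 ^ ?N * \<rho> ^ k) sums C"
        using sums_mult[OF geometric_sums[of \<rho>], of "4 ^ ?N"] \<rho> by (simp add: C_def)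
    qed (use \<rho> in auto)
    finally show ?thesis .
  qed
  moreover have "0 < C" using \<rho> by (simp add: C_def)
  ultimately show thesis using that by blast
qed

section \<open>Bounded functions with bounded support\<close>

text \<open>The test functions. The class is stable under cutting to measurable sets and under subtracting means over cubes,
  which Schwartz functions are not.\<close>

definition Linfc :: "(real^'n::finite \<Rightarrow> complex) set" where
  "Linfc = {f. f \<in> borel_measurable lebesgue \<and> (\<exists>M. \<forall>x. cmod (f x) \<le> M) \<and> bounded {x. f x \<noteq> 0}}"

definition cutoff :: "'a set \<Rightarrow> ('a \<Rightarrow> complex) \<Rightarrow> 'a \<Rightarrow> complex" where
  "cutoff A f x = (if x \<in> A then f x else 0)"

lemma integrable_bounded_support:
  fixes h :: "real^'n::finite \<Rightarrow> 'b::{banach, second_countable_topology}"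
  assumes "h \<in> borel_measurable lebesgue" "\<And>x. norm (h x) \<le> M" "bounded {x. h x \<noteq> 0}"
  shows "integrable lebesgue h"
proof -
  obtain a where a: "{x. h x \<noteq> 0} \<subseteq> cbox (- a) a"
    using bounded_subset_cbox_symmetric[OF assms(3)] by blast
  show ?thesis
  proof (rule Bochner_Integration.integrable_bound[where f = "\<lambda>x. M * indicator (cbox (- a) a) x"])
    show "integrable lebesgue (\<lambda>x. M * indicator (cbox (- a) a) x)"
      using lmeasurable_cbox[of "- a" a] by (intro integrable_mult_right) (simp add: fmeasurable_def)
    show "AE x in lebesgue. norm (h x) \<le> norm (M * indicator (cbox (- a) a) x)"
    proof (intro AE_I2)
      fix x
      have "0 \<le> M" using assms(2)[of x] norm_ge_zero order_trans by blast
      then show "norm (h x) \<le> norm (M * indicator (cbox (- a) a) x)"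
        using assms(2)[of x] a by (cases "h x = 0") (auto simp: abs_mult indicator_def)
    qed
  qed (use assms in auto)
qed

lemma LinfcI:
  assumes "f \<in> borel_measurable lebesgue" "\<And>x. cmod (f x) \<le> M" "bounded S" "\<And>x. x \<notin> S \<Longrightarrow> f x = 0"
  shows "f \<in> Linfc"
proof -
  have "{x. f x \<noteq> 0} \<subseteq> S" using assms(4) by blast
  then show ?thesis using assms bounded_subset unfolding Linfc_def by blast
qed

lemma Linfc_meas: "f \<in> Linfc \<Longrightarrow> f \<in> borel_measurable lebesgue"
  by (simp add: Linfc_def)

lemma Linfc_bound: "f \<in> Linfc \<Longrightarrow> \<exists>M. \<forall>x. cmod (f x) \<le> M"
  by (simp add: Linfc_def)

lemma Linfc_supp: "f \<in> Linfc \<Longrightarrow> bounded {x. f x \<noteq> 0}"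
  by (simp add: Linfc_def)

lemma Linfc_integrable: "f \<in> Linfc \<Longrightarrow> integrable lebesgue f"
  unfolding Linfc_def using integrable_bounded_support by blast

lemma Linfc_L2: assumes "f \<in> Linfc" shows "f \<in> L2_fun"
proof -
  obtain M where M: "\<And>x. cmod (f x) \<le> M" using Linfc_bound[OF assms] by blast
  have "integrable lebesgue (\<lambda>x. (cmod (f x))\<^sup>2)"
  proof (rule integrable_bounded_support[where M = "M\<^sup>2"])
    show "(\<lambda>x. (cmod (f x))\<^sup>2) \<in> borel_measurable lebesgue" using Linfc_meas[OF assms] by measurable
    show "norm ((cmod (f x))\<^sup>2) \<le> M\<^sup>2" for x using M[of x] by (simp add: power_mono)
    show "bounded {x. (cmod (f x))\<^sup>2 \<noteq> 0}" using Linfc_supp[OF assms] by simp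
  qed
  then show ?thesis using Linfc_meas[OF assms] by (simp add: L2_fun_def)
qed

lemma Linfc_add: assumes "f \<in> Linfc" "g \<in> Linfc" shows "(\<lambda>x. f x + g x) \<in> Linfc"
proof -
  obtain M M' where M: "\<And>x. cmod (f x) \<le> M" "\<And>x. cmod (g x) \<le> M'"
    using Linfc_bound[OF assms(1)] Linfc_bound[OF assms(2)] by blast
  show ?thesis
  proof (rule LinfcI)
    show "cmod (f x + g x) \<le> M + M'" for x using M norm_triangle_mono by blast
    show "bounded ({x. f x \<noteq> 0} \<union> {x. g x \<noteq> 0})" using Linfc_supp[OF assms(1)] Linfc_supp[OF assms(2)] by simp
    show "(\<lambda>x. f x + g x) \<in> borel_measurable lebesgue"
      using Linfc_meas[OF assms(1)] Linfc_meas[OF assms(2)] by measurable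
  qed simp
qed

lemma Linfc_scale: assumes "f \<in> Linfc" shows "(\<lambda>x. c * f x) \<in> Linfc"
proof -
  obtain M where M: "\<And>x. cmod (f x) \<le> M" using Linfc_bound[OF assms(1)] by blast
  show ?thesis
  proof (rule LinfcI)
    show "cmod (c * f x) \<le> cmod c * M" for x using M by (simp add: norm_mult mult_left_mono)
    show "(\<lambda>x. c * f x) \<in> borel_measurable lebesgue" using Linfc_meas[OF assms(1)] by measurable
    show "bounded {x. f x \<noteq> 0}" by (rule Linfc_supp[OF assms(1)])
  qed simp
qed

lemma Linfc_diff: assumes "f \<in> Linfc" "g \<in> Linfc" shows "(\<lambda>x. f x - g x) \<in> Linfc"
  using Linfc_add[OF assms(1) Linfc_scale[OF assms(2), of "-1"]] by simp

lemma Linfc_zero: "(\<lambda>x. 0) \<in> Linfc"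
  by (rule LinfcI[where M = 0 and S = "{}"]) auto

lemma Linfc_sum: "finite I \<Longrightarrow> (\<And>i. i \<in> I \<Longrightarrow> f i \<in> Linfc) \<Longrightarrow> (\<lambda>x. \<Sum>i\<in>I. f i x) \<in> Linfc"
proof (induction rule: finite_induct)
  case empty
  then show ?case using Linfc_zero by simp
next
  case (insert i I)
  then show ?case using Linfc_add[of "f i" "\<lambda>x. \<Sum>i\<in>I. f i x"] by simp
qed

lemma Linfc_cutoff: assumes "f \<in> Linfc" "A \<in> sets lebesgue" shows "cutoff A f \<in> Linfc"
proof -
  obtain M where M: "\<And>x. cmod (f x) \<le> M" using Linfc_bound[OF assms(1)] by blast
  have M0: "0 \<le> M" using M norm_ge_zero order_trans by blast
  show ?thesis
  proof (rule LinfcI)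
    show "cmod (cutoff A f x) \<le> M" for x using M M0 by (simp add: cutoff_def)
    show "cutoff A f \<in> borel_measurable lebesgue"
      unfolding cutoff_def[abs_def] using Linfc_meas[OF assms(1)] assms(2) by measurable
    show "bounded {x. f x \<noteq> 0}" by (rule Linfc_supp[OF assms(1)])
  qed (simp add: cutoff_def)
qed

lemma Linfc_const_on: assumes "bounded A" "A \<in> sets lebesgue" shows "cutoff A (\<lambda>x. c) \<in> Linfc"
proof (rule LinfcI)
  show "cmod (cutoff A (\<lambda>x. c) x) \<le> cmod c" for x by (simp add: cutoff_def)
  show "cutoff A (\<lambda>x. c) \<in> borel_measurable lebesgue"
    unfolding cutoff_def[abs_def] using assms(2) by measurable
qed (use assms in \<open>auto simp: cutoff_def\<close>)

lemma fin_norm_cutoff: "fin_norm J r (\<lambda>j. cutoff A (f j) x) = (if x \<in> A then fin_norm J r (\<lambda>j. f j x) else 0)"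
  by (simp add: cutoff_def)

lemma fin_norm_Linfc:
  assumes f: "\<And>j. f j \<in> Linfc" and r: "0 < r"
  shows "(\<lambda>x. fin_norm J r (\<lambda>j. f j x)) \<in> borel_measurable lebesgue"
    and "\<exists>M. \<forall>x. fin_norm J r (\<lambda>j. f j x) \<le> M"
    and "bounded {x. fin_norm J r (\<lambda>j. f j x) \<noteq> 0}"
proof -
  show "(\<lambda>x. fin_norm J r (\<lambda>j. f j x)) \<in> borel_measurable lebesgue"
    by (rule fin_norm_measurable) (rule Linfc_meas[OF f])
  obtain M where M: "\<And>j x. cmod (f j x) \<le> M j" using Linfc_bound[OF f] by metis
  have "fin_norm J r (\<lambda>j. f j x) \<le> fin_norm J r (\<lambda>j. of_real (M j))" for x
  proof (rule fin_norm_mono[OF r])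
    show "cmod (f j x) \<le> cmod (of_real (M j))" for j using M[of j x] by simp
  qed
  then show "\<exists>M. \<forall>x. fin_norm J r (\<lambda>j. f j x) \<le> M" by blast
  have "{x. fin_norm J r (\<lambda>j. f j x) \<noteq> 0} \<subseteq> (\<Union>j<J. {x. f j x \<noteq> 0})"
  proof
    fix x assume "x \<in> {x. fin_norm J r (\<lambda>j. f j x) \<noteq> 0}"
    then have "\<not> (\<forall>j<J. f j x = 0)" using fin_norm_cong[of J "\<lambda>j. f j x" "\<lambda>j. 0" r] by auto
    then show "x \<in> (\<Union>j<J. {x. f j x \<noteq> 0})" by auto
  qed
  then show "bounded {x. fin_norm J r (\<lambda>j. f j x) \<noteq> 0}"
    by (rule bounded_subset[rotated]) (intro bounded_UN finite_lessThan ballI Linfc_supp[OF f])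
qed

lemma fin_norm_powr_integrable:
  assumes f: "\<And>j. f j \<in> Linfc" and r: "0 < r" and s: "0 < s"
  shows "integrable lebesgue (\<lambda>x. fin_norm J r (\<lambda>j. f j x) powr s)"
proof -
  obtain M where M: "\<And>x. fin_norm J r (\<lambda>j. f j x) \<le> M" using fin_norm_Linfc(2)[of f, OF f r] by blast
  show ?thesis
  proof (rule integrable_bounded_support)
    show "(\<lambda>x. fin_norm J r (\<lambda>j. f j x) powr s) \<in> borel_measurable lebesgue"
      using fin_norm_Linfc(1)[of f, OF f r] by measurable
    show "norm (fin_norm J r (\<lambda>j. f j x) powr s) \<le> M powr s" for x using M s by (simp add: powr_mono2)
    show "bounded {x. fin_norm J r (\<lambda>j. f j x) powr s \<noteq> 0}" using fin_norm_Linfc(3)[of f, OF f r] by simp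
  qed
qed

lemma fin_norm_integrable:
  assumes f: "\<And>j. f j \<in> Linfc" and r: "0 < r"
  shows "integrable lebesgue (\<lambda>x. fin_norm J r (\<lambda>j. f j x))"
  using fin_norm_powr_integrable[of f r 1 J, OF f r] by simp

section \<open>Calderon-Zygmund operators\<close>

lemma closed_ess_support: "closed (ess_support f)"
proof -
  have "- ess_support f = \<Union>{U. open U \<and> (AE y in lebesgue. y \<in> U \<longrightarrow> f y = 0)}"
    by (auto simp: ess_support_def)
  then have "open (- ess_support f)" by (auto intro!: open_Union)
  then show ?thesis by (simp add: closed_def)
qed

lemma ess_support_subset:
  assumes "closed S" "\<And>x. x \<notin> S \<Longrightarrow> f x = 0" shows "ess_support f \<subseteq> S"
proof
  fix x assume x: "x \<in> ess_support f"
  show "x \<in> S"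
  proof (rule ccontr)
    assume "x \<notin> S"
    have "AE y in lebesgue. y \<in> - S \<longrightarrow> f y = 0" using assms(2) by (intro AE_I2) auto
    then show False using x assms(1) \<open>x \<notin> S\<close> unfolding ess_support_def by (auto simp: open_Compl)
  qed
qed

locale cz_operator =
  fixes T :: "(real^'n::finite \<Rightarrow> complex) \<Rightarrow> real^'n \<Rightarrow> complex"
    and K :: "real^'n \<Rightarrow> real^'n \<Rightarrow> complex" and CK \<alpha> :: real
  assumes lin: "L2_bounded_linear T" and alpha: "0 < \<alpha>" and ker: "CZ_kernel K CK \<alpha>"
    and rep: "\<And>f. f \<in> L2_fun \<Longrightarrow> compact (ess_support f) \<Longrightarrow>
      AE x in lebesgue. x \<notin> ess_support f \<longrightarrow> T f x = (\<integral>y. K x y * f y \<partial>lebesgue)"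
begin

lemma dim_ge1: "1 \<le> real CARD('n)"
  using zero_less_card_finite[where ?'a = 'n] by linarith

lemma T_meas: "f \<in> Linfc \<Longrightarrow> T f \<in> borel_measurable lebesgue"
  using lin Linfc_L2 unfolding L2_bounded_linear_def L2_fun_def by blast

lemma T_add: "f \<in> Linfc \<Longrightarrow> g \<in> Linfc \<Longrightarrow> AE x in lebesgue. T (\<lambda>y. f y + g y) x = T f x + T g x"
  using lin Linfc_L2 unfolding L2_bounded_linear_def by blast

lemma T_scale: "f \<in> Linfc \<Longrightarrow> AE x in lebesgue. T (\<lambda>y. c * f y) x = c * T f x"
  using lin Linfc_L2 unfolding L2_bounded_linear_def by blast

lemma T_zero: "AE x in lebesgue. T (\<lambda>y. 0) x = 0"
  using T_scale[OF Linfc_zero, of 0] by simp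

lemma T_sum: "finite I \<Longrightarrow> (\<And>i. i \<in> I \<Longrightarrow> f i \<in> Linfc) \<Longrightarrow>
    AE x in lebesgue. T (\<lambda>y. \<Sum>i\<in>I. f i y) x = (\<Sum>i\<in>I. T (f i) x)"
proof (induction rule: finite_induct)
  case empty
  then show ?case using T_zero by simp
next
  case (insert i I)
  have "AE x in lebesgue. T (\<lambda>y. f i y + (\<Sum>i\<in>I. f i y)) x = T (f i) x + T (\<lambda>y. \<Sum>i\<in>I. f i y) x"
    using insert by (intro T_add Linfc_sum) auto
  moreover have "AE x in lebesgue. T (\<lambda>y. \<Sum>i\<in>I. f i y) x = (\<Sum>i\<in>I. T (f i) x)"
    using insert by auto
  ultimately have "AE x in lebesgue. T (\<lambda>y. f i y + (\<Sum>i\<in>I. f i y)) x = T (f i) x + (\<Sum>i\<in>I. T (f i) x)"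
    by eventually_elim simp
  then show ?case using insert(1,2) by simp
qed

lemma T_rep:
  assumes f: "f \<in> Linfc" and S: "closed S" "\<And>x. x \<notin> S \<Longrightarrow> f x = 0"
  shows "AE x in lebesgue. x \<notin> S \<longrightarrow> T f x = (\<integral>y. K x y * f y \<partial>lebesgue)"
proof -
  have "ess_support f \<subseteq> closure {x. f x \<noteq> 0}"
  proof (rule ess_support_subset)
    fix x assume "x \<notin> closure {x. f x \<noteq> 0}"
    then have "x \<notin> {x. f x \<noteq> 0}" using closure_subset[of "{x. f x \<noteq> 0}"] by (rule contra_subsetD[rotated])
    then show "f x = 0" by simp
  qed simp
  then have "bounded (ess_support f)" by (rule bounded_subset[OF bounded_closure[OF Linfc_supp[OF f]]])
  then have "compact (ess_support f)" using closed_ess_support by (simp add: compact_eq_bounded_closed)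
  from rep[OF Linfc_L2[OF f] this] show ?thesis
  proof eventually_elim
    case (elim x)
    have "ess_support f \<subseteq> S" using S(2) by (intro ess_support_subset S(1)) auto
    then show ?case using elim by blast
  qed
qed

lemma K_size: "x \<noteq> y \<Longrightarrow> cmod (K x y) \<le> CK * norm (x - y) powr (- real CARD('n))"
  using ker by (simp add: CZ_kernel_def)

lemma K_reg:
  assumes "norm (x - x') < norm (x - y) / 2"
  shows "cmod (K x y - K x' y) \<le> CK * (norm (x - x') powr \<alpha> / norm (x - y) powr (real CARD('n) + \<alpha>))"
    and "cmod (K y x - K y x') \<le> CK * (norm (x - x') powr \<alpha> / norm (x - y) powr (real CARD('n) + \<alpha>))"
proof -
  have "cmod (K x y - K x' y) + cmod (K y x - K y x') \<le> CK * (norm (x - x') powr \<alpha> / norm (x - y) powr (real CARD('n) + \<alpha>))"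
    using ker assms by (simp add: CZ_kernel_def)
  then show "cmod (K x y - K x' y) \<le> CK * (norm (x - x') powr \<alpha> / norm (x - y) powr (real CARD('n) + \<alpha>))"
    "cmod (K y x - K y x') \<le> CK * (norm (x - x') powr \<alpha> / norm (x - y) powr (real CARD('n) + \<alpha>))"
    using norm_ge_zero[of "K x y - K x' y"] norm_ge_zero[of "K y x - K y x'"] by linarith+
qed

lemma CK_nonneg: "0 \<le> CK"
proof -
  obtain e :: "real^'n" where e: "norm e = 1" using vector_choose_size[of 1] by auto
  then have "e \<noteq> 0" by auto
  then have "0 \<le> CK * norm (e - 0) powr (- real CARD('n))"
    by (rule order_trans[OF norm_ge_zero K_size])
  then show ?thesis using e by simp
qed

text \<open>Measurability of the kernel is a consequence of the smoothness condition in the second variable,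
  which makes it continuous off the diagonal.\<close>

lemma K_meas [measurable]: "(\<lambda>y. K x y) \<in> borel_measurable lebesgue"
proof -
  have "continuous_on (- {x}) (\<lambda>y. K x y)"
  proof (rule continuous_at_imp_continuous_on, intro ballI)
    fix y0 assume "y0 \<in> - {x}"
    then have d: "0 < norm (y0 - x)" by auto
    have "((\<lambda>y. K x y - K x y0) \<longlongrightarrow> 0) (at y0)"
    proof (rule Lim_null_comparison)
      have "eventually (\<lambda>y. dist y y0 < norm (y0 - x) / 2) (at y0)"
        unfolding eventually_at using d by (intro exI[of _ "norm (y0 - x) / 2"]) auto
      then show "eventually (\<lambda>y. norm (K x y - K x y0) \<le> CK * (norm (y0 - y) powr \<alpha> / norm (y0 - x) powr (real CARD('n) + \<alpha>))) (at y0)"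
      proof eventually_elim
        case (elim y)
        then have "norm (y0 - y) < norm (y0 - x) / 2" by (simp add: dist_norm norm_minus_commute)
        from K_reg(2)[OF this] show ?case by (simp add: norm_minus_commute)
      qed
      have "((\<lambda>y. norm (y0 - y) powr \<alpha>) \<longlongrightarrow> 0) (at y0)"
      proof (rule tendsto_zero_powrI[where b = \<alpha>])
        have "((\<lambda>y. norm (y0 - y)) \<longlongrightarrow> norm (y0 - y0)) (at y0)" by (intro tendsto_intros)
        then show "((\<lambda>y. norm (y0 - y)) \<longlongrightarrow> 0) (at y0)" by simp
      qed (use alpha in auto)
      then have "((\<lambda>y. CK * (norm (y0 - y) powr \<alpha> / norm (y0 - x) powr (real CARD('n) + \<alpha>))) \<longlongrightarrow> CK * (0 / norm (y0 - x) powr (real CARD('n) + \<alpha>))) (at y0)"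
        using d by (intro tendsto_intros) auto
      then show "((\<lambda>y. CK * (norm (y0 - y) powr \<alpha> / norm (y0 - x) powr (real CARD('n) + \<alpha>))) \<longlongrightarrow> 0) (at y0)" by simp
    qed
    then show "isCont (\<lambda>y. K x y) y0" by (simp add: isCont_def LIM_zero_iff)
  qed
  then have "(\<lambda>y. if y \<in> - {x} then K x y else K x x) \<in> borel_measurable borel"
    by (intro borel_measurable_continuous_on_if) auto
  moreover have "(\<lambda>y. if y \<in> - {x} then K x y else K x x) = (\<lambda>y. K x y)" by auto
  ultimately have "(\<lambda>y. K x y) \<in> borel_measurable borel" by simp
  then show ?thesis by (intro measurable_completion) simp
qed

lemma K_integrable:
  assumes f: "f \<in> Linfc" and d: "0 < \<delta>" and off: "\<And>y. norm (x - y) < \<delta> \<Longrightarrow> f y = 0"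
  shows "integrable lebesgue (\<lambda>y. K x y * f y)"
proof -
  obtain M where M: "\<And>x. cmod (f x) \<le> M" using Linfc_bound[OF f] by blast
  show ?thesis
  proof (rule integrable_bounded_support)
    show "(\<lambda>y. K x y * f y) \<in> borel_measurable lebesgue" using Linfc_meas[OF f] by measurable
    show "cmod (K x y * f y) \<le> CK * \<delta> powr (- real CARD('n)) * M" for y
    proof (cases "norm (x - y) < \<delta>")
      case True
      have "0 \<le> M" using M norm_ge_zero order_trans by blast
      then show ?thesis using off[OF True] CK_nonneg by simp
    next
      case False
      then have "x \<noteq> y" using d by auto
      then have "cmod (K x y) \<le> CK * norm (x - y) powr (- real CARD('n))" by (rule K_size)
      also have "\<dots> \<le> CK * \<delta> powr (- real CARD('n))"
        using False d CK_nonneg by (intro mult_left_mono powr_mono2') auto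
      finally show ?thesis unfolding norm_mult
        using M CK_nonneg by (intro mult_mono) auto
    qed
    have "{y. K x y * f y \<noteq> 0} \<subseteq> {y. f y \<noteq> 0}" by auto
    then show "bounded {y. K x y * f y \<noteq> 0}" using Linfc_supp[OF f] bounded_subset by blast
  qed
qed

definition ker_const :: real where
  "ker_const = CK * real CARD('n) powr \<alpha> * 2 powr (real CARD('n) + \<alpha>) + 2 * CK * (1 + 3 * real CARD('n)) powr (real CARD('n) + \<alpha>)"

lemma ker_const_nonneg: "0 \<le> ker_const"
  using CK_nonneg by (simp add: ker_const_def)

text \<open>The smoothness condition at a distance of at least \<open>3 n l\<close>, where \<open>n l\<close> bounds the diameter of a cube of side \<open>l\<close>.\<close>

lemma far_bound:
  fixes u v :: "real^'n"
  assumes l: "0 < l" and far: "3 * real CARD('n) * l \<le> norm v" and u: "norm u \<le> real CARD('n) * l"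
  shows "norm u < norm v / 2"
    and "CK * (norm u powr \<alpha> / norm v powr (real CARD('n) + \<alpha>)) \<le> ker_const * bump \<alpha> l v"
proof -
  have dl: "l \<le> real CARD('n) * l" using dim_ge1 l by simp
  have v: "norm u < norm v / 2" "l \<le> norm v" "0 < norm v" using far u dl l by linarith+
  show "norm u < norm v / 2" by (rule v)
  have e: "0 \<le> real CARD('n) + \<alpha>" using alpha by simp
  have "(l + norm v) powr (real CARD('n) + \<alpha>) \<le> (2 * norm v) powr (real CARD('n) + \<alpha>)"
    using v l e by (intro powr_mono2) auto
  also have "\<dots> = 2 powr (real CARD('n) + \<alpha>) * norm v powr (real CARD('n) + \<alpha>)" by (simp add: powr_mult)
  finally have 1: "1 / norm v powr (real CARD('n) + \<alpha>) \<le> 2 powr (real CARD('n) + \<alpha>) / (l + norm v) powr (real CARD('n) + \<alpha>)"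
    using v l by (simp add: divide_simps mult_ac)
  have 2: "norm u powr \<alpha> \<le> real CARD('n) powr \<alpha> * l powr \<alpha>"
    using u alpha powr_mono2[of \<alpha> "norm u" "real CARD('n) * l"] by (simp add: powr_mult)
  have "norm u powr \<alpha> * (1 / norm v powr (real CARD('n) + \<alpha>)) \<le> (real CARD('n) powr \<alpha> * l powr \<alpha>) * (2 powr (real CARD('n) + \<alpha>) / (l + norm v) powr (real CARD('n) + \<alpha>))"
    using 1 2 by (intro mult_mono) auto
  also have "\<dots> = real CARD('n) powr \<alpha> * 2 powr (real CARD('n) + \<alpha>) * bump \<alpha> l v" by (simp add: bump_def)
  finally have "CK * (norm u powr \<alpha> / norm v powr (real CARD('n) + \<alpha>)) \<le> CK * (real CARD('n) powr \<alpha> * 2 powr (real CARD('n) + \<alpha>) * bump \<alpha> l v)"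
    using CK_nonneg by (intro mult_left_mono) auto
  also have "\<dots> \<le> ker_const * bump \<alpha> l v"
    unfolding ker_const_def using CK_nonneg by (simp add: algebra_simps)
  finally show "CK * (norm u powr \<alpha> / norm v powr (real CARD('n) + \<alpha>)) \<le> ker_const * bump \<alpha> l v" .
qed

lemma K_second_var:
  assumes "0 < l" "norm (y - c) \<le> real CARD('n) * l" "3 * real CARD('n) * l \<le> norm (x - c)"
  shows "cmod (K x y - K x c) \<le> ker_const * bump \<alpha> l (x - c)"
proof -
  have n: "norm (c - x) = norm (x - c)" "norm (c - y) = norm (y - c)" by (simp_all add: norm_minus_commute)
  note fb = far_bound[OF assms(1,3,2)]
  have "cmod (K x c - K x y) \<le> CK * (norm (c - y) powr \<alpha> / norm (c - x) powr (real CARD('n) + \<alpha>))"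
    using fb(1) by (intro K_reg(2)) (simp add: n)
  also have "\<dots> \<le> ker_const * bump \<alpha> l (x - c)" using fb(2) by (simp add: n)
  finally show ?thesis by (simp add: norm_minus_commute)
qed

text \<open>Far from the cube this is the smoothness condition. Within the distance \<open>3 n l\<close> both values of the kernel
  are bounded by a multiple of \<open>l\<^bsup>-n\<^esup>\<close>, which is comparable to the majorant there.\<close>

lemma K_first_var:
  assumes l: "0 < l" and xx: "norm (x - x') \<le> real CARD('n) * l" and d: "l \<le> norm (x - y)" "l \<le> norm (x' - y)"
  shows "cmod (K x y - K x' y) \<le> ker_const * bump \<alpha> l (x' - y)"
proof (cases "3 * real CARD('n) * l \<le> norm (x' - y)")
  case True
  have n: "norm (x - x') = norm (x' - x)" by (simp add: norm_minus_commute)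
  note fb = far_bound[OF l True xx]
  have "cmod (K x' y - K x y) \<le> CK * (norm (x' - x) powr \<alpha> / norm (x' - y) powr (real CARD('n) + \<alpha>))"
    using fb(1) by (intro K_reg(1)) (simp add: n)
  also have "\<dots> \<le> ker_const * bump \<alpha> l (x' - y)" using fb(2) by (simp add: n)
  finally show ?thesis by (simp add: norm_minus_commute)
next
  case False
  have sz: "cmod (K u y) \<le> CK * l powr (- real CARD('n))" if "l \<le> norm (u - y)" for u
  proof -
    have "u \<noteq> y" using that l by auto
    then have "cmod (K u y) \<le> CK * norm (u - y) powr (- real CARD('n))" by (rule K_size)
    also have "\<dots> \<le> CK * l powr (- real CARD('n))" using that l CK_nonneg by (intro mult_left_mono powr_mono2') auto
    finally show ?thesis .
  qed
  have e: "0 \<le> real CARD('n) + \<alpha>" using alpha by simp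
  have "(l + norm (x' - y)) powr (real CARD('n) + \<alpha>) \<le> ((1 + 3 * real CARD('n)) * l) powr (real CARD('n) + \<alpha>)"
    using False l e by (intro powr_mono2) (auto simp: algebra_simps)
  also have "\<dots> = (1 + 3 * real CARD('n)) powr (real CARD('n) + \<alpha>) * (l powr real CARD('n) * l powr \<alpha>)" by (simp add: powr_mult powr_add)
  finally have le: "(l + norm (x' - y)) powr (real CARD('n) + \<alpha>) \<le> (1 + 3 * real CARD('n)) powr (real CARD('n) + \<alpha>) * (l powr real CARD('n) * l powr \<alpha>)" .
  have pos: "0 < (l + norm (x' - y)) powr (real CARD('n) + \<alpha>)" using add_pos_nonneg[OF l norm_ge_zero, of "x' - y"] by simp
  have low: "l powr (- real CARD('n)) \<le> (1 + 3 * real CARD('n)) powr (real CARD('n) + \<alpha>) * bump \<alpha> l (x' - y)"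
  proof -
    have "l powr (- real CARD('n)) * (l + norm (x' - y)) powr (real CARD('n) + \<alpha>) \<le> l powr (- real CARD('n)) * ((1 + 3 * real CARD('n)) powr (real CARD('n) + \<alpha>) * (l powr real CARD('n) * l powr \<alpha>))"
      by (intro mult_left_mono le) auto
    also have "\<dots> = (1 + 3 * real CARD('n)) powr (real CARD('n) + \<alpha>) * l powr \<alpha>" using l by (simp add: powr_minus)
    finally show ?thesis unfolding bump_def using pos by (simp add: pos_le_divide_eq)
  qed
  have "cmod (K x y - K x' y) \<le> cmod (K x y) + cmod (K x' y)" by (rule norm_triangle_ineq4)
  also have "\<dots> \<le> 2 * CK * l powr (- real CARD('n))" using sz[OF d(1)] sz[OF d(2)] by simp
  also have "\<dots> \<le> 2 * CK * ((1 + 3 * real CARD('n)) powr (real CARD('n) + \<alpha>) * bump \<alpha> l (x' - y))"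
    using CK_nonneg by (intro mult_left_mono low) auto
  also have "\<dots> \<le> ker_const * bump \<alpha> l (x' - y)"
    unfolding ker_const_def using CK_nonneg by (simp add: algebra_simps)
  finally show ?thesis .
qed

text \<open>The hypothesis from which the weak type estimate starts. It is available for one component and \<open>s = 2\<close> at
  first, and for \<open>s = r\<close> after the unweighted bound of \<open>T\<close> has been proved.\<close>

definition strong_type :: "nat \<Rightarrow> real \<Rightarrow> real \<Rightarrow> real \<Rightarrow> bool" where
  "strong_type J r s B \<longleftrightarrow> (\<forall>f. (\<forall>j. f j \<in> Linfc) \<longrightarrow>
     (\<integral>\<^sup>+x. ennreal (fin_norm J r (\<lambda>j. T (f j) x) powr s) \<partial>lebesgue)
       \<le> ennreal B * (\<integral>\<^sup>+x. ennreal (fin_norm J r (\<lambda>j. f j x) powr s) \<partial>lebesgue))"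

end

section \<open>The weak type estimate\<close>

lemma set_nn_integral_eq_LINT:
  fixes F :: "'a \<Rightarrow> real"
  assumes "integrable M F" "\<And>x. 0 \<le> F x" "A \<in> sets M"
  shows "(\<integral>\<^sup>+x\<in>A. ennreal (F x) \<partial>M) = ennreal (LINT x:A|M. F x)"
proof -
  have "(\<integral>\<^sup>+x\<in>A. ennreal (F x) \<partial>M) = (\<integral>\<^sup>+x. ennreal (indicator A x *\<^sub>R F x) \<partial>M)"
    by (intro nn_integral_cong) (simp split: split_indicator)
  also have "\<dots> = ennreal (LINT x:A|M. F x)" unfolding set_lebesgue_integral_def
    by (rule nn_integral_eq_integral[OF integrable_mult_indicator[OF assms(3,1)]])
      (use assms(2) in \<open>auto simp: indicator_def\<close>)
  finally show ?thesis .
qed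

lemma LINT_nonneg: "(\<And>x. 0 \<le> F x) \<Longrightarrow> 0 \<le> (LINT x:A|M. (F x :: real))"
  unfolding set_lebesgue_integral_def by (intro Bochner_Integration.integral_nonneg) (auto simp: indicator_def)

text \<open>Continuity from above of the measure with density \<open>h\<close>. It allows a Calderon-Zygmund decomposition with finitely many
  bad pieces, for which linearity of the operator is sufficient.\<close>

lemma finite_tail_small:
  fixes h :: "'a \<Rightarrow> ennreal"
  assumes [measurable]: "h \<in> borel_measurable M" and fin: "(\<integral>\<^sup>+x. h x \<partial>M) < \<infinity>"
    and P: "countable P" and A: "\<And>p. p \<in> P \<Longrightarrow> A p \<in> sets M" and d: "0 < (\<delta>::ennreal)"
  obtains P' where "finite P'" "P' \<subseteq> P" "(\<integral>\<^sup>+x\<in>(\<Union>(A ` P) - \<Union>(A ` P')). h x \<partial>M) < \<delta>"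
proof (cases "P = {}")
  case True
  then show ?thesis using d by (intro that[of "{}"]) auto
next
  case False
  define e where "e = from_nat_into P"
  have e: "e n \<in> P" for n unfolding e_def by (rule from_nat_into[OF False])
  have re: "range e = P" unfolding e_def by (rule range_from_nat_into[OF False P])
  define D where "D n = \<Union>(A ` P) - \<Union>(A ` e ` {..<n})" for n :: nat
  have Um: "\<Union>(A ` P) \<in> sets M" using P A by (intro sets.countable_UN') auto
  have Fm: "\<Union>(A ` e ` {..<n}) \<in> sets M" for n using A e by (intro sets.finite_Union) auto
  have Dm: "D n \<in> sets M" for n unfolding D_def using Um Fm by auto
  have ed: "emeasure (density M h) (D n) = (\<integral>\<^sup>+x\<in>D n. h x \<partial>M)" for n
    using Dm by (simp add: emeasure_density)
  have le: "emeasure (density M h) (D n) \<le> (\<integral>\<^sup>+x. h x \<partial>M)" for n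
    unfolding ed by (intro nn_integral_mono) (auto simp: indicator_def)
  have "(\<lambda>n. emeasure (density M h) (D n)) \<longlonglongrightarrow> emeasure (density M h) (\<Inter>n. D n)"
  proof (rule Lim_emeasure_decseq)
    show "range D \<subseteq> sets (density M h)" using Dm by auto
    show "decseq D" unfolding decseq_def D_def by (auto; force)
    show "emeasure (density M h) (D i) \<noteq> \<infinity>" for i using le[of i] fin by (auto simp: top_unique)
  qed
  moreover have "(\<Inter>n. D n) = {}"
  proof -
    have "x \<notin> (\<Inter>n. D n)" for x
    proof
      assume x: "x \<in> (\<Inter>n. D n)"
      then have "x \<in> D 0" by blast
      then obtain p where p: "p \<in> P" "x \<in> A p" by (auto simp: D_def)
      then obtain n where "p = e n" using re by blast
      then have "x \<notin> D (Suc n)" using p by (auto simp: D_def)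
      then show False using x by blast
    qed
    then show ?thesis by blast
  qed
  ultimately have "(\<lambda>n. emeasure (density M h) (D n)) \<longlonglongrightarrow> 0" by simp
  then have "eventually (\<lambda>n. emeasure (density M h) (D n) < \<delta>) sequentially"
    by (rule order_tendstoD(2)) (rule d)
  then obtain n where "emeasure (density M h) (D n) < \<delta>" by (auto simp: eventually_sequentially)
  then have "(\<integral>\<^sup>+x\<in>D n. h x \<partial>M) < \<delta>" by (simp only: ed)
  then show ?thesis
    by (intro that[of "e ` {..<n}"]) (use e in \<open>auto simp: D_def\<close>)
qed

context cz_operator begin

definition bump_const :: real where
  "bump_const = (SOME C. 0 < C \<and> (\<forall>l (x::real^'n). 0 < l \<longrightarrow> (\<integral>\<^sup>+y. ennreal (bump \<alpha> l (x - y)) \<partial>lebesgue) \<le> ennreal C))"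

lemma bump_const: "0 < bump_const"
  "0 < l \<Longrightarrow> (\<integral>\<^sup>+y. ennreal (bump \<alpha> l ((x::real^'n) - y)) \<partial>lebesgue) \<le> ennreal bump_const"
proof -
  have "\<exists>C. 0 < C \<and> (\<forall>l (x::real^'n). 0 < l \<longrightarrow> (\<integral>\<^sup>+y. ennreal (bump \<alpha> l (x - y)) \<partial>lebesgue) \<le> ennreal C)"
    by (rule bump_integral_bound[OF alpha]) blast
  from someI_ex[OF this, folded bump_const_def]
  show "0 < bump_const"
    "0 < l \<Longrightarrow> (\<integral>\<^sup>+y. ennreal (bump \<alpha> l (x - y)) \<partial>lebesgue) \<le> ennreal bump_const" by blast+
qed

text \<open>The three terms account for the dilated stopping cubes, for the good part and for the bad part of the
  Calderon-Zygmund decomposition.\<close>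

definition weak_const :: "real \<Rightarrow> real \<Rightarrow> real" where
  "weak_const s B = (6 * real CARD('n)) ^ CARD('n) + 3 * B * (2 ^ CARD('n)) powr (s - 1) + 2 * ker_const * bump_const"

definition tail_const :: real where
  "tail_const = (1 + 4 powr (real CARD('n) + \<alpha>) * 2 ^ CARD('n)) * bump_const"

lemma tail_const_pos: "0 < tail_const"
  unfolding tail_const_def using bump_const(1) by (intro mult_pos_pos add_pos_nonneg) auto

end

locale cz_grid = cz_operator T K CK \<alpha> + dyadic_grid L z
  for T :: "(real^'n::finite \<Rightarrow> complex) \<Rightarrow> real^'n \<Rightarrow> complex" and K CK \<alpha> L and z :: "real^'n"
begin

definition avg :: "'n gidx \<Rightarrow> (real^'n \<Rightarrow> complex) \<Rightarrow> complex" where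
  "avg p f = (\<integral>y. cutoff (cube p) f y \<partial>lebesgue) / vol p"

definition bad :: "'n gidx \<Rightarrow> (real^'n \<Rightarrow> complex) \<Rightarrow> real^'n \<Rightarrow> complex" where
  "bad p f = cutoff (cube p) (\<lambda>y. f y - avg p f)"

lemma bad_Linfc: assumes "f \<in> Linfc" shows "bad p f \<in> Linfc"
proof -
  have "bad p f = (\<lambda>y. cutoff (cube p) f y - cutoff (cube p) (\<lambda>y. avg p f) y)"
    by (auto simp: bad_def cutoff_def)
  then show ?thesis using assms by (simp add: Linfc_diff Linfc_cutoff Linfc_const_on bounded_cube)
qed

lemma integral_cutoff_const:
  fixes c :: complex
  shows "(\<integral>y. cutoff (cube p) (\<lambda>y. c) y \<partial>lebesgue) = vol p * c"
proof -
  have "(\<integral>y. cutoff (cube p) (\<lambda>y. c) y \<partial>lebesgue) = (\<integral>y. indicator (cube p) y *\<^sub>R c \<partial>lebesgue)"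
    by (intro Bochner_Integration.integral_cong refl) (simp add: cutoff_def)
  also have "\<dots> = vol p *\<^sub>R c" by (subst integral_scaleR_left) (auto simp: emeasure_cube)
  finally show ?thesis by (simp add: scaleR_conv_of_real)
qed

lemma integral_bad: assumes "f \<in> Linfc" shows "(\<integral>y. bad p f y \<partial>lebesgue) = 0"
proof -
  have "bad p f = (\<lambda>y. cutoff (cube p) f y - cutoff (cube p) (\<lambda>y. avg p f) y)"
    by (auto simp: bad_def cutoff_def)
  then have "(\<integral>y. bad p f y \<partial>lebesgue) = (\<integral>y. cutoff (cube p) f y \<partial>lebesgue) - (\<integral>y. cutoff (cube p) (\<lambda>y. avg p f) y \<partial>lebesgue)"
    using assms by (simp add: Bochner_Integration.integral_diff Linfc_integrable Linfc_cutoff Linfc_const_on bounded_cube)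
  also have "\<dots> = 0" using vol_pos[of p] by (simp add: integral_cutoff_const avg_def)
  finally show ?thesis .
qed

lemma fin_norm_avg:
  assumes f: "\<And>j. f j \<in> Linfc" and r: "1 < r"
  shows "vol p * fin_norm J r (\<lambda>j. avg p (f j)) \<le> (LINT y:cube p|lebesgue. fin_norm J r (\<lambda>j. f j y))"
proof -
  have r0: "0 < r" using r by simp
  let ?h = "\<lambda>y. indicator (cube p) y *\<^sub>R fin_norm J r (\<lambda>j. f j y)"
  have "fin_norm J r (\<lambda>j. \<integral>y. 1 * cutoff (cube p) (f j) y \<partial>lebesgue) \<le> (\<integral>y. ?h y \<partial>lebesgue)"
  proof (rule fin_norm_integral[OF r])
    show "integrable lebesgue (\<lambda>y. 1 * cutoff (cube p) (f j) y)" for j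
      using Linfc_integrable[OF Linfc_cutoff[OF f cube_measurable]] by simp
    show "integrable lebesgue ?h"
      by (rule integrable_mult_indicator[OF cube_measurable fin_norm_integrable[of f, OF f r0]])
    show "cmod 1 * fin_norm J r (\<lambda>j. cutoff (cube p) (f j) y) \<le> ?h y" for y
      by (simp add: fin_norm_cutoff)
  qed
  moreover have "fin_norm J r (\<lambda>j. \<integral>y. 1 * cutoff (cube p) (f j) y \<partial>lebesgue) = fin_norm J r (\<lambda>j. vol p * avg p (f j))"
    using vol_pos[of p] by (intro fin_norm_cong) (simp add: avg_def)
  moreover have "\<dots> = vol p * fin_norm J r (\<lambda>j. avg p (f j))" using r0 vol_nn[of p] by (simp add: fin_norm_scale)
  ultimately show ?thesis by (simp add: set_lebesgue_integral_def)
qed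

lemma integral_fin_norm_bad:
  assumes f: "\<And>j. f j \<in> Linfc" and r: "1 < r"
  shows "(\<integral>y. fin_norm J r (\<lambda>j. bad p (f j) y) \<partial>lebesgue) \<le> 2 * (LINT y:cube p|lebesgue. fin_norm J r (\<lambda>j. f j y))"
proof -
  have r0: "0 < r" using r by simp
  let ?F = "\<lambda>y. fin_norm J r (\<lambda>j. f j y)"
  let ?c = "fin_norm J r (\<lambda>j. avg p (f j))"
  have Fi: "integrable lebesgue (\<lambda>y. indicator (cube p) y *\<^sub>R ?F y)"
    by (rule integrable_mult_indicator[OF cube_measurable fin_norm_integrable[of f, OF f r0]])
  have ci: "integrable lebesgue (\<lambda>y. indicator (cube p) y *\<^sub>R ?c)"
    by (rule integrable_scaleR_left) (simp add: emeasure_cube)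
  have "(\<integral>y. fin_norm J r (\<lambda>j. bad p (f j) y) \<partial>lebesgue) \<le> (\<integral>y. indicator (cube p) y *\<^sub>R ?F y + indicator (cube p) y *\<^sub>R ?c \<partial>lebesgue)"
  proof (rule integral_mono)
    show "integrable lebesgue (\<lambda>y. fin_norm J r (\<lambda>j. bad p (f j) y))"
      by (rule fin_norm_integrable[of "\<lambda>j. bad p (f j)", OF bad_Linfc[OF f] r0])
    show "integrable lebesgue (\<lambda>y. indicator (cube p) y *\<^sub>R ?F y + indicator (cube p) y *\<^sub>R ?c)"
      using Fi ci by (rule Bochner_Integration.integrable_add)
    show "fin_norm J r (\<lambda>j. bad p (f j) y) \<le> indicator (cube p) y *\<^sub>R ?F y + indicator (cube p) y *\<^sub>R ?c" for y
      unfolding bad_def fin_norm_cutoff using fin_norm_diff_le[OF r, of J "\<lambda>j. f j y" "\<lambda>j. avg p (f j)"] by simp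
  qed
  also have "\<dots> = (LINT y:cube p|lebesgue. ?F y) + vol p * ?c"
    using Fi ci unfolding set_lebesgue_integral_def
    by (subst Bochner_Integration.integral_add) (auto simp: emeasure_cube)
  also have "\<dots> \<le> 2 * (LINT y:cube p|lebesgue. ?F y)" using fin_norm_avg[of f r p J, OF f r] by simp
  finally show ?thesis .
qed

text \<open>Since the bad part has integral zero, \<open>K x y\<close> may be replaced by its difference from the value at the corner of
  the cube.\<close>

lemma T_bad_bound:
  assumes f: "\<And>j. f j \<in> Linfc" and r: "1 < r"
  shows "AE x in lebesgue. 3 * real CARD('n) * side p \<le> norm (x - corner p) \<longrightarrow>
     fin_norm J r (\<lambda>j. T (bad p (f j)) x) \<le> ker_const * bump \<alpha> (side p) (x - corner p) * (\<integral>y. fin_norm J r (\<lambda>j. bad p (f j) y) \<partial>lebesgue)"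
proof -
  have r0: "0 < r" using r by simp
  let ?c = "corner p"
  let ?S = "cball ?c (real CARD('n) * side p)"
  have off: "bad p g y = 0" if "y \<notin> ?S" for g y
  proof -
    have "y \<notin> cube p" using that norm_cube[of ?c p y] by (auto simp: dist_norm)
    then show ?thesis by (simp add: bad_def cutoff_def)
  qed
  have "AE x in lebesgue. x \<notin> ?S \<longrightarrow> T (bad p (f j)) x = (\<integral>y. K x y * bad p (f j) y \<partial>lebesgue)" for j
    by (rule T_rep[OF bad_Linfc[OF f]]) (use off in auto)
  then have "AE x in lebesgue. \<forall>j. x \<notin> ?S \<longrightarrow> T (bad p (f j)) x = (\<integral>y. K x y * bad p (f j) y \<partial>lebesgue)"
    by (intro AE_all_countable[THEN iffD2] allI)
  then show ?thesis
  proof eventually_elim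
    case (elim x)
    show ?case
    proof
      assume x: "3 * real CARD('n) * side p \<le> norm (x - ?c)"
      let ?k = "\<lambda>y. K x y - K x ?c"
      define m where "m = ker_const * bump \<alpha> (side p) (x - ?c)"
      have pos: "0 < real CARD('n) * side p" using dim_ge1 by (intro mult_pos_pos) auto
      have x3: "3 * (real CARD('n) * side p) \<le> norm (x - ?c)" using x by (simp only: mult.assoc)
      have "real CARD('n) * side p < norm (x - ?c)" using x3 pos by linarith
      then have xS: "x \<notin> ?S" by (simp add: dist_norm norm_minus_commute)
      have iK: "integrable lebesgue (\<lambda>y. K x y * bad p (f j) y)" for j
      proof (rule K_integrable[OF bad_Linfc[OF f] pos])
        fix y assume "norm (x - y) < real CARD('n) * side p"
        then have "norm (y - ?c) > real CARD('n) * side p"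
        proof -
          have "norm (x - ?c) \<le> norm (x - y) + norm (y - ?c)"
            using norm_triangle_ineq[of "x - y" "y - ?c"] by simp
          then show ?thesis using x3 pos \<open>norm (x - y) < real CARD('n) * side p\<close> by linarith
        qed
        then show "bad p (f j) y = 0" by (intro off) (simp add: dist_norm norm_minus_commute)
      qed
      have ik: "integrable lebesgue (\<lambda>y. ?k y * bad p (f j) y)" for j
        unfolding left_diff_distrib
        by (intro Bochner_Integration.integrable_diff iK integrable_mult_right Linfc_integrable bad_Linfc f)
      have Teq: "T (bad p (f j)) x = (\<integral>y. ?k y * bad p (f j) y \<partial>lebesgue)" for j
      proof -
        have "(\<integral>y. ?k y * bad p (f j) y \<partial>lebesgue) = (\<integral>y. K x y * bad p (f j) y \<partial>lebesgue) - (\<integral>y. K x ?c * bad p (f j) y \<partial>lebesgue)"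
          unfolding left_diff_distrib
          by (intro Bochner_Integration.integral_diff iK integrable_mult_right Linfc_integrable bad_Linfc f)
        also have "(\<integral>y. K x ?c * bad p (f j) y \<partial>lebesgue) = 0" using integral_bad[OF f] by simp
        finally show ?thesis using elim xS by simp
      qed
      have "fin_norm J r (\<lambda>j. T (bad p (f j)) x) = fin_norm J r (\<lambda>j. \<integral>y. ?k y * bad p (f j) y \<partial>lebesgue)"
        by (simp only: Teq)
      also have "\<dots> \<le> (\<integral>y. m * fin_norm J r (\<lambda>j. bad p (f j) y) \<partial>lebesgue)"
      proof (rule fin_norm_integral[OF r ik])
        show "integrable lebesgue (\<lambda>y. m * fin_norm J r (\<lambda>j. bad p (f j) y))"
          by (intro integrable_mult_right fin_norm_integrable[of "\<lambda>j. bad p (f j)", OF bad_Linfc[OF f] r0])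
        show "cmod (?k y) * fin_norm J r (\<lambda>j. bad p (f j) y) \<le> m * fin_norm J r (\<lambda>j. bad p (f j) y)" for y
        proof (cases "y \<in> cube p")
          case True
          have "cmod (?k y) \<le> m" unfolding m_def
            using norm_cube[OF True corner_mem] x by (intro K_second_var) auto
          then show ?thesis by (intro mult_right_mono) auto
        next
          case False
          then show ?thesis by (simp add: bad_def fin_norm_cutoff)
        qed
      qed
      finally show "fin_norm J r (\<lambda>j. T (bad p (f j)) x) \<le> ker_const * bump \<alpha> (side p) (x - ?c) * (\<integral>y. fin_norm J r (\<lambda>j. bad p (f j) y) \<partial>lebesgue)"
        by (simp add: m_def)
    qed
  qed
qed

lemma fin_norm_T_meas:
  assumes f: "\<And>j. f j \<in> Linfc"
  shows "(\<lambda>x. fin_norm J r (\<lambda>j. T (f j) x)) \<in> borel_measurable lebesgue"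
  by (rule fin_norm_measurable) (rule T_meas[OF f])

lemma T_bad_L1:
  assumes f: "\<And>j. f j \<in> Linfc" and r: "1 < r"
    and G: "G \<in> sets lebesgue" "\<And>x. x \<in> G \<Longrightarrow> 3 * real CARD('n) * side p \<le> norm (x - corner p)"
  shows "(\<integral>\<^sup>+x\<in>G. ennreal (fin_norm J r (\<lambda>j. T (bad p (f j)) x)) \<partial>lebesgue)
    \<le> ennreal (2 * ker_const * bump_const * (LINT y:cube p|lebesgue. fin_norm J r (\<lambda>j. f j y)))"
proof -
  define I where "I = (\<integral>y. fin_norm J r (\<lambda>j. bad p (f j) y) \<partial>lebesgue)"
  have I: "0 \<le> I" "I \<le> 2 * (LINT y:cube p|lebesgue. fin_norm J r (\<lambda>j. f j y))"
    unfolding I_def using integral_fin_norm_bad[of f r J p, OF f r] by simp_all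
  have kI: "0 \<le> ker_const * I" using ker_const_nonneg I by simp
  have "(\<integral>\<^sup>+x\<in>G. ennreal (fin_norm J r (\<lambda>j. T (bad p (f j)) x)) \<partial>lebesgue)
     \<le> (\<integral>\<^sup>+x. ennreal (ker_const * I) * ennreal (bump \<alpha> (side p) (corner p - x)) \<partial>lebesgue)"
  proof (rule nn_integral_mono_AE)
    have n: "bump \<alpha> l (x - y) = bump \<alpha> l (y - x)" for l and x y :: "real^'n" by (simp add: bump_def norm_minus_commute)
    from T_bad_bound[of f r p J, OF f r]
    show "AE x in lebesgue. ennreal (fin_norm J r (\<lambda>j. T (bad p (f j)) x)) * indicator G x
       \<le> ennreal (ker_const * I) * ennreal (bump \<alpha> (side p) (corner p - x))"
    proof eventually_elim
      case (elim x)
      show ?case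
      proof (cases "x \<in> G")
        case True
        then have "fin_norm J r (\<lambda>j. T (bad p (f j)) x) \<le> ker_const * I * bump \<alpha> (side p) (corner p - x)"
          using elim G(2)[OF True] by (simp add: I_def n[of _ "corner p"] mult_ac)
        then show ?thesis using True kI by (simp add: ennreal_mult[symmetric] ennreal_leI)
      qed simp
    qed
  qed
  also have "\<dots> = ennreal (ker_const * I) * (\<integral>\<^sup>+x. ennreal (bump \<alpha> (side p) (corner p - x)) \<partial>lebesgue)"
    by (intro nn_integral_cmult measurable_compose[OF _ measurable_ennreal] measurable_completion) simp
  also have "\<dots> \<le> ennreal (ker_const * I) * ennreal bump_const"
    by (intro mult_left_mono bump_const(2)) auto
  also have "\<dots> = ennreal (ker_const * bump_const * I)"
    using kI bump_const(1) by (simp add: ennreal_mult[symmetric] mult_ac)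
  also have "\<dots> \<le> ennreal (ker_const * bump_const * (2 * (LINT y:cube p|lebesgue. fin_norm J r (\<lambda>j. f j y))))"
    using I ker_const_nonneg bump_const(1) by (intro ennreal_leI mult_left_mono) auto
  finally show ?thesis by (simp add: mult_ac)
qed

text \<open>Off the stopping cubes \<open>F\<close> is at most \<open>lam\<close>. Seen from a point \<open>x\<close> at a distance from a stopping cube that is large compared
  to its side, the kernel is nearly constant on the cube, so \<open>F\<close> may be replaced there by its mean, which is at
  most \<open>2\<^sup>n lam\<close>. In total \<open>F\<close> acts like a constant multiple of \<open>lam\<close>.\<close>

lemma bump_average_off_stopping:
  assumes F: "F \<in> borel_measurable lebesgue" "\<And>y. 0 \<le> F y" and lam: "0 < lam" and l: "0 < l"
    and P: "disjoint_family_on cube P"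
      "\<And>p. p \<in> P \<Longrightarrow> (\<integral>\<^sup>+y\<in>cube p. ennreal (F y) \<partial>lebesgue) \<le> ennreal (2 ^ CARD('n) * lam * vol p)"
      "AE x in lebesgue. x \<notin> \<Union>(cube ` P) \<longrightarrow> ennreal (F x) \<le> ennreal lam"
    and x: "\<And>p. p \<in> P \<Longrightarrow> 3 * real CARD('n) * side p \<le> norm (x - corner p)"
  shows "(\<integral>\<^sup>+y. ennreal (F y * bump \<alpha> l (x - y)) \<partial>lebesgue) \<le> ennreal (tail_const * lam)"
proof -
  let ?e = "real CARD('n) + \<alpha>"
  define b where "b y = bump \<alpha> l (x - y)" for y
  have b0: "0 \<le> b y" for y by (simp add: b_def)
  have bm[measurable]: "b \<in> borel_measurable lebesgue" unfolding b_def[abs_def] by (intro measurable_completion) simp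
  note [measurable] = F(1)
  have cP: "countable P" by (rule countable_subset[OF subset_UNIV]) simp
  have [measurable]: "\<Union>(cube ` P) \<in> sets lebesgue" using cP by (intro sets.countable_UN') auto
  have bI: "(\<integral>\<^sup>+y. ennreal (b y) \<partial>lebesgue) \<le> ennreal bump_const" unfolding b_def by (rule bump_const(2)[OF l])
  define C where "C = 4 powr ?e * 2 ^ CARD('n) * lam"
  have C0: "0 \<le> C" using lam by (simp add: C_def)
  have off: "(\<integral>\<^sup>+y\<in>- \<Union>(cube ` P). ennreal (F y * b y) \<partial>lebesgue) \<le> ennreal lam * ennreal bump_const"
  proof -
    have "(\<integral>\<^sup>+y\<in>- \<Union>(cube ` P). ennreal (F y * b y) \<partial>lebesgue) \<le> (\<integral>\<^sup>+y. ennreal lam * ennreal (b y) \<partial>lebesgue)"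
    proof (rule nn_integral_mono_AE)
      show "AE y in lebesgue. ennreal (F y * b y) * indicator (- \<Union>(cube ` P)) y \<le> ennreal lam * ennreal (b y)"
        using P(3)
      proof eventually_elim
        case (elim y)
        show ?case
        proof (cases "y \<in> \<Union>(cube ` P)")
          case False
          then have "ennreal (F y) \<le> ennreal lam" using elim by simp
          then have "F y \<le> lam" using lam by (simp add: ennreal_le_iff)
          then have "F y * b y \<le> lam * b y" using b0 by (intro mult_right_mono)
          then show ?thesis using False lam b0 by (simp add: ennreal_mult[symmetric] ennreal_leI)
        qed simp
      qed
    qed
    also have "\<dots> = ennreal lam * (\<integral>\<^sup>+y. ennreal (b y) \<partial>lebesgue)" by (intro nn_integral_cmult) simp
    also have "\<dots> \<le> ennreal lam * ennreal bump_const" by (intro mult_left_mono bI) simp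
    finally show ?thesis .
  qed
  have "(\<integral>\<^sup>+y\<in>\<Union>(cube ` P). ennreal (F y * b y) \<partial>lebesgue) \<le> (\<integral>\<^sup>+y\<in>\<Union>(cube ` P). ennreal (C * b y) \<partial>lebesgue)"
  proof (rule nn_integral_disjoint_UN_mono[OF _ _ cP _ P(1)])
    fix p assume p: "p \<in> P"
    define bc where "bc = bump \<alpha> l (x - corner p)"
    have bc0: "0 \<le> bc" by (simp add: bc_def)
    have near: "norm (y - corner p) \<le> norm (x - corner p) / 3" if "y \<in> cube p" for y
      using norm_cube[OF that corner_mem] x[OF p] by simp
    have 1: "b y \<le> 2 powr ?e * bc" if "y \<in> cube p" for y
      unfolding b_def bc_def
    proof (rule bump_mono[OF l alpha])
      show "norm (x - corner p) \<le> 2 * norm (x - y) + (2 - 1) * l"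
      proof -
        have "norm (x - corner p) \<le> norm (x - y) + norm (y - corner p)"
          using norm_triangle_ineq[of "x - y" "y - corner p"] by simp
        moreover have "(2 - 1) * l = l" by simp
        ultimately show ?thesis using near[OF that] l norm_ge_zero[of "x - y"] by linarith
      qed
    qed simp
    have 2: "bc \<le> 2 powr ?e * b y" if "y \<in> cube p" for y
      unfolding b_def bc_def
    proof (rule bump_mono[OF l alpha])
      show "norm (x - y) \<le> 2 * norm (x - corner p) + (2 - 1) * l"
      proof -
        have "norm (x - y) \<le> norm (x - corner p) + norm (y - corner p)"
          using norm_triangle_ineq4[of "x - corner p" "y - corner p"] by simp
        moreover have "(2 - 1) * l = l" by simp
        ultimately show ?thesis using near[OF that] l norm_ge_zero[of "x - corner p"] by linarith
      qed
    qed simp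
    have "(\<integral>\<^sup>+y\<in>cube p. ennreal (F y * b y) \<partial>lebesgue) \<le> (\<integral>\<^sup>+y. ennreal (2 powr ?e * bc) * (ennreal (F y) * indicator (cube p) y) \<partial>lebesgue)"
    proof (rule nn_integral_mono)
      fix y
      have "y \<in> cube p \<Longrightarrow> F y * b y \<le> 2 powr ?e * bc * F y"
        using mult_left_mono[OF 1 F(2), of y y] by (simp add: mult_ac)
      then show "ennreal (F y * b y) * indicator (cube p) y \<le> ennreal (2 powr ?e * bc) * (ennreal (F y) * indicator (cube p) y)"
        using bc0 F(2)[of y] by (auto simp: ennreal_mult[symmetric] ennreal_leI indicator_def)
    qed
    also have "\<dots> = ennreal (2 powr ?e * bc) * (\<integral>\<^sup>+y\<in>cube p. ennreal (F y) \<partial>lebesgue)"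
      by (intro nn_integral_cmult) measurable
    also have "\<dots> \<le> ennreal (2 powr ?e * bc) * ennreal (2 ^ CARD('n) * lam * vol p)"
      by (intro mult_left_mono P(2)[OF p]) simp
    also have "\<dots> = ennreal (2 powr ?e * 2 ^ CARD('n) * lam * bc) * ennreal (vol p)"
      using bc0 lam by (simp add: ennreal_mult[symmetric] mult_ac)
    also have "\<dots> = (\<integral>\<^sup>+y. ennreal (2 powr ?e * 2 ^ CARD('n) * lam * bc) * indicator (cube p) y \<partial>lebesgue)"
      by (simp add: nn_integral_cmult_indicator emeasure_cube)
    also have "\<dots> \<le> (\<integral>\<^sup>+y\<in>cube p. ennreal (C * b y) \<partial>lebesgue)"
    proof (rule nn_integral_mono)
      fix y
      have "2 powr ?e * 2 ^ CARD('n) * lam * bc \<le> C * b y" if "y \<in> cube p"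
      proof -
        have "2 powr ?e * 2 ^ CARD('n) * lam * bc \<le> 2 powr ?e * 2 ^ CARD('n) * lam * (2 powr ?e * b y)"
          using lam by (intro mult_left_mono 2[OF that]) auto
        also have "\<dots> = (2 powr ?e * 2 powr ?e) * 2 ^ CARD('n) * lam * b y" by (simp only: mult_ac)
        also have "2 powr ?e * 2 powr ?e = 4 powr ?e" by (simp flip: powr_mult)
        finally show ?thesis by (simp add: C_def)
      qed
      then show "ennreal (2 powr ?e * 2 ^ CARD('n) * lam * bc) * indicator (cube p) y \<le> ennreal (C * b y) * indicator (cube p) y"
        by (auto simp: indicator_def intro!: ennreal_leI)
    qed
    finally show "(\<integral>\<^sup>+y\<in>cube p. ennreal (F y * b y) \<partial>lebesgue) \<le> (\<integral>\<^sup>+y\<in>cube p. ennreal (C * b y) \<partial>lebesgue)" .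
  qed auto
  also have "\<dots> \<le> (\<integral>\<^sup>+y. ennreal C * ennreal (b y) \<partial>lebesgue)"
    using C0 b0 by (intro nn_integral_mono) (auto simp: indicator_def ennreal_mult)
  also have "\<dots> = ennreal C * (\<integral>\<^sup>+y. ennreal (b y) \<partial>lebesgue)" by (intro nn_integral_cmult) simp
  also have "\<dots> \<le> ennreal C * ennreal bump_const" by (intro mult_left_mono bI) simp
  finally have on: "(\<integral>\<^sup>+y\<in>\<Union>(cube ` P). ennreal (F y * b y) \<partial>lebesgue) \<le> ennreal C * ennreal bump_const" .
  have "(\<integral>\<^sup>+y. ennreal (F y * b y) \<partial>lebesgue) = (\<integral>\<^sup>+y. ennreal (F y * b y) * indicator (\<Union>(cube ` P)) y + ennreal (F y * b y) * indicator (- \<Union>(cube ` P)) y \<partial>lebesgue)"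
    by (intro nn_integral_cong) (auto simp: indicator_def)
  also have "\<dots> = (\<integral>\<^sup>+y\<in>\<Union>(cube ` P). ennreal (F y * b y) \<partial>lebesgue) + (\<integral>\<^sup>+y\<in>- \<Union>(cube ` P). ennreal (F y * b y) \<partial>lebesgue)"
    by (intro nn_integral_add) measurable
  also have "\<dots> \<le> ennreal C * ennreal bump_const + ennreal lam * ennreal bump_const" by (intro add_mono on off)
  also have "\<dots> = ennreal (tail_const * lam)"
    using C0 lam bump_const(1)
    by (simp add: ennreal_mult[symmetric] ennreal_plus[symmetric] tail_const_def C_def algebra_simps del: ennreal_plus)
  finally show ?thesis by (simp add: b_def)
qed

end

lemma emeasure_superlevel_le:
  fixes u :: "'a \<Rightarrow> real"
  assumes [measurable]: "u \<in> borel_measurable M" "A \<in> sets M" and c: "0 \<le> c"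
  shows "ennreal c * emeasure M {x \<in> space M. x \<in> A \<and> c < u x} \<le> (\<integral>\<^sup>+x\<in>A. ennreal (u x) \<partial>M)"
proof -
  have "ennreal c * emeasure M {x \<in> space M. x \<in> A \<and> c < u x} = (\<integral>\<^sup>+x. ennreal c * indicator {x \<in> space M. x \<in> A \<and> c < u x} x \<partial>M)"
    by (subst nn_integral_cmult_indicator) auto
  also have "\<dots> \<le> (\<integral>\<^sup>+x\<in>A. ennreal (u x) \<partial>M)"
    by (intro nn_integral_mono) (auto simp: indicator_def ennreal_leI)
  finally show ?thesis .
qed

lemma integral_le_of_nn_integral:
  fixes h :: "'a \<Rightarrow> real"
  assumes h: "h \<in> borel_measurable M" "\<And>x. 0 \<le> h x" and le: "(\<integral>\<^sup>+x. ennreal (h x) \<partial>M) \<le> ennreal c" and c: "0 \<le> c"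
  shows "integrable M h" "(\<integral>x. h x \<partial>M) \<le> c"
proof -
  have "(\<integral>\<^sup>+x. ennreal (h x) \<partial>M) < \<infinity>" using le ennreal_less_top le_less_trans by (metis infinity_ennreal_def)
  then show i: "integrable M h" using h by (intro integrableI_nonneg) auto
  have "ennreal (\<integral>x. h x \<partial>M) = (\<integral>\<^sup>+x. ennreal (h x) \<partial>M)" using h(2) by (intro nn_integral_eq_integral[OF i, symmetric]) auto
  then have "ennreal (\<integral>x. h x \<partial>M) \<le> ennreal c" using le by simp
  then show "(\<integral>x. h x \<partial>M) \<le> c" using c by (simp add: ennreal_le_iff)
qed

lemma AE_pos_measure_ex:
  assumes "AE x in M. Q x" "S \<in> sets M" "0 < emeasure M S"
  shows "\<exists>x\<in>S. Q x"
proof (rule ccontr)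
  assume n: "\<not> (\<exists>x\<in>S. Q x)"
  have "AE x in M. x \<notin> S" using assms(1) by eventually_elim (use n in blast)
  then have "emeasure M S = 0" using assms(2) AE_iff_measurable[of S M "\<lambda>x. x \<notin> S"] sets.sets_into_space[OF assms(2)] by auto
  then show False using assms(3) by simp
qed

context cz_grid begin

text \<open>Outside the stopping cubes the good part is at most \<open>lam\<close>, and on the finitely many treated cubes it is a mean and so at most
  \<open>2\<^sup>n lam\<close>; there its \<open>s\<close>-th power is controlled by its first power. On the remaining cubes \<open>f\<close> is left
  unchanged, and their contribution is small by assumption.\<close>

lemma good_part_Ls:
  assumes r: "1 < r" and s: "1 < s" and f: "\<And>j. f j \<in> Linfc" and lam: "0 < lam"
    and P: "disjoint_family_on cube P"
      "\<And>p. p \<in> P \<Longrightarrow> (\<integral>\<^sup>+y\<in>cube p. ennreal (fin_norm J r (\<lambda>j. f j y)) \<partial>lebesgue) \<le> ennreal (2 ^ CARD('n) * lam * vol p)"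
      "AE x in lebesgue. x \<notin> \<Union>(cube ` P) \<longrightarrow> ennreal (fin_norm J r (\<lambda>j. f j x)) \<le> ennreal lam"
    and P': "finite P'" "P' \<subseteq> P"
    and tail: "(\<integral>\<^sup>+x\<in>(\<Union>(cube ` P) - \<Union>(cube ` P')). ennreal (fin_norm J r (\<lambda>j. f j x) powr s) \<partial>lebesgue)
       \<le> ennreal (lam powr (s - 1) * (\<integral>y. fin_norm J r (\<lambda>j. f j y) \<partial>lebesgue))"
  shows "(\<integral>\<^sup>+x. ennreal (fin_norm J r (\<lambda>j. f j x - (\<Sum>p\<in>P'. bad p (f j) x)) powr s) \<partial>lebesgue)
      \<le> ennreal (3 * (2 ^ CARD('n) * lam) powr (s - 1) * (\<integral>y. fin_norm J r (\<lambda>j. f j y) \<partial>lebesgue))"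
proof -
  have r0: "0 < r" using r by simp
  define F where "F y = fin_norm J r (\<lambda>j. f j y)" for y
  have F0: "0 \<le> F y" for y by (simp add: F_def)
  have Fm[measurable]: "F \<in> borel_measurable lebesgue" unfolding F_def[abs_def] by (rule fin_norm_Linfc(1)[of f, OF f r0])
  have Fi: "integrable lebesgue F" unfolding F_def[abs_def] by (rule fin_norm_integrable[of f, OF f r0])
  define I where "I = (\<integral>y. F y \<partial>lebesgue)"
  have I0: "0 \<le> I" unfolding I_def using F0 by simp
  have FI: "(\<integral>\<^sup>+y. ennreal (F y) \<partial>lebesgue) = ennreal I" unfolding I_def using F0 by (intro nn_integral_eq_integral[OF Fi]) simp
  have cP: "countable P" by (rule countable_subset[OF subset_UNIV]) simp
  define U where "U = \<Union>(cube ` P)"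
  define U' where "U' = \<Union>(cube ` P')"
  have Um[measurable]: "U \<in> sets lebesgue" unfolding U_def using cP by (intro sets.countable_UN') auto
  have U'm[measurable]: "U' \<in> sets lebesgue" unfolding U'_def using P' by (intro sets.finite_Union) auto
  define c where "c p = fin_norm J r (\<lambda>j. avg p (f j))" for p
  have c0: "0 \<le> c p" for p by (simp add: c_def)
  have cvol: "ennreal (c p) * ennreal (vol p) \<le> (\<integral>\<^sup>+y\<in>cube p. ennreal (F y) \<partial>lebesgue)" for p
  proof -
    have "vol p * c p \<le> (LINT y:cube p|lebesgue. F y)"
      unfolding c_def F_def by (rule fin_norm_avg[of f, OF f r])
    then show ?thesis
      using c0[of p] by (simp add: set_nn_integral_eq_LINT[OF Fi F0 cube_measurable] ennreal_mult[symmetric] ennreal_leI mult.commute)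
  qed
  have cle: "c p \<le> 2 ^ CARD('n) * lam" if "p \<in> P" for p
  proof -
    have "ennreal (c p) * ennreal (vol p) \<le> ennreal (2 ^ CARD('n) * lam * vol p)"
      using cvol[of p] P(2)[OF that] unfolding F_def by (rule order_trans)
    then have "c p * vol p \<le> 2 ^ CARD('n) * lam * vol p"
      using c0[of p] lam by (simp add: ennreal_mult[symmetric] ennreal_le_iff)
    then show ?thesis using vol_pos[of p] by (simp only: mult_le_cancel_right_pos)
  qed
  define D where "D = (2 ^ CARD('n) * lam) powr (s - 1)"
  have D0: "0 \<le> D" by (simp add: D_def)
  have lD: "lam powr (s - 1) \<le> D" unfolding D_def
  proof (rule powr_mono2)
    have "1 * lam \<le> 2 ^ CARD('n) * lam" using lam by (intro mult_right_mono) auto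
    then show "lam \<le> 2 ^ CARD('n) * lam" by simp
  qed (use s lam in auto)
  have pow: "x powr s \<le> y powr (s - 1) * x" if "0 \<le> x" "x \<le> y" for x y :: real
  proof -
    have "x powr s = x powr (s - 1) * x" using that s powr_mult_base[of x "s - 1"] by (simp add: mult.commute)
    also have "\<dots> \<le> y powr (s - 1) * x" using that s by (intro mult_right_mono powr_mono2) auto
    finally show ?thesis .
  qed
  define g where "g j y = f j y - (\<Sum>p\<in>P'. bad p (f j) y)" for j y
  have gin: "g j y = avg p (f j)" if "p \<in> P'" "y \<in> cube p" for j y p
  proof -
    have "(\<Sum>p\<in>P'. bad p (f j) y) = (\<Sum>p\<in>{p}. bad p (f j) y)"
    proof (rule sum.mono_neutral_right)
      show "\<forall>i\<in>P' - {p}. bad i (f j) y = 0"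
      proof
        fix i assume i: "i \<in> P' - {p}"
        then have "cube i \<inter> cube p = {}" using P(1) P'(2) that(1) unfolding disjoint_family_on_def by blast
        then show "bad i (f j) y = 0" using that(2) by (auto simp: bad_def cutoff_def)
      qed
    qed (use P' that in auto)
    then show ?thesis using that by (simp add: g_def bad_def cutoff_def)
  qed
  have gout: "g j y = f j y" if "y \<notin> U'" for j y
  proof -
    have "(\<Sum>p\<in>P'. bad p (f j) y) = 0" using that by (intro sum.neutral) (auto simp: U'_def bad_def cutoff_def)
    then show ?thesis by (simp add: g_def)
  qed
  define h1 where "h1 y = (\<Sum>p\<in>P'. ennreal (D * c p) * indicator (cube p) y)" for y
  define h2 where "h2 y = ennreal (F y powr s) * indicator (U - U') y" for y
  have pt: "AE y in lebesgue. ennreal (fin_norm J r (\<lambda>j. g j y) powr s) \<le> h1 y + h2 y + ennreal (D * F y)"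
    using P(3)
  proof eventually_elim
    case (elim y)
    consider (a) "y \<in> U'" | (b) "y \<in> U - U'" | (c) "y \<notin> U \<and> y \<notin> U'" by blast
    then show ?case
    proof cases
      case a
      then obtain p where p: "p \<in> P'" "y \<in> cube p" by (auto simp: U'_def)
      have "fin_norm J r (\<lambda>j. g j y) = c p" using gin[OF p] by (simp add: c_def)
      moreover have "c p powr s \<le> D * c p" unfolding D_def
        using p P'(2) c0 by (intro pow cle) auto
      ultimately have "ennreal (fin_norm J r (\<lambda>j. g j y) powr s) \<le> ennreal (D * c p) * indicator (cube p) y"
        using p by (simp add: ennreal_leI)
      also have "\<dots> \<le> h1 y" unfolding h1_def
        by (rule member_le_sum) (use p P' in auto)
      finally show ?thesis by (simp add: add_increasing2 add.assoc)
    next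
      case b
      then have "ennreal (fin_norm J r (\<lambda>j. g j y) powr s) = h2 y" using gout by (simp add: h2_def F_def)
      then show ?thesis by (simp add: add_increasing add_increasing2)
    next
      case c
      then have "F y \<le> lam" using elim lam by (simp add: U_def F_def ennreal_le_iff)
      then have "F y powr s \<le> lam powr (s - 1) * F y" by (intro pow F0)
      also have "\<dots> \<le> D * F y" by (intro mult_right_mono lD F0)
      finally have "ennreal (fin_norm J r (\<lambda>j. g j y) powr s) \<le> ennreal (D * F y)"
        using c gout by (simp add: F_def ennreal_leI)
      then show ?thesis by (simp add: add_increasing)
    qed
  qed
  have [measurable]: "h1 \<in> borel_measurable lebesgue" unfolding h1_def[abs_def] by measurable
  have [measurable]: "h2 \<in> borel_measurable lebesgue" unfolding h2_def[abs_def] by measurable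
  have "(\<integral>\<^sup>+y. ennreal (fin_norm J r (\<lambda>j. g j y) powr s) \<partial>lebesgue) \<le> (\<integral>\<^sup>+y. h1 y + h2 y + ennreal (D * F y) \<partial>lebesgue)"
    by (rule nn_integral_mono_AE[OF pt])
  also have "\<dots> = (\<integral>\<^sup>+y. h1 y \<partial>lebesgue) + (\<integral>\<^sup>+y. h2 y \<partial>lebesgue) + (\<integral>\<^sup>+y. ennreal (D * F y) \<partial>lebesgue)"
    by (subst nn_integral_add; (subst nn_integral_add)?; measurable)
  also have "(\<integral>\<^sup>+y. h1 y \<partial>lebesgue) \<le> ennreal (D * I)"
  proof -
    have "(\<integral>\<^sup>+y. h1 y \<partial>lebesgue) = (\<Sum>p\<in>P'. ennreal (D * c p) * ennreal (vol p))"
      unfolding h1_def by (subst nn_integral_sum) (auto simp: nn_integral_cmult_indicator emeasure_cube)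
    also have "\<dots> \<le> (\<Sum>p\<in>P'. ennreal D * (\<integral>\<^sup>+y\<in>cube p. ennreal (F y) \<partial>lebesgue))"
    proof (rule sum_mono)
      fix p
      have "ennreal (D * c p) * ennreal (vol p) = ennreal D * (ennreal (c p) * ennreal (vol p))"
        using D0 c0 by (simp add: ennreal_mult mult_ac)
      also have "\<dots> \<le> ennreal D * (\<integral>\<^sup>+y\<in>cube p. ennreal (F y) \<partial>lebesgue)" by (intro mult_left_mono cvol) simp
      finally show "ennreal (D * c p) * ennreal (vol p) \<le> ennreal D * (\<integral>\<^sup>+y\<in>cube p. ennreal (F y) \<partial>lebesgue)" .
    qed
    also have "\<dots> = ennreal D * (\<Sum>p\<in>P'. \<integral>\<^sup>+y\<in>cube p. ennreal (F y) \<partial>lebesgue)" by (simp add: sum_distrib_left)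
    also have "(\<Sum>p\<in>P'. \<integral>\<^sup>+y\<in>cube p. ennreal (F y) \<partial>lebesgue) = (\<integral>\<^sup>+p. (\<integral>\<^sup>+y\<in>cube p. ennreal (F y) \<partial>lebesgue) \<partial>count_space P')"
      using P' by (simp add: nn_integral_count_space_finite)
    also have "\<dots> = (\<integral>\<^sup>+y\<in>\<Union>(cube ` P'). ennreal (F y) \<partial>lebesgue)"
      using P' P(1) by (intro nn_integral_disjoint_UN[symmetric]) (auto intro: disjoint_family_on_mono countable_finite)
    also have "\<dots> \<le> (\<integral>\<^sup>+y. ennreal (F y) \<partial>lebesgue)" by (intro nn_integral_mono) (auto simp: indicator_def)
    also have "\<dots> = ennreal I" by (rule FI)
    finally show ?thesis using D0 I0 by (simp add: ennreal_mult mult_left_mono)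
  qed
  also have "(\<integral>\<^sup>+y. h2 y \<partial>lebesgue) \<le> ennreal (D * I)"
  proof -
    have "(\<integral>\<^sup>+y. h2 y \<partial>lebesgue) \<le> ennreal (lam powr (s - 1) * I)"
      using tail unfolding h2_def I_def F_def U_def U'_def .
    also have "\<dots> \<le> ennreal (D * I)" by (intro ennreal_leI mult_right_mono lD I0)
    finally show ?thesis .
  qed
  also have "(\<integral>\<^sup>+y. ennreal (D * F y) \<partial>lebesgue) = ennreal (D * I)"
    using D0 F0 I0 FI by (simp add: ennreal_mult nn_integral_cmult)
  also have "ennreal (D * I) + ennreal (D * I) + ennreal (D * I) = ennreal (3 * D * I)"
    using D0 I0 by (simp add: ennreal_plus[symmetric] del: ennreal_plus)
  finally show ?thesis by (simp add: g_def D_def I_def F_def add_mono)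
qed

lemma stopping_cubes_dilated:
  assumes "countable P" "disjoint_family_on cube P"
  shows "emeasure lebesgue (\<Union>p\<in>P. ball (corner p) (3 * real CARD('n) * side p))
     \<le> ennreal ((6 * real CARD('n)) ^ CARD('n)) * emeasure lebesgue (\<Union>(cube ` P))"
proof -
  have "emeasure lebesgue (\<Union>p\<in>P. ball (corner p) (3 * real CARD('n) * side p))
     \<le> (\<integral>\<^sup>+p. emeasure lebesgue (ball (corner p) (3 * real CARD('n) * side p)) \<partial>count_space P)"
    using assms(1) by (intro emeasure_UN_le_count fmeasurableD lmeasurable_ball)
  also have "\<dots> \<le> (\<integral>\<^sup>+p. ennreal ((6 * real CARD('n)) ^ CARD('n)) * emeasure lebesgue (cube p) \<partial>count_space P)"
  proof (rule nn_integral_mono)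
    fix p
    have "emeasure lebesgue (ball (corner p) (3 * real CARD('n) * side p)) \<le> ennreal ((2 * (3 * real CARD('n) * side p)) ^ CARD('n))"
      by (intro emeasure_ball_le mult_pos_pos) auto
    also have "(2 * (3 * real CARD('n) * side p)) ^ CARD('n) = (6 * real CARD('n)) ^ CARD('n) * vol p"
    proof -
      have "2 * (3 * real CARD('n) * side p) = (6 * real CARD('n)) * side p" by simp
      then show ?thesis by (simp only: vol_def power_mult_distrib)
    qed
    finally show "emeasure lebesgue (ball (corner p) (3 * real CARD('n) * side p)) \<le> ennreal ((6 * real CARD('n)) ^ CARD('n)) * emeasure lebesgue (cube p)"
      by (simp add: emeasure_cube ennreal_mult)
  qed
  also have "\<dots> = ennreal ((6 * real CARD('n)) ^ CARD('n)) * (\<integral>\<^sup>+p. emeasure lebesgue (cube p) \<partial>count_space P)"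
    by (intro nn_integral_cmult) simp
  also have "(\<integral>\<^sup>+p. emeasure lebesgue (cube p) \<partial>count_space P) = emeasure lebesgue (\<Union>(cube ` P))"
    using assms by (intro emeasure_UN_countable[symmetric]) auto
  finally show ?thesis .
qed

text \<open>The Calderon-Zygmund decomposition at height \<open>lam\<close>. The good part is estimated by the strong type bound, and the bad
  part in \<open>L\<^sup>1\<close> outside the dilated stopping cubes by cancellation. The last conclusion is a second property
  of the complement of the same exceptional set, namely that it controls the maximal operator of \<open>bump\<close>.\<close>

lemma weak_type:
  assumes r: "1 < r" and s: "1 < s" and B: "0 \<le> B" and SB: "strong_type J r s B"
    and f: "\<And>j. f j \<in> Linfc" and lam: "0 < lam"
    and top: "\<And>x. (\<integral>\<^sup>+y\<in>cube (idx k0 x). ennreal (fin_norm J r (\<lambda>j. f j y)) \<partial>lebesgue) \<le> ennreal (lam * vol (idx k0 x))"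
  obtains E where "E \<in> sets lebesgue"
    "ennreal lam * emeasure lebesgue E \<le> ennreal (weak_const s B * (\<integral>y. fin_norm J r (\<lambda>j. f j y) \<partial>lebesgue))"
    "AE x in lebesgue. x \<notin> E \<longrightarrow> fin_norm J r (\<lambda>j. T (f j) x) \<le> 2 * lam"
    "\<And>x l. x \<notin> E \<Longrightarrow> 0 < l \<Longrightarrow>
       (\<integral>\<^sup>+y. ennreal (fin_norm J r (\<lambda>j. f j y) * bump \<alpha> l (x - y)) \<partial>lebesgue) \<le> ennreal (tail_const * lam)"
proof -
  have r0: "0 < r" using r by simp
  define F where "F y = fin_norm J r (\<lambda>j. f j y)" for y
  have F0: "0 \<le> F y" for y by (simp add: F_def)
  have Fm[measurable]: "F \<in> borel_measurable lebesgue" unfolding F_def[abs_def] by (rule fin_norm_Linfc(1)[of f, OF f r0])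
  have Fi: "integrable lebesgue F" unfolding F_def[abs_def] by (rule fin_norm_integrable[of f, OF f r0])
  define I where "I = (\<integral>y. F y \<partial>lebesgue)"
  have I0: "0 \<le> I" unfolding I_def using F0 by simp
  have FI: "(\<integral>\<^sup>+y. ennreal (F y) \<partial>lebesgue) = ennreal I" unfolding I_def using F0 by (intro nn_integral_eq_integral[OF Fi]) simp
  have Fem: "(\<lambda>y. ennreal (F y)) \<in> borel_measurable lebesgue" by measurable
  obtain P where P1: "\<And>p. p \<in> P \<Longrightarrow> k0 < fst p"
    and P2: "\<And>p. p \<in> P \<Longrightarrow> ennreal (lam * vol p) < (\<integral>\<^sup>+y\<in>cube p. ennreal (F y) \<partial>lebesgue)"
    and P3: "\<And>p. p \<in> P \<Longrightarrow> (\<integral>\<^sup>+y\<in>cube p. ennreal (F y) \<partial>lebesgue) \<le> ennreal (2 ^ CARD('n) * lam * vol p)"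
    and P4: "disjoint_family_on cube P"
    and P5: "AE x in lebesgue. x \<notin> \<Union>(cube ` P) \<longrightarrow> ennreal (F x) \<le> ennreal lam"
    by (rule calderon_zygmund_cubes[OF Fem lam top[folded F_def]]) (rule that)
  have cP: "countable P" by (rule countable_subset[OF subset_UNIV]) simp
  define U where "U = \<Union>(cube ` P)"
  have Um[measurable]: "U \<in> sets lebesgue" unfolding U_def using cP by (intro sets.countable_UN') auto
  have lamU: "ennreal lam * emeasure lebesgue U \<le> ennreal I"
  proof -
    have "ennreal lam * emeasure lebesgue U = (\<integral>\<^sup>+y\<in>U. ennreal lam \<partial>lebesgue)" by (simp add: nn_integral_cmult_indicator)
    also have "\<dots> \<le> (\<integral>\<^sup>+y\<in>U. ennreal (F y) \<partial>lebesgue)" unfolding U_def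
    proof (rule nn_integral_disjoint_UN_mono[OF _ _ cP _ P4])
      fix p assume "p \<in> P"
      from P2[OF this] show "(\<integral>\<^sup>+y\<in>cube p. ennreal lam \<partial>lebesgue) \<le> (\<integral>\<^sup>+y\<in>cube p. ennreal (F y) \<partial>lebesgue)"
        using lam by (simp add: nn_integral_cmult_indicator emeasure_cube ennreal_mult)
    qed (use Fem in auto)
    also have "\<dots> \<le> (\<integral>\<^sup>+y. ennreal (F y) \<partial>lebesgue)" by (intro nn_integral_mono) (auto simp: indicator_def)
    finally show ?thesis by (simp add: FI)
  qed
  \<comment> \<open>Outside these balls both the cancellation estimate and the comparability of \<open>bump\<close> are available.\<close>
  define G where "G = (\<Union>p\<in>P. ball (corner p) (3 * real CARD('n) * side p))"
  have Gm[measurable]: "G \<in> sets lebesgue" unfolding G_def using cP by (intro sets.countable_UN' image_subsetI fmeasurableD lmeasurable_ball)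
  have Gc[measurable]: "- G \<in> sets lebesgue" using Gm by (simp only: Compl_in_sets_lebesgue)
  have offG: "3 * real CARD('n) * side p \<le> norm (x - corner p)" if "p \<in> P" "x \<notin> G" for p x
    using that by (force simp: G_def dist_norm norm_minus_commute)
  define c1 where "c1 = (6 * real CARD('n)) ^ CARD('n)"
  have lamG: "ennreal lam * emeasure lebesgue G \<le> ennreal (c1 * I)"
  proof -
    have "ennreal lam * emeasure lebesgue G \<le> ennreal lam * (ennreal c1 * emeasure lebesgue U)"
      unfolding G_def U_def c1_def by (intro mult_left_mono stopping_cubes_dilated cP P4) simp
    also have "\<dots> = ennreal c1 * (ennreal lam * emeasure lebesgue U)" by (simp only: mult_ac)
    also have "\<dots> \<le> ennreal c1 * ennreal I" by (intro mult_left_mono lamU) simp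
    finally show ?thesis using I0 by (simp add: ennreal_mult c1_def)
  qed
  have Fs: "(\<integral>\<^sup>+x. ennreal (F x powr s) \<partial>lebesgue) < \<infinity>"
    using fin_norm_powr_integrable[of f r s J, OF f r0] s unfolding F_def
    by (subst nn_integral_eq_integral) auto
  obtain P' where P': "finite P'" "P' \<subseteq> P"
    and tail: "(\<integral>\<^sup>+x\<in>(\<Union>(cube ` P) - \<Union>(cube ` P')). ennreal (F x powr s) \<partial>lebesgue) \<le> ennreal (lam powr (s - 1) * I)"
  proof (cases "I = 0")
    case True
    have "P = {}"
    proof (rule ccontr)
      assume "P \<noteq> {}"
      then obtain p where p: "p \<in> P" by auto
      have "(\<integral>\<^sup>+y\<in>cube p. ennreal (F y) \<partial>lebesgue) \<le> (\<integral>\<^sup>+y. ennreal (F y) \<partial>lebesgue)"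
        by (intro nn_integral_mono) (auto simp: indicator_def)
      then show False using P2[OF p] True by (simp add: FI)
    qed
    then show ?thesis by (intro that[of "{}"]) auto
  next
    case False
    have d: "0 < ennreal (lam powr (s - 1) * I)" using False I0 lam by simp
    show ?thesis
    proof (rule finite_tail_small[where A = cube, OF _ Fs cP cube_measurable d])
      show "(\<lambda>x. ennreal (F x powr s)) \<in> borel_measurable lebesgue" by measurable
    qed (rule that, assumption, assumption, rule less_imp_le)
  qed
  define b where "b p j = bad p (f j)" for p j
  define g where "g j y = f j y - (\<Sum>p\<in>P'. b p j y)" for j y
  have bL: "b p j \<in> Linfc" for p j unfolding b_def by (rule bad_Linfc[OF f])
  have sL: "(\<lambda>y. \<Sum>p\<in>P'. b p j y) \<in> Linfc" for j using bL P' by (intro Linfc_sum) auto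
  have gL: "g j \<in> Linfc" for j unfolding g_def[abs_def] by (intro Linfc_diff f sL)
  have gs: "(\<integral>\<^sup>+x. ennreal (fin_norm J r (\<lambda>j. g j x) powr s) \<partial>lebesgue) \<le> ennreal (3 * (2 ^ CARD('n) * lam) powr (s - 1) * I)"
    unfolding g_def b_def I_def F_def
    by (rule good_part_Ls[OF r s f lam P4 _ _ P']) (use P3 P5 tail in \<open>auto simp: F_def I_def\<close>)
  define E1 where "E1 = {x \<in> space lebesgue. x \<in> UNIV \<and> lam powr s < fin_norm J r (\<lambda>j. T (g j) x) powr s}"
  have Tgm[measurable]: "(\<lambda>x. fin_norm J r (\<lambda>j. T (g j) x)) \<in> borel_measurable lebesgue" by (rule fin_norm_T_meas[OF gL])
  have E1m[measurable]: "E1 \<in> sets lebesgue" unfolding E1_def by measurable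
  define c2 where "c2 = 3 * B * (2 ^ CARD('n)) powr (s - 1)"
  have lamE1: "ennreal lam * emeasure lebesgue E1 \<le> ennreal (c2 * I)"
  proof -
    have "ennreal (lam powr s) * emeasure lebesgue E1 \<le> (\<integral>\<^sup>+x\<in>UNIV. ennreal (fin_norm J r (\<lambda>j. T (g j) x) powr s) \<partial>lebesgue)"
      unfolding E1_def by (rule emeasure_superlevel_le) auto
    also have "\<dots> \<le> ennreal B * (\<integral>\<^sup>+x. ennreal (fin_norm J r (\<lambda>j. g j x) powr s) \<partial>lebesgue)"
      using SB gL unfolding strong_type_def by simp
    also have "\<dots> \<le> ennreal B * ennreal (3 * (2 ^ CARD('n) * lam) powr (s - 1) * I)" by (intro mult_left_mono gs) simp
    also have "\<dots> = ennreal (lam powr (s - 1)) * ennreal (c2 * I)"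
      using B I0 by (simp add: ennreal_mult[symmetric] powr_mult c2_def mult_ac)
    also have "lam powr s = lam powr (s - 1) * lam" using lam powr_mult_base[of lam "s - 1"] by (simp add: mult.commute)
    finally have "ennreal (lam powr (s - 1)) * (ennreal lam * emeasure lebesgue E1) \<le> ennreal (lam powr (s - 1)) * ennreal (c2 * I)"
      using lam by (simp add: ennreal_mult mult.assoc)
    then show ?thesis using lam by (simp add: ennreal_mult_le_mult_iff)
  qed
  define W where "W x = (\<Sum>p\<in>P'. fin_norm J r (\<lambda>j. T (b p j) x))" for x
  have Tbm[measurable]: "(\<lambda>x. fin_norm J r (\<lambda>j. T (b p j) x)) \<in> borel_measurable lebesgue" for p by (rule fin_norm_T_meas[OF bL])
  have Wm[measurable]: "W \<in> borel_measurable lebesgue" unfolding W_def[abs_def] by measurable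
  define E2 where "E2 = {x \<in> space lebesgue. x \<in> - G \<and> lam < W x}"
  have E2m[measurable]: "E2 \<in> sets lebesgue" unfolding E2_def by measurable
  define c3 where "c3 = 2 * ker_const * bump_const"
  have c30: "0 \<le> c3" using ker_const_nonneg bump_const(1) by (simp add: c3_def)
  have lamE2: "ennreal lam * emeasure lebesgue E2 \<le> ennreal (c3 * I)"
  proof -
    have "ennreal lam * emeasure lebesgue E2 \<le> (\<integral>\<^sup>+x\<in>- G. ennreal (W x) \<partial>lebesgue)"
      unfolding E2_def using lam by (intro emeasure_superlevel_le Wm Gc) simp
    also have "\<dots> = (\<integral>\<^sup>+x. (\<Sum>p\<in>P'. ennreal (fin_norm J r (\<lambda>j. T (b p j) x)) * indicator (- G) x) \<partial>lebesgue)"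
      unfolding W_def by (intro nn_integral_cong) (simp add: sum_ennreal[symmetric] sum_distrib_right del: sum_ennreal)
    also have "\<dots> = (\<Sum>p\<in>P'. \<integral>\<^sup>+x\<in>- G. ennreal (fin_norm J r (\<lambda>j. T (b p j) x)) \<partial>lebesgue)"
      by (intro nn_integral_sum) measurable
    also have "\<dots> \<le> (\<Sum>p\<in>P'. ennreal c3 * (\<integral>\<^sup>+y\<in>cube p. ennreal (F y) \<partial>lebesgue))"
    proof (rule sum_mono)
      fix p assume p: "p \<in> P'"
      have "(\<integral>\<^sup>+x\<in>- G. ennreal (fin_norm J r (\<lambda>j. T (b p j) x)) \<partial>lebesgue) \<le> ennreal (c3 * (LINT y:cube p|lebesgue. F y))"
        unfolding b_def c3_def F_def
        by (rule T_bad_L1[OF f r]) (rule Gc, rule offG[OF subsetD[OF P'(2) p]], simp)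
      also have "\<dots> = ennreal c3 * (\<integral>\<^sup>+y\<in>cube p. ennreal (F y) \<partial>lebesgue)"
        using c30 LINT_nonneg[of F, OF F0] by (simp add: set_nn_integral_eq_LINT[OF Fi F0 cube_measurable] ennreal_mult)
      finally show "(\<integral>\<^sup>+x\<in>- G. ennreal (fin_norm J r (\<lambda>j. T (b p j) x)) \<partial>lebesgue) \<le> ennreal c3 * (\<integral>\<^sup>+y\<in>cube p. ennreal (F y) \<partial>lebesgue)" .
    qed
    also have "\<dots> = ennreal c3 * (\<Sum>p\<in>P'. \<integral>\<^sup>+y\<in>cube p. ennreal (F y) \<partial>lebesgue)" by (simp add: sum_distrib_left)
    also have "(\<Sum>p\<in>P'. \<integral>\<^sup>+y\<in>cube p. ennreal (F y) \<partial>lebesgue) = (\<integral>\<^sup>+p. (\<integral>\<^sup>+y\<in>cube p. ennreal (F y) \<partial>lebesgue) \<partial>count_space P')"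
      using P' by (simp add: nn_integral_count_space_finite)
    also have "\<dots> = (\<integral>\<^sup>+y\<in>\<Union>(cube ` P'). ennreal (F y) \<partial>lebesgue)"
      using P' P4 Fem by (intro nn_integral_disjoint_UN[symmetric]) (auto intro: disjoint_family_on_mono countable_finite)
    also have "ennreal c3 * \<dots> \<le> ennreal c3 * (\<integral>\<^sup>+y. ennreal (F y) \<partial>lebesgue)" by (intro mult_left_mono nn_integral_mono) (auto simp: indicator_def)
    also have "\<dots> = ennreal (c3 * I)" using c30 I0 by (simp add: FI ennreal_mult)
    finally show ?thesis .
  qed
  show thesis
  proof (rule that[of "G \<union> E1 \<union> E2"])
    show "G \<union> E1 \<union> E2 \<in> sets lebesgue" by auto
    have "emeasure lebesgue (G \<union> E1 \<union> E2) \<le> emeasure lebesgue G + emeasure lebesgue E1 + emeasure lebesgue E2"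
      by (rule order_trans[OF emeasure_subadditive add_right_mono[OF emeasure_subadditive]]) auto
    then have "ennreal lam * emeasure lebesgue (G \<union> E1 \<union> E2) \<le> ennreal lam * (emeasure lebesgue G + emeasure lebesgue E1 + emeasure lebesgue E2)"
      by (intro mult_left_mono) auto
    also have "\<dots> \<le> ennreal (c1 * I) + ennreal (c2 * I) + ennreal (c3 * I)"
      unfolding distrib_left by (intro add_mono lamG lamE1 lamE2)
    also have "\<dots> = ennreal (weak_const s B * I)"
      using I0 B c30 by (simp add: ennreal_plus[symmetric] weak_const_def c1_def c2_def c3_def algebra_simps del: ennreal_plus)
    finally show "ennreal lam * emeasure lebesgue (G \<union> E1 \<union> E2) \<le> ennreal (weak_const s B * (\<integral>y. fin_norm J r (\<lambda>j. f j y) \<partial>lebesgue))"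
      by (simp add: I_def F_def)
    have "AE x in lebesgue. T (\<lambda>y. g j y + (\<Sum>p\<in>P'. b p j y)) x = T (g j) x + T (\<lambda>y. \<Sum>p\<in>P'. b p j y) x" for j
      by (rule T_add[OF gL sL])
    then have A1: "AE x in lebesgue. \<forall>j. T (f j) x = T (g j) x + T (\<lambda>y. \<Sum>p\<in>P'. b p j y) x"
      by (intro AE_all_countable[THEN iffD2] allI) (simp add: g_def)
    have A2: "AE x in lebesgue. \<forall>j. T (\<lambda>y. \<Sum>p\<in>P'. b p j y) x = (\<Sum>p\<in>P'. T (b p j) x)"
      by (intro AE_all_countable[THEN iffD2] allI T_sum P' bL)
    show "AE x in lebesgue. x \<notin> G \<union> E1 \<union> E2 \<longrightarrow> fin_norm J r (\<lambda>j. T (f j) x) \<le> 2 * lam"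
      using A1 A2
    proof eventually_elim
      case (elim x)
      show ?case
      proof
        assume x: "x \<notin> G \<union> E1 \<union> E2"
        have "fin_norm J r (\<lambda>j. T (g j) x) \<le> lam"
        proof (rule ccontr)
          assume "\<not> fin_norm J r (\<lambda>j. T (g j) x) \<le> lam"
          then have "lam powr s < fin_norm J r (\<lambda>j. T (g j) x) powr s" using lam s by (intro powr_less_mono2) auto
          then show False using x by (simp add: E1_def)
        qed
        moreover have "W x \<le> lam" using x by (auto simp: E2_def)
        moreover have "fin_norm J r (\<lambda>j. T (f j) x) \<le> fin_norm J r (\<lambda>j. T (g j) x) + fin_norm J r (\<lambda>j. \<Sum>p\<in>P'. T (b p j) x)"
          using elim fin_norm_triangle[OF r, of J "\<lambda>j. T (g j) x" "\<lambda>j. \<Sum>p\<in>P'. T (b p j) x"] by simp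
        moreover have "fin_norm J r (\<lambda>j. \<Sum>p\<in>P'. T (b p j) x) \<le> W x"
          unfolding W_def by (rule fin_norm_sum[OF r P'(1)])
        ultimately show "fin_norm J r (\<lambda>j. T (f j) x) \<le> 2 * lam" by linarith
      qed
    qed
    show "(\<integral>\<^sup>+y. ennreal (fin_norm J r (\<lambda>j. f j y) * bump \<alpha> l (x - y)) \<partial>lebesgue) \<le> ennreal (tail_const * lam)"
      if "x \<notin> G \<union> E1 \<union> E2" "0 < l" for x l
      unfolding F_def[symmetric]
      by (rule bump_average_off_stopping[OF Fm F0 lam that(2) P4 P3 P5]) (assumption, rule offG, assumption, use that in simp)
  qed
qed

end

section \<open>Sparse domination\<close>

context cz_operator begin

text \<open>The height, relative to the mean, at which the exceptional set of the weak type estimate occupies at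
  most the fraction \<open>2\<^bsup>-n-2\<^esup>\<close> of the cube.\<close>

definition loc_const :: "real \<Rightarrow> real \<Rightarrow> real" where
  "loc_const s B = max 1 (weak_const s B * 2 ^ (CARD('n) + 2))"

definition step_const :: "real \<Rightarrow> real \<Rightarrow> real" where
  "step_const s B = 2 * loc_const s B + 2 * loc_const s B * ((1 + 3 * real CARD('n)) powr (real CARD('n) + \<alpha>) * tail_const * loc_const s B)
     + ker_const * tail_const * loc_const s B"

lemma loc_const_ge1: "1 \<le> loc_const s B" by (simp add: loc_const_def)

lemma step_const_ge: "2 * loc_const s B \<le> step_const s B" "0 \<le> step_const s B"
proof -
  have "0 \<le> 2 * loc_const s B * ((1 + 3 * real CARD('n)) powr (real CARD('n) + \<alpha>) * tail_const * loc_const s B)"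
    "0 \<le> ker_const * tail_const * loc_const s B"
    using loc_const_ge1[of s B] tail_const_pos ker_const_nonneg by simp_all
  then show "2 * loc_const s B \<le> step_const s B" unfolding step_const_def by linarith
  then show "0 \<le> step_const s B" using loc_const_ge1[of s B] by linarith
qed

end

context cz_grid begin

text \<open>The integral over the triple is divided by the volume of the cube itself, hence differs from the mean over
  the triple by the factor \<open>3\<^sup>n\<close>.\<close>

definition triple_avg :: "nat \<Rightarrow> real \<Rightarrow> (nat \<Rightarrow> real^'n \<Rightarrow> complex) \<Rightarrow> 'n gidx \<Rightarrow> real" where
  "triple_avg J r f p = (LINT y:triple p|lebesgue. fin_norm J r (\<lambda>j. f j y)) / vol p"

lemma triple_avg_nonneg: "0 \<le> triple_avg J r f p"
  unfolding triple_avg_def by (intro divide_nonneg_nonneg LINT_nonneg) auto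

lemma triple_avg_eq: "(\<integral>y. fin_norm J r (\<lambda>j. cutoff (triple p) (f j) y) \<partial>lebesgue) = triple_avg J r f p * vol p"
proof -
  have "(\<integral>y. fin_norm J r (\<lambda>j. cutoff (triple p) (f j) y) \<partial>lebesgue) = (LINT y:triple p|lebesgue. fin_norm J r (\<lambda>j. f j y))"
    unfolding set_lebesgue_integral_def fin_norm_cutoff
    by (intro Bochner_Integration.integral_cong refl) simp
  then show ?thesis by (simp add: triple_avg_def)
qed

lemma vol_idx: "vol (idx (fst p) x) = vol p"
  by (simp add: vol_def side_def)

text \<open>The weak type estimate at a height proportional to the mean. If the mean is zero, then so is \<open>T f\<close> almost
  everywhere, by the strong type bound.\<close>

lemma local_estimate:
  assumes r: "1 < r" and s: "1 < s" and B: "0 \<le> B" and SB: "strong_type J r s B"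
    and f: "\<And>j. f j \<in> Linfc"
  obtains E where "E \<in> sets lebesgue" "emeasure lebesgue E \<le> ennreal (vol p / 2 ^ (CARD('n) + 2))"
    "AE x in lebesgue. x \<notin> E \<longrightarrow> fin_norm J r (\<lambda>j. T (cutoff (triple p) (f j)) x) \<le> 2 * loc_const s B * triple_avg J r f p"
    "\<And>x l. x \<notin> E \<Longrightarrow> 0 < l \<Longrightarrow>
       (\<integral>\<^sup>+y. ennreal (fin_norm J r (\<lambda>j. cutoff (triple p) (f j) y) * bump \<alpha> l (x - y)) \<partial>lebesgue)
          \<le> ennreal (tail_const * loc_const s B * triple_avg J r f p)"
proof -
  have r0: "0 < r" using r by simp
  define g where "g j = cutoff (triple p) (f j)" for j
  have gL: "g j \<in> Linfc" for j unfolding g_def by (intro Linfc_cutoff f) simp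
  define F where "F y = fin_norm J r (\<lambda>j. g j y)" for y
  have F0: "0 \<le> F y" for y by (simp add: F_def)
  have Fm[measurable]: "F \<in> borel_measurable lebesgue" unfolding F_def[abs_def] by (rule fin_norm_Linfc(1)[of g, OF gL r0])
  have Fi: "integrable lebesgue F" unfolding F_def[abs_def] by (rule fin_norm_integrable[of g, OF gL r0])
  define a where "a = triple_avg J r f p"
  have a0: "0 \<le> a" unfolding a_def by (rule triple_avg_nonneg)
  have Ia: "(\<integral>y. F y \<partial>lebesgue) = a * vol p" unfolding F_def g_def a_def by (rule triple_avg_eq)
  have FI: "(\<integral>\<^sup>+y. ennreal (F y) \<partial>lebesgue) = ennreal (a * vol p)"
    using nn_integral_eq_integral[OF Fi] F0 Ia by simp
  define A where "A = loc_const s B"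
  have A1: "1 \<le> A" unfolding A_def by (rule loc_const_ge1)
  show thesis
  proof (cases "a = 0")
    case True
    have "AE y in lebesgue. ennreal (F y) = 0" using FI True by (simp add: nn_integral_0_iff_AE)
    then have Fz: "AE y in lebesgue. F y = 0" by eventually_elim (use F0 in \<open>simp add: order_antisym\<close>)
    have "(\<integral>\<^sup>+x. ennreal (F x powr s) \<partial>lebesgue) = (\<integral>\<^sup>+x. 0 \<partial>(lebesgue :: (real^'n) measure))"
      by (rule nn_integral_cong_AE) (use Fz in \<open>eventually_elim, simp\<close>)
    then have "(\<integral>\<^sup>+x. ennreal (fin_norm J r (\<lambda>j. T (g j) x) powr s) \<partial>lebesgue) \<le> 0"
      using SB gL unfolding strong_type_def F_def by (metis mult_zero_right nn_integral_const mult_zero_left)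
    moreover have [measurable]: "(\<lambda>x. fin_norm J r (\<lambda>j. T (g j) x)) \<in> borel_measurable lebesgue" by (rule fin_norm_T_meas[OF gL])
    ultimately have "AE x in lebesgue. ennreal (fin_norm J r (\<lambda>j. T (g j) x) powr s) = 0"
      by (subst (asm) le_zero_eq, subst (asm) nn_integral_0_iff_AE) measurable
    then have Tz: "AE x in lebesgue. fin_norm J r (\<lambda>j. T (g j) x) \<le> 0"
      by eventually_elim (simp add: ennreal_eq_0_iff)
    show thesis
    proof (rule that[of "{}"])
      show "AE x in lebesgue. x \<notin> {} \<longrightarrow> fin_norm J r (\<lambda>j. T (cutoff (triple p) (f j)) x) \<le> 2 * loc_const s B * triple_avg J r f p"
        using Tz True by (simp add: a_def g_def)
      fix x l
      have "(\<integral>\<^sup>+y. ennreal (F y * bump \<alpha> l (x - y)) \<partial>lebesgue) = (\<integral>\<^sup>+y. 0 \<partial>(lebesgue :: (real^'n) measure))"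
        by (rule nn_integral_cong_AE) (use Fz in \<open>eventually_elim, simp\<close>)
      then show "(\<integral>\<^sup>+y. ennreal (fin_norm J r (\<lambda>j. cutoff (triple p) (f j) y) * bump \<alpha> l (x - y)) \<partial>lebesgue)
          \<le> ennreal (tail_const * loc_const s B * triple_avg J r f p)" by (simp add: F_def g_def)
    qed auto
  next
    case False
    then have apos: "0 < a" using a0 by simp
    define lam where "lam = A * a"
    have lam0: "0 < lam" using apos A1 by (simp add: lam_def)
    have top: "(\<integral>\<^sup>+y\<in>cube (idx (fst p) x). ennreal (fin_norm J r (\<lambda>j. g j y)) \<partial>lebesgue) \<le> ennreal (lam * vol (idx (fst p) x))" for x
    proof -
      have "(\<integral>\<^sup>+y\<in>cube (idx (fst p) x). ennreal (F y) \<partial>lebesgue) \<le> (\<integral>\<^sup>+y. ennreal (F y) \<partial>lebesgue)"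
        by (intro nn_integral_mono) (auto simp: indicator_def)
      also have "\<dots> \<le> ennreal (lam * vol p)" unfolding FI lam_def
        using A1 a0 by (intro ennreal_leI mult_right_mono) (auto simp: mult_le_cancel_right1)
      finally show ?thesis by (simp add: F_def vol_idx)
    qed
    obtain E where E: "E \<in> sets lebesgue"
      "ennreal lam * emeasure lebesgue E \<le> ennreal (weak_const s B * (\<integral>y. fin_norm J r (\<lambda>j. g j y) \<partial>lebesgue))"
      "AE x in lebesgue. x \<notin> E \<longrightarrow> fin_norm J r (\<lambda>j. T (g j) x) \<le> 2 * lam"
      "\<And>x l. x \<notin> E \<Longrightarrow> 0 < l \<Longrightarrow>
         (\<integral>\<^sup>+y. ennreal (fin_norm J r (\<lambda>j. g j y) * bump \<alpha> l (x - y)) \<partial>lebesgue) \<le> ennreal (tail_const * lam)"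
      by (rule weak_type[where f = g, OF r s B SB gL lam0 top]) (rule that)
    show thesis
    proof (rule that[OF E(1)])
      have W: "weak_const s B * 2 ^ (CARD('n) + 2) \<le> A" by (simp add: A_def loc_const_def)
      have "weak_const s B * (a * vol p) \<le> (A / 2 ^ (CARD('n) + 2)) * (a * vol p)"
        using W a0 by (intro mult_right_mono) (auto simp: field_simps)
      also have "\<dots> = lam * (vol p / 2 ^ (CARD('n) + 2))" by (simp add: lam_def)
      finally have "ennreal lam * emeasure lebesgue E \<le> ennreal (lam * (vol p / 2 ^ (CARD('n) + 2)))"
        using E(2) unfolding F_def[symmetric] Ia by (meson ennreal_leI order_trans)
      also have "\<dots> = ennreal lam * ennreal (vol p / 2 ^ (CARD('n) + 2))" using lam0 by (intro ennreal_mult) auto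
      finally show "emeasure lebesgue E \<le> ennreal (vol p / 2 ^ (CARD('n) + 2))"
        using lam0 by (simp add: ennreal_mult_le_mult_iff)
      show "AE x in lebesgue. x \<notin> E \<longrightarrow> fin_norm J r (\<lambda>j. T (cutoff (triple p) (f j)) x) \<le> 2 * loc_const s B * triple_avg J r f p"
        using E(3) by (simp add: g_def lam_def A_def a_def mult.assoc)
      show "(\<integral>\<^sup>+y. ennreal (fin_norm J r (\<lambda>j. cutoff (triple p) (f j) y) * bump \<alpha> l (x - y)) \<partial>lebesgue)
          \<le> ennreal (tail_const * loc_const s B * triple_avg J r f p)" if "x \<notin> E" "0 < l" for x l
        using E(4)[OF that] by (simp add: g_def lam_def A_def a_def mult_ac)
    qed
  qed
qed

lemma bump_ge_on_triple:
  assumes "x \<in> triple q" "y \<in> triple q"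
  shows "1 \<le> (1 + 3 * real CARD('n)) powr (real CARD('n) + \<alpha>) * vol q * bump \<alpha> (side q) (x - y)"
proof -
  let ?e = "real CARD('n) + \<alpha>"
  have e: "0 \<le> ?e" using alpha by simp
  have "side q + norm (x - y) \<le> (1 + 3 * real CARD('n)) * side q"
    using norm_triple[OF assms] by (simp add: algebra_simps)
  then have "(side q + norm (x - y)) powr ?e \<le> ((1 + 3 * real CARD('n)) * side q) powr ?e"
    using e add_pos_nonneg[OF side_pos norm_ge_zero, of q "x - y"] by (intro powr_mono2) auto
  also have "\<dots> = (1 + 3 * real CARD('n)) powr ?e * (vol q * side q powr \<alpha>)"
    using powr_realpow[OF side_pos[of q], of "CARD('n)"] by (simp add: powr_mult powr_add vol_def)
  finally have "(side q + norm (x - y)) powr ?e \<le> (1 + 3 * real CARD('n)) powr ?e * (vol q * side q powr \<alpha>)" .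
  moreover have "0 < (side q + norm (x - y)) powr ?e" using add_pos_nonneg[OF side_pos norm_ge_zero, of q "x - y"] by simp
  ultimately show ?thesis by (simp add: bump_def pos_le_divide_eq mult_ac)
qed

lemma T_off_triple_rep:
  assumes h: "h \<in> Linfc" and off: "\<And>y. y \<in> triple q \<Longrightarrow> h y = 0"
  shows "AE x in lebesgue. x \<in> cube q \<longrightarrow> T h x = (\<integral>y. K x y * h y \<partial>lebesgue)"
proof -
  define O' where "O' = box (\<chi> i. corner q $ i - side q) (\<chi> i. corner q $ i + 2 * side q)"
  have O: "O' \<subseteq> triple q" by (auto simp: O'_def triple_iff mem_box_cart less_imp_le)
  have cO: "cube q \<subseteq> O'"
  proof
    fix x assume "x \<in> cube q"
    then have c: "corner q $ i \<le> x $ i" "x $ i < corner q $ i + side q" for i by (simp_all add: cube_iff)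
    have "corner q $ i - side q < x $ i \<and> x $ i < corner q $ i + 2 * side q" for i
      using c[of i] side_pos[of q] by linarith
    then show "x \<in> O'" by (simp add: O'_def mem_box_cart)
  qed
  have "AE x in lebesgue. x \<notin> - O' \<longrightarrow> T h x = (\<integral>y. K x y * h y \<partial>lebesgue)"
  proof (rule T_rep[OF h])
    show "closed (- O')" by (simp add: O'_def closed_Compl open_box)
    show "h x = 0" if "x \<notin> - O'" for x using that O off by auto
  qed
  then show ?thesis by eventually_elim (use cO in auto)
qed

text \<open>A function that vanishes on the triple of \<open>q\<close> has an image that oscillates on \<open>q\<close> by at most the convolution of its
  norm with \<open>bump\<close>, evaluated at an arbitrary point of the cube.\<close>

lemma oscillation_off_triple:
  assumes r: "1 < r" and h: "\<And>j. h j \<in> Linfc" and off: "\<And>j y. y \<in> triple q \<Longrightarrow> h j y = 0"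
    and G: "G \<in> borel_measurable lebesgue" "\<And>y. fin_norm J r (\<lambda>j. h j y) \<le> G y"
    and x: "x \<in> cube q" "x' \<in> cube q" and c: "0 \<le> c"
    and le: "(\<integral>\<^sup>+y. ennreal (G y * bump \<alpha> (side q) (x' - y)) \<partial>lebesgue) \<le> ennreal c"
  shows "fin_norm J r (\<lambda>j. (\<integral>y. K x y * h j y \<partial>lebesgue) - (\<integral>y. K x' y * h j y \<partial>lebesgue)) \<le> ker_const * c"
proof -
  have G0: "0 \<le> G y" for y using G(2)[of y] fin_norm_nonneg order_trans by blast
  have iK: "integrable lebesgue (\<lambda>y. K u y * h j y)" if "u \<in> cube q" for u j
  proof (rule K_integrable[OF h side_pos[of q]])
    fix y assume "norm (u - y) < side q"
    then have "y \<in> triple q" using norm_off_triple[OF that, of y] by force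
    then show "h j y = 0" by (rule off)
  qed
  have bm: "(\<lambda>y. bump \<alpha> (side q) (x' - y)) \<in> borel_measurable lebesgue" by (intro measurable_completion) simp
  have Hm: "(\<lambda>y. G y * bump \<alpha> (side q) (x' - y)) \<in> borel_measurable lebesgue" using G(1) bm by measurable
  note H = integral_le_of_nn_integral[OF Hm _ le c]
  have H0: "0 \<le> G y * bump \<alpha> (side q) (x' - y)" for y using G0 by simp
  have "fin_norm J r (\<lambda>j. (\<integral>y. K x y * h j y \<partial>lebesgue) - (\<integral>y. K x' y * h j y \<partial>lebesgue))
      = fin_norm J r (\<lambda>j. \<integral>y. (K x y - K x' y) * h j y \<partial>lebesgue)"
    unfolding left_diff_distrib
    by (intro fin_norm_cong Bochner_Integration.integral_diff[symmetric] iK x)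
  also have "\<dots> \<le> (\<integral>y. ker_const * (G y * bump \<alpha> (side q) (x' - y)) \<partial>lebesgue)"
  proof (rule fin_norm_integral[OF r])
    show "integrable lebesgue (\<lambda>y. (K x y - K x' y) * h j y)" for j
      unfolding left_diff_distrib by (intro Bochner_Integration.integrable_diff iK x)
    show "integrable lebesgue (\<lambda>y. ker_const * (G y * bump \<alpha> (side q) (x' - y)))"
      by (intro integrable_mult_right H(1) H0)
    fix y
    show "cmod (K x y - K x' y) * fin_norm J r (\<lambda>j. h j y) \<le> ker_const * (G y * bump \<alpha> (side q) (x' - y))"
    proof (cases "y \<in> triple q")
      case True
      then have "fin_norm J r (\<lambda>j. h j y) = 0" using off by simp
      then show ?thesis using ker_const_nonneg H0[of y] by simp
    next
      case False
      have "cmod (K x y - K x' y) \<le> ker_const * bump \<alpha> (side q) (x' - y)"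
        by (intro K_first_var norm_cube x norm_off_triple False) simp
      then have "cmod (K x y - K x' y) * fin_norm J r (\<lambda>j. h j y) \<le> (ker_const * bump \<alpha> (side q) (x' - y)) * G y"
        using G(2) ker_const_nonneg by (intro mult_mono) auto
      then show ?thesis by (simp add: mult_ac)
    qed
  qed
  also have "\<dots> \<le> ker_const * c" using H H0 ker_const_nonneg by (simp add: mult_left_mono)
  finally show ?thesis .
qed

text \<open>Let \<open>E\<close> be the exceptional set of \<open>local_estimate\<close> for \<open>p\<close>, and stop at the cubes \<open>q\<close> in which \<open>E\<close> has
  density more than \<open>2\<^bsup>-n-1\<^esup>\<close>. Its density in them is at most \<open>1/2\<close>, while the exceptional set that belongs to
  \<open>q\<close> has density at most \<open>1/8\<close>, so \<open>q\<close> contains a point \<open>x'\<close> outside both. There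
  \<open>T\<close> is controlled on the restrictions of \<open>f\<close> to both triples, hence also on the difference
  \<open>h\<close> of these. The oscillation estimate carries the bound for \<open>T h\<close> from \<open>x'\<close> to all of \<open>q\<close>. The
  mean over the triple of \<open>q\<close> is controlled by the one for \<open>p\<close> through the convolution with \<open>bump\<close> at \<open>x'\<close>.\<close>

lemma sparse_step:
  assumes r: "1 < r" and s: "1 < s" and B: "0 \<le> B" and SB: "strong_type J r s B"
    and f: "\<And>j. f j \<in> Linfc"
  shows "\<exists>Q. (\<forall>q\<in>Q. fst p < fst q \<and> cube q \<subseteq> cube p) \<and> disjoint_family_on cube Q \<and>
    emeasure lebesgue (\<Union>(cube ` Q)) \<le> ennreal (vol p / 2) \<and>
    (AE x in lebesgue. x \<in> cube p \<longrightarrow> x \<notin> \<Union>(cube ` Q) \<longrightarrow>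
        fin_norm J r (\<lambda>j. T (cutoff (triple p) (f j)) x) \<le> step_const s B * triple_avg J r f p) \<and>
    (\<forall>q\<in>Q. AE x in lebesgue. x \<in> cube q \<longrightarrow>
        fin_norm J r (\<lambda>j. T (cutoff (triple p) (f j)) x) \<le> step_const s B * triple_avg J r f p + fin_norm J r (\<lambda>j. T (cutoff (triple q) (f j)) x))"
proof -
  have r0: "0 < r" using r by simp
  define A where "A = loc_const s B"
  have A1: "1 \<le> A" unfolding A_def by (rule loc_const_ge1)
  obtain E where E: "E \<in> sets lebesgue" "emeasure lebesgue E \<le> ennreal (vol p / 2 ^ (CARD('n) + 2))"
    "AE x in lebesgue. x \<notin> E \<longrightarrow> fin_norm J r (\<lambda>j. T (cutoff (triple p) (f j)) x) \<le> 2 * A * triple_avg J r f p"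
    "\<And>x l. x \<notin> E \<Longrightarrow> 0 < l \<Longrightarrow>
       (\<integral>\<^sup>+y. ennreal (fin_norm J r (\<lambda>j. cutoff (triple p) (f j) y) * bump \<alpha> l (x - y)) \<partial>lebesgue)
          \<le> ennreal (tail_const * A * triple_avg J r f p)"
    by (rule local_estimate[where f = f and p = p, OF r s B SB f]) (rule that[unfolded A_def])
  define H where "H = E \<inter> cube p"
  have Hm[measurable]: "H \<in> sets lebesgue" unfolding H_def using E(1) by auto
  have He: "emeasure lebesgue H \<le> ennreal (vol p / 2 ^ (CARD('n) + 2))"
    using E(1,2) emeasure_mono[of H E lebesgue] by (auto simp: H_def intro: order_trans)
  \<comment> \<open>Large enough for the cubes to occupy at most half of \<open>p\<close>, and after multiplication
    by \<open>2\<^sup>n\<close> still at most \<open>1/2\<close>.\<close>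
  define lam :: real where "lam = 1 / 2 ^ (CARD('n) + 1)"
  have "(1::real) \<le> 2 ^ CARD('n)" by simp
  then have "(1::real) < 2 ^ (CARD('n) + 1)" unfolding power_add power_one_right by linarith
  then have lam0: "0 < lam" and lam1: "lam < 1" by (simp_all add: lam_def)
  have ind: "(\<integral>\<^sup>+y\<in>X. indicator H y \<partial>lebesgue) = emeasure lebesgue (H \<inter> X)" if "X \<in> sets lebesgue" for X
  proof -
    have "(\<integral>\<^sup>+y\<in>X. indicator H y \<partial>lebesgue) = (\<integral>\<^sup>+y. indicator (H \<inter> X) y \<partial>lebesgue)"
      by (intro nn_integral_cong) (simp add: indicator_def)
    then show ?thesis using that Hm by simp
  qed
  have Im: "(indicator H :: real^'n \<Rightarrow> ennreal) \<in> borel_measurable lebesgue" by measurable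
  have top: "(\<integral>\<^sup>+y\<in>cube (idx (fst p) x). indicator H y \<partial>lebesgue) \<le> ennreal (lam * vol (idx (fst p) x))" for x
  proof -
    have "(\<integral>\<^sup>+y\<in>cube (idx (fst p) x). indicator H y \<partial>lebesgue) \<le> emeasure lebesgue H"
      unfolding ind[OF cube_measurable] by (intro emeasure_mono) auto
    also have "\<dots> \<le> ennreal (vol p / 2 ^ (CARD('n) + 2))" by (rule He)
    also have "\<dots> \<le> ennreal (lam * vol p)" by (intro ennreal_leI) (simp add: lam_def divide_simps)
    finally show ?thesis by (simp add: vol_idx)
  qed
  obtain Q where Q1: "\<And>q. q \<in> Q \<Longrightarrow> fst p < fst q"
    and Q2: "\<And>q. q \<in> Q \<Longrightarrow> ennreal (lam * vol q) < (\<integral>\<^sup>+y\<in>cube q. indicator H y \<partial>lebesgue)"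
    and Q3: "\<And>q. q \<in> Q \<Longrightarrow> (\<integral>\<^sup>+y\<in>cube q. indicator H y \<partial>lebesgue) \<le> ennreal (2 ^ CARD('n) * lam * vol q)"
    and Q4: "disjoint_family_on cube Q"
    and Q5: "AE x in lebesgue. x \<notin> \<Union>(cube ` Q) \<longrightarrow> (indicator H x :: ennreal) \<le> ennreal lam"
    by (rule calderon_zygmund_cubes[OF Im lam0 top]) (rule that)
  have cQ: "countable Q" by (rule countable_subset[OF subset_UNIV]) simp
  have sub: "cube q \<subseteq> cube p" if "q \<in> Q" for q
  proof -
    have "H \<inter> cube q \<noteq> {}" using Q2[OF that] unfolding ind[OF cube_measurable] by auto
    then obtain x where "x \<in> cube p" "x \<in> cube q" by (auto simp: H_def)
    then show ?thesis using Q1[OF that] by (intro cube_nested) auto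
  qed
  have meas: "emeasure lebesgue (\<Union>(cube ` Q)) \<le> ennreal (vol p / 2)"
  proof -
    have Um[measurable]: "\<Union>(cube ` Q) \<in> sets lebesgue" using cQ by (intro sets.countable_UN') auto
    have "ennreal lam * emeasure lebesgue (\<Union>(cube ` Q)) = (\<integral>\<^sup>+y\<in>\<Union>(cube ` Q). ennreal lam \<partial>lebesgue)"
      by (simp add: nn_integral_cmult_indicator)
    also have "\<dots> \<le> (\<integral>\<^sup>+y\<in>\<Union>(cube ` Q). indicator H y \<partial>lebesgue)"
    proof (rule nn_integral_disjoint_UN_mono[OF _ Im cQ _ Q4])
      fix q assume "q \<in> Q"
      from Q2[OF this] show "(\<integral>\<^sup>+y\<in>cube q. ennreal lam \<partial>lebesgue) \<le> (\<integral>\<^sup>+y\<in>cube q. indicator H y \<partial>lebesgue)"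
        using lam0 by (simp add: nn_integral_cmult_indicator emeasure_cube ennreal_mult)
    qed auto
    also have "\<dots> \<le> emeasure lebesgue H" unfolding ind[OF Um] by (rule emeasure_mono[OF Int_lower1 Hm])
    also have "\<dots> \<le> ennreal (vol p / 2 ^ (CARD('n) + 2))" by (rule He)
    also have "\<dots> = ennreal (lam * (vol p / 2))" by (simp add: lam_def)
    also have "\<dots> = ennreal lam * ennreal (vol p / 2)" using lam0 by (intro ennreal_mult) auto
    finally show ?thesis using lam0 by (simp add: ennreal_mult_le_mult_iff)
  qed
  have outside: "AE x in lebesgue. x \<in> cube p \<longrightarrow> x \<notin> \<Union>(cube ` Q) \<longrightarrow>
        fin_norm J r (\<lambda>j. T (cutoff (triple p) (f j)) x) \<le> step_const s B * triple_avg J r f p"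
    using E(3) Q5
  proof eventually_elim
    case (elim x)
    show ?case
    proof (intro impI)
      assume x: "x \<in> cube p" "x \<notin> \<Union>(cube ` Q)"
      have "x \<notin> H"
      proof
        assume "x \<in> H"
        then have "(1::ennreal) \<le> ennreal lam" using elim x by simp
        then have "ennreal 1 \<le> ennreal lam" by simp
        then show False using lam0 lam1 by (subst (asm) ennreal_le_iff) auto
      qed
      then have "fin_norm J r (\<lambda>j. T (cutoff (triple p) (f j)) x) \<le> 2 * A * triple_avg J r f p" using x elim by (simp add: H_def)
      also have "\<dots> \<le> step_const s B * triple_avg J r f p" unfolding A_def
        by (intro mult_right_mono step_const_ge triple_avg_nonneg)
      finally show "fin_norm J r (\<lambda>j. T (cutoff (triple p) (f j)) x) \<le> step_const s B * triple_avg J r f p" .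
    qed
  qed
  have inside: "AE x in lebesgue. x \<in> cube q \<longrightarrow>
        fin_norm J r (\<lambda>j. T (cutoff (triple p) (f j)) x) \<le> step_const s B * triple_avg J r f p + fin_norm J r (\<lambda>j. T (cutoff (triple q) (f j)) x)"
    if q: "q \<in> Q" for q
  proof -
    define fp fq h where "fp j = cutoff (triple p) (f j)" and "fq j = cutoff (triple q) (f j)" and "h j = cutoff (triple p - triple q) (f j)" for j
    have L: "fp j \<in> Linfc" "fq j \<in> Linfc" "h j \<in> Linfc" for j
      unfolding fp_def fq_def h_def by (auto intro!: Linfc_cutoff f)
    have triple_sub: "triple q \<subseteq> triple p" using triple_nested[of "corner q" p q] subsetD[OF sub[OF q] corner_mem] Q1[OF q] by simp
    have split: "fp j = (\<lambda>y. fq j y + h j y)" for j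
      using triple_sub by (auto simp: fp_def fq_def h_def cutoff_def fun_eq_iff)
    define N where "N u x = fin_norm J r (\<lambda>j. u j x)" for u and x :: "real^'n"
    define a where "a = triple_avg J r f p"
    have a0: "0 \<le> a" unfolding a_def by (rule triple_avg_nonneg)
    obtain E' where E': "E' \<in> sets lebesgue" "emeasure lebesgue E' \<le> ennreal (vol q / 2 ^ (CARD('n) + 2))"
      "AE x in lebesgue. x \<notin> E' \<longrightarrow> fin_norm J r (\<lambda>j. T (cutoff (triple q) (f j)) x) \<le> 2 * A * triple_avg J r f q"
      by (rule local_estimate[where f = f and p = q, OF r s B SB f]) (rule that[unfolded A_def])
    have add: "AE x in lebesgue. \<forall>j. T (fp j) x = T (fq j) x + T (h j) x"
      unfolding split by (intro AE_all_countable[THEN iffD2] allI T_add L)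
    have rep: "AE x in lebesgue. \<forall>j. x \<in> cube q \<longrightarrow> T (h j) x = (\<integral>y. K x y * h j y \<partial>lebesgue)"
      by (intro AE_all_countable[THEN iffD2] allI T_off_triple_rep L) (simp add: h_def cutoff_def)
    have all: "AE x in lebesgue. (x \<notin> E \<longrightarrow> N (\<lambda>j. T (fp j)) x \<le> 2 * A * a) \<and>
       (x \<notin> E' \<longrightarrow> N (\<lambda>j. T (fq j)) x \<le> 2 * A * triple_avg J r f q) \<and> (\<forall>j. T (fp j) x = T (fq j) x + T (h j) x) \<and>
       (\<forall>j. x \<in> cube q \<longrightarrow> T (h j) x = (\<integral>y. K x y * h j y \<partial>lebesgue))"
      using E(3) E'(3) add rep by eventually_elim (simp add: N_def fp_def fq_def a_def)
    have pos: "0 < emeasure lebesgue (cube q - E - E')"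
    proof (rule ccontr)
      assume "\<not> 0 < emeasure lebesgue (cube q - E - E')"
      then have z: "emeasure lebesgue (cube q - E - E') = 0" by simp
      have "ennreal (vol q) = emeasure lebesgue (cube q)" by (simp add: emeasure_cube)
      also have "\<dots> \<le> emeasure lebesgue ((H \<inter> cube q) \<union> (E' \<union> (cube q - E - E')))"
        using E(1) E'(1) sub[OF q] by (intro emeasure_mono) (auto simp: H_def)
      also have "\<dots> \<le> emeasure lebesgue (H \<inter> cube q) + emeasure lebesgue (E' \<union> (cube q - E - E'))"
        using E(1) E'(1) by (intro emeasure_subadditive) auto
      also have "\<dots> \<le> emeasure lebesgue (H \<inter> cube q) + (emeasure lebesgue E' + emeasure lebesgue (cube q - E - E'))"
        using E(1) E'(1) by (intro add_left_mono emeasure_subadditive) auto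
      also have "\<dots> \<le> ennreal (2 ^ CARD('n) * lam * vol q) + (ennreal (vol q / 2 ^ (CARD('n) + 2)) + 0)"
        using Q3[OF q] E'(2) z unfolding ind[OF cube_measurable] by (intro add_mono) auto
      also have "\<dots> = ennreal (vol q / 2 + vol q / 2 ^ (CARD('n) + 2))"
        by (simp add: lam_def ennreal_plus[symmetric] del: ennreal_plus)
      also have "\<dots> \<le> ennreal (vol q / 2 + vol q / 4)"
      proof (intro ennreal_leI add_left_mono divide_left_mono)
        have "(1::real) \<le> 2 ^ CARD('n)" by simp
        then show "(4::real) \<le> 2 ^ (CARD('n) + 2)" by simp
      qed auto
      finally have "vol q \<le> vol q / 2 + vol q / 4" by (subst (asm) ennreal_le_iff) auto
      then show False using vol_pos[of q] by simp
    qed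
    have "\<exists>x\<in>cube q - E - E'. (x \<notin> E \<longrightarrow> N (\<lambda>j. T (fp j)) x \<le> 2 * A * a) \<and>
       (x \<notin> E' \<longrightarrow> N (\<lambda>j. T (fq j)) x \<le> 2 * A * triple_avg J r f q) \<and> (\<forall>j. T (fp j) x = T (fq j) x + T (h j) x) \<and>
       (\<forall>j. x \<in> cube q \<longrightarrow> T (h j) x = (\<integral>y. K x y * h j y \<partial>lebesgue))"
      using E(1) E'(1) by (intro AE_pos_measure_ex[OF all _ pos]) auto
    then obtain x' where x': "x' \<in> cube q" "x' \<notin> E" "N (\<lambda>j. T (fp j)) x' \<le> 2 * A * a"
       "N (\<lambda>j. T (fq j)) x' \<le> 2 * A * triple_avg J r f q" "\<And>j. T (fp j) x' = T (fq j) x' + T (h j) x'"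
       "\<And>j. T (h j) x' = (\<integral>y. K x' y * h j y \<partial>lebesgue)" by blast
    define \<beta> where "\<beta> = tail_const * A * a"
    have \<beta>0: "0 \<le> \<beta>" using tail_const_pos A1 a0 by (simp add: \<beta>_def)
    have bmp: "(\<integral>\<^sup>+y. ennreal (N fp y * bump \<alpha> (side q) (x' - y)) \<partial>lebesgue) \<le> ennreal \<beta>"
      using E(4)[OF x'(2) side_pos[of q]] by (simp add: N_def fp_def \<beta>_def a_def)
    have Npm: "N fp \<in> borel_measurable lebesgue" unfolding N_def[abs_def] by (rule fin_norm_Linfc(1)[of fp, OF L(1) r0])
    define c4 where "c4 = (1 + 3 * real CARD('n)) powr (real CARD('n) + \<alpha>)"
    have aq: "triple_avg J r f q \<le> c4 * \<beta>"
    proof -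
      have bm: "(\<lambda>y. bump \<alpha> (side q) (x' - y)) \<in> borel_measurable lebesgue" by (intro measurable_completion) simp
      have Hm: "(\<lambda>y. N fp y * bump \<alpha> (side q) (x' - y)) \<in> borel_measurable lebesgue" using Npm bm by measurable
      have H0: "0 \<le> N fp y * bump \<alpha> (side q) (x' - y)" for y by (simp add: N_def)
      note HH = integral_le_of_nn_integral[OF Hm H0 bmp \<beta>0]
      have "triple_avg J r f q * vol q = (\<integral>y. N fq y \<partial>lebesgue)" unfolding N_def fq_def by (rule triple_avg_eq[symmetric])
      also have "\<dots> \<le> (\<integral>y. c4 * vol q * (N fp y * bump \<alpha> (side q) (x' - y)) \<partial>lebesgue)"
      proof (rule integral_mono)
        show "integrable lebesgue (N fq)" unfolding N_def[abs_def] by (rule fin_norm_integrable[of fq, OF L(2) r0])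
        show "integrable lebesgue (\<lambda>y. c4 * vol q * (N fp y * bump \<alpha> (side q) (x' - y)))" by (intro integrable_mult_right HH)
        fix y
        show "N fq y \<le> c4 * vol q * (N fp y * bump \<alpha> (side q) (x' - y))"
        proof (cases "y \<in> triple q")
          case True
          have "1 \<le> c4 * vol q * bump \<alpha> (side q) (x' - y)" unfolding c4_def
            using x'(1) cube_subset_triple[of q] True by (intro bump_ge_on_triple) auto
          then have "N fp y * 1 \<le> N fp y * (c4 * vol q * bump \<alpha> (side q) (x' - y))"
            by (intro mult_left_mono) (simp_all add: N_def)
          moreover have "N fq y = N fp y" using True triple_sub by (simp add: N_def fq_def fp_def fin_norm_cutoff subsetD)
          ultimately show ?thesis by (simp add: mult_ac)
        next
          case False
          then have "N fq y = 0" by (simp add: N_def fq_def fin_norm_cutoff)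
          moreover have "0 \<le> c4 * vol q" by (simp add: c4_def)
          ultimately show ?thesis using H0[of y] by (simp only: mult_nonneg_nonneg)
        qed
      qed
      also have "\<dots> = c4 * vol q * (\<integral>y. N fp y * bump \<alpha> (side q) (x' - y) \<partial>lebesgue)" by simp
      also have "\<dots> \<le> c4 * vol q * \<beta>" using HH(2) by (intro mult_left_mono) (auto simp: c4_def)
      finally have "triple_avg J r f q * vol q \<le> (c4 * \<beta>) * vol q" by (simp add: mult_ac)
      then show ?thesis by (simp only: mult_le_cancel_right_pos vol_pos)
    qed
    have Th': "N (\<lambda>j. T (h j)) x' \<le> 2 * A * a + 2 * A * (c4 * \<beta>)"
    proof -
      have "N (\<lambda>j. T (h j)) x' = fin_norm J r (\<lambda>j. T (fp j) x' - T (fq j) x')" unfolding N_def using x'(5) by simp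
      also have "\<dots> \<le> N (\<lambda>j. T (fp j)) x' + N (\<lambda>j. T (fq j)) x'" unfolding N_def by (rule fin_norm_diff_le[OF r])
      also have "\<dots> \<le> 2 * A * a + 2 * A * triple_avg J r f q" using x'(3,4) by simp
      also have "\<dots> \<le> 2 * A * a + 2 * A * (c4 * \<beta>)" using aq A1 by (intro add_left_mono mult_left_mono) auto
      finally show ?thesis .
    qed
    show ?thesis using add rep
    proof eventually_elim
      case (elim x)
      show ?case
      proof
        assume x: "x \<in> cube q"
        have osc: "fin_norm J r (\<lambda>j. T (h j) x - T (h j) x') \<le> ker_const * \<beta>"
        proof -
          have "fin_norm J r (\<lambda>j. T (h j) x - T (h j) x') = fin_norm J r (\<lambda>j. (\<integral>y. K x y * h j y \<partial>lebesgue) - (\<integral>y. K x' y * h j y \<partial>lebesgue))"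
            using elim x x'(6) by simp
          also have "\<dots> \<le> ker_const * \<beta>"
          proof (rule oscillation_off_triple[OF r L(3) _ Npm _ x x'(1) \<beta>0 bmp])
            show "h j y = 0" if "y \<in> triple q" for j y using that by (simp add: h_def cutoff_def)
            show "fin_norm J r (\<lambda>j. h j y) \<le> N fp y" for y unfolding N_def h_def fp_def fin_norm_cutoff by simp
          qed
          finally show ?thesis .
        qed
        have "N (\<lambda>j. T (h j)) x \<le> fin_norm J r (\<lambda>j. T (h j) x - T (h j) x') + N (\<lambda>j. T (h j)) x'"
          using fin_norm_triangle[OF r, of J "\<lambda>j. T (h j) x - T (h j) x'" "\<lambda>j. T (h j) x'"] by (simp add: N_def)
        then have "N (\<lambda>j. T (h j)) x \<le> ker_const * \<beta> + (2 * A * a + 2 * A * (c4 * \<beta>))" using osc Th' by linarith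
        also have "\<dots> = step_const s B * a"
          by (simp add: step_const_def \<beta>_def A_def c4_def algebra_simps)
        finally have "N (\<lambda>j. T (h j)) x \<le> step_const s B * a" .
        moreover have "N (\<lambda>j. T (fp j)) x \<le> N (\<lambda>j. T (fq j)) x + N (\<lambda>j. T (h j)) x"
          unfolding N_def using elim fin_norm_triangle[OF r, of J "\<lambda>j. T (fq j) x" "\<lambda>j. T (h j) x"] by simp
        ultimately show "fin_norm J r (\<lambda>j. T (cutoff (triple p) (f j)) x) \<le> step_const s B * triple_avg J r f p + fin_norm J r (\<lambda>j. T (cutoff (triple q) (f j)) x)"
          by (simp add: N_def fp_def fq_def a_def)
      qed
    qed
  qed
  show ?thesis
    by (intro exI[of _ Q] conjI ballI Q1 sub Q4 meas outside inside)
qed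

end

context dyadic_grid begin

text \<open>Every generation of descendants occupies at most half of the measure of the previous one, so almost every
  point lies in descendants of finitely many generations only, and in at most one of each. The part of a
  cube outside its children avoids all later generations.\<close>

lemma sparse_family:
  assumes ch: "\<And>p q. q \<in> ch p \<Longrightarrow> fst p < fst q \<and> cube q \<subseteq> cube p"
    and dis: "\<And>p. disjoint_family_on cube (ch p)"
    and small: "\<And>p. emeasure lebesgue (\<Union>(cube ` ch p)) \<le> ennreal (vol p / 2)"
  obtains S where "p0 \<in> S" "\<And>p q. p \<in> S \<Longrightarrow> q \<in> ch p \<Longrightarrow> q \<in> S" "\<And>p. p \<in> S \<Longrightarrow> cube p \<subseteq> cube p0"
    "disjoint_family_on (\<lambda>p. cube p - \<Union>(cube ` ch p)) S" "AE x in lebesgue. finite {p\<in>S. x \<in> cube p}"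
proof -
  define gen where "gen = rec_nat {p0} (\<lambda>_ X. \<Union>(ch ` X))"
  have g0: "gen 0 = {p0}" and gS: "gen (Suc i) = \<Union>(ch ` gen i)" for i by (simp_all add: gen_def)
  define S where "S = (\<Union>i. gen i)"
  define U where "U i = \<Union>(cube ` gen i)" for i
  have cnt: "countable X" for X :: "'n gidx set" by (rule countable_subset[OF subset_UNIV]) simp
  have Um[measurable]: "U i \<in> sets lebesgue" for i unfolding U_def using cnt by (intro sets.countable_UN') auto
  have W: "\<Union>(cube ` ch p) \<in> sets lebesgue" for p using cnt by (intro sets.countable_UN') auto
  have gd: "disjoint_family_on cube (gen i)" for i
  proof (induction i)
    case 0
    then show ?case by (simp add: g0 disjoint_family_on_def)
  next
    case (Suc i)
    show ?case unfolding disjoint_family_on_def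
    proof (intro ballI impI)
      fix q1 q2 assume q: "q1 \<in> gen (Suc i)" "q2 \<in> gen (Suc i)" "q1 \<noteq> q2"
      then obtain p1 p2 where p: "p1 \<in> gen i" "q1 \<in> ch p1" "p2 \<in> gen i" "q2 \<in> ch p2" by (auto simp only: gS)
      show "cube q1 \<inter> cube q2 = {}"
      proof (cases "p1 = p2")
        case True
        then show ?thesis using dis[of p1] p q(3) unfolding disjoint_family_on_def by blast
      next
        case False
        then have "cube p1 \<inter> cube p2 = {}" using Suc p unfolding disjoint_family_on_def by blast
        then show ?thesis using ch[OF p(2)] ch[OF p(4)] by blast
      qed
    qed
  qed
  have USuc: "U (Suc i) = (\<Union>p\<in>gen i. \<Union>(cube ` ch p))" for i by (auto simp: U_def gS)
  have Umono: "U (Suc i) \<subseteq> U i" for i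
    unfolding USuc using ch by (fastforce simp: U_def)
  have Uanti: "i \<le> j \<Longrightarrow> U j \<subseteq> U i" for i j
    using lift_Suc_antimono_le[of U, OF Umono] by blast
  have Ue: "emeasure lebesgue (U i) \<le> ennreal (vol p0 / 2 ^ i)" for i
  proof (induction i)
    case 0
    then show ?case by (simp add: U_def g0 emeasure_cube)
  next
    case (Suc i)
    have "emeasure lebesgue (U (Suc i)) \<le> (\<integral>\<^sup>+p. emeasure lebesgue (\<Union>(cube ` ch p)) \<partial>count_space (gen i))"
      unfolding USuc by (intro emeasure_UN_le_count cnt W)
    also have "\<dots> \<le> (\<integral>\<^sup>+p. ennreal (1/2) * emeasure lebesgue (cube p) \<partial>count_space (gen i))"
    proof (rule nn_integral_mono)
      fix p
      have "ennreal (vol p / 2) = ennreal (1/2) * emeasure lebesgue (cube p)"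
        by (simp add: emeasure_cube ennreal_mult[symmetric] del: ennreal_half)
      then show "emeasure lebesgue (\<Union>(cube ` ch p)) \<le> ennreal (1/2) * emeasure lebesgue (cube p)" using small[of p] by simp
    qed
    also have "\<dots> = ennreal (1/2) * (\<integral>\<^sup>+p. emeasure lebesgue (cube p) \<partial>count_space (gen i))" by (intro nn_integral_cmult) simp
    also have "(\<integral>\<^sup>+p. emeasure lebesgue (cube p) \<partial>count_space (gen i)) = emeasure lebesgue (U i)"
      unfolding U_def using cnt gd by (intro emeasure_UN_countable[symmetric]) auto
    also have "ennreal (1/2) * emeasure lebesgue (U i) \<le> ennreal (1/2) * ennreal (vol p0 / 2 ^ i)" by (intro mult_left_mono Suc) simp
    also have "\<dots> = ennreal (1/2 * (vol p0 / 2 ^ i))" by (rule ennreal_mult[symmetric]) auto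
    also have "1/2 * (vol p0 / 2 ^ i) = vol p0 / 2 ^ Suc i" by simp
    finally show ?case .
  qed
  define N where "N = (\<Inter>i. U i)"
  have Nm: "N \<in> sets lebesgue" unfolding N_def by (intro sets.countable_INT) auto
  have "emeasure lebesgue N = 0"
  proof (rule ccontr)
    assume ne: "emeasure lebesgue N \<noteq> 0"
    have le: "emeasure lebesgue N \<le> ennreal (vol p0 / 2 ^ i)" for i
    proof -
      have "N \<subseteq> U i" by (auto simp: N_def)
      then show ?thesis using emeasure_mono[OF _ Um] Ue[of i] order_trans by blast
    qed
    have lim: "(\<lambda>i. ennreal (vol p0 / 2 ^ i)) \<longlonglongrightarrow> ennreal 0"
    proof (rule tendsto_ennrealI)
      have "(\<lambda>i. vol p0 * (1/2) ^ i) \<longlonglongrightarrow> vol p0 * 0" by (intro tendsto_intros LIMSEQ_power_zero) simp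
      then show "(\<lambda>i. vol p0 / 2 ^ i) \<longlonglongrightarrow> 0" by (simp add: power_one_over)
    qed
    have "emeasure lebesgue N \<le> ennreal 0"
      by (rule LIMSEQ_le_const[OF lim]) (use le in blast)
    then show False using ne by simp
  qed
  then have "N \<in> null_sets lebesgue" using Nm by auto
  then have AEN: "AE x in lebesgue. x \<notin> N" by (rule AE_not_in)
  show thesis
  proof (rule that[of S])
    show "p0 \<in> S" using g0 by (auto simp: S_def)
    show "q \<in> S" if pS: "p \<in> S" and qp: "q \<in> ch p" for p q
    proof -
      obtain i where "p \<in> gen i" using pS by (auto simp: S_def)
      then have "q \<in> gen (Suc i)" using qp gS by auto
      then show ?thesis by (auto simp: S_def simp del: gS)
    qed
    show "cube p \<subseteq> cube p0" if pS: "p \<in> S" for p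
    proof -
      obtain i where "p \<in> gen i" using pS by (auto simp: S_def)
      then have "cube p \<subseteq> U i" by (auto simp: U_def)
      also have "U i \<subseteq> U 0" by (rule Uanti) simp
      finally show ?thesis by (simp add: U_def g0)
    qed
    show "disjoint_family_on (\<lambda>p. cube p - \<Union>(cube ` ch p)) S" unfolding disjoint_family_on_def
    proof (intro ballI impI)
      have key: "p = q" if "p \<in> gen i" "q \<in> gen j" "i \<le> j" "x \<in> cube p" "x \<notin> \<Union>(cube ` ch p)" "x \<in> cube q" for p q i j x
      proof (cases "i = j")
        case True
        then show ?thesis using gd[of i] that unfolding disjoint_family_on_def by blast
      next
        case False
        then have "x \<in> U (Suc i)" using Uanti[of "Suc i" j] that by (auto simp: U_def)
        then obtain p' where p': "p' \<in> gen i" "x \<in> \<Union>(cube ` ch p')" unfolding USuc by blast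
        then have "x \<in> cube p'" using ch by blast
        then have "p' = p" using gd[of i] that p' unfolding disjoint_family_on_def by blast
        then show ?thesis using p' that by simp
      qed
      fix p q assume pq: "p \<in> S" "q \<in> S" "p \<noteq> q"
      obtain i j where ij: "p \<in> gen i" "q \<in> gen j" using pq(1,2) unfolding S_def by blast
      show "(cube p - \<Union>(cube ` ch p)) \<inter> (cube q - \<Union>(cube ` ch q)) = {}"
      proof (rule ccontr)
        assume "(cube p - \<Union>(cube ` ch p)) \<inter> (cube q - \<Union>(cube ` ch q)) \<noteq> {}"
        then obtain x where x: "x \<in> cube p" "x \<notin> \<Union>(cube ` ch p)" "x \<in> cube q" "x \<notin> \<Union>(cube ` ch q)" by blast
        have "p = q"
        proof (cases "i \<le> j")
          case True
          show ?thesis by (rule key[OF ij True x(1,2,3)])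
        next
          case False
          then have "j \<le> i" by simp
          from key[OF ij(2,1) this x(3,4,1)] show ?thesis by simp
        qed
        then show False using pq(3) by simp
      qed
    qed
    show "AE x in lebesgue. finite {p\<in>S. x \<in> cube p}"
      using AEN
    proof eventually_elim
      case (elim x)
      then obtain i where i: "x \<notin> U i" by (auto simp: N_def)
      have "{p\<in>S. x \<in> cube p} \<subseteq> (\<Union>j<i. {p\<in>gen j. x \<in> cube p})"
      proof
        fix p assume "p \<in> {p\<in>S. x \<in> cube p}"
        then obtain j where j: "p \<in> gen j" "x \<in> cube p" unfolding S_def by blast
        then have "x \<in> U j" unfolding U_def by blast
        then have "j < i" using Uanti[of i j] i by (meson not_le subsetD)
        then show "p \<in> (\<Union>j<i. {p\<in>gen j. x \<in> cube p})" using j by blast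
      qed
      moreover have "finite {p\<in>gen j. x \<in> cube p}" for j
      proof (cases "{p\<in>gen j. x \<in> cube p} = {}")
        case False
        then obtain p where p: "p \<in> gen j" "x \<in> cube p" by blast
        then have "{p\<in>gen j. x \<in> cube p} \<subseteq> {p}" using gd[of j] unfolding disjoint_family_on_def by blast
        then show ?thesis by (rule finite_subset) simp
      next
        case True
        then show ?thesis by (simp only: finite.emptyI)
      qed
      ultimately show ?case by (meson finite_UN finite_lessThan finite_subset)
    qed
  qed
qed

end

context cz_grid begin

text \<open>For almost every \<open>x\<close> the cubes of the family that contain \<open>x\<close> form a finite chain. Each passage to a child
  costs one mean, and the last cube of the chain is one on which \<open>x\<close> lies outside the children.\<close>

theorem sparse_domination:
  assumes r: "1 < r" and s: "1 < s" and B: "0 \<le> B" and SB: "strong_type J r s B"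
    and f: "\<And>j. f j \<in> Linfc"
  obtains S E where "\<And>p. p \<in> S \<Longrightarrow> cube p \<subseteq> cube p0"
    "\<And>p. p \<in> S \<Longrightarrow> E p \<in> sets lebesgue" "\<And>p. p \<in> S \<Longrightarrow> E p \<subseteq> cube p"
    "\<And>p. p \<in> S \<Longrightarrow> vol p \<le> 2 * measure lebesgue (E p)" "disjoint_family_on E S"
    "AE x in lebesgue. x \<in> cube p0 \<longrightarrow> finite {p\<in>S. x \<in> cube p} \<and>
        fin_norm J r (\<lambda>j. T (cutoff (triple p0) (f j)) x) \<le> (\<Sum>p\<in>{p\<in>S. x \<in> cube p}. step_const s B * triple_avg J r f p)"
proof -
  define C where "C = step_const s B"
  define H where "H p x = fin_norm J r (\<lambda>j. T (cutoff (triple p) (f j)) x)" for p x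
  define a where "a = triple_avg J r f"
  have C0: "0 \<le> C" unfolding C_def by (rule step_const_ge)
  have a0: "0 \<le> C * a p" for p using C0 triple_avg_nonneg[of J r f p] by (simp add: a_def)
  have "\<forall>p. \<exists>Q. (\<forall>q\<in>Q. fst p < fst q \<and> cube q \<subseteq> cube p) \<and> disjoint_family_on cube Q \<and>
    emeasure lebesgue (\<Union>(cube ` Q)) \<le> ennreal (vol p / 2) \<and>
    (AE x in lebesgue. x \<in> cube p \<longrightarrow> x \<notin> \<Union>(cube ` Q) \<longrightarrow> H p x \<le> C * a p) \<and>
    (\<forall>q\<in>Q. AE x in lebesgue. x \<in> cube q \<longrightarrow> H p x \<le> C * a p + H q x)"
    unfolding H_def C_def a_def using sparse_step[where f = f, OF r s B SB f] by blast
  then obtain ch where ch': "\<forall>p. (\<forall>q\<in>ch p. fst p < fst q \<and> cube q \<subseteq> cube p) \<and> disjoint_family_on cube (ch p) \<and>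
    emeasure lebesgue (\<Union>(cube ` ch p)) \<le> ennreal (vol p / 2) \<and>
    (AE x in lebesgue. x \<in> cube p \<longrightarrow> x \<notin> \<Union>(cube ` ch p) \<longrightarrow> H p x \<le> C * a p) \<and>
    (\<forall>q\<in>ch p. AE x in lebesgue. x \<in> cube q \<longrightarrow> H p x \<le> C * a p + H q x)"
    by (rule choice[THEN exE])
  have ch: "\<And>p q. q \<in> ch p \<Longrightarrow> fst p < fst q \<and> cube q \<subseteq> cube p" "\<And>p. disjoint_family_on cube (ch p)"
    "\<And>p. emeasure lebesgue (\<Union>(cube ` ch p)) \<le> ennreal (vol p / 2)"
    "\<And>p. AE x in lebesgue. x \<in> cube p \<longrightarrow> x \<notin> \<Union>(cube ` ch p) \<longrightarrow> H p x \<le> C * a p"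
    "\<And>p q. q \<in> ch p \<Longrightarrow> AE x in lebesgue. x \<in> cube q \<longrightarrow> H p x \<le> C * a p + H q x"
    using ch' by blast+
  obtain S where S: "p0 \<in> S" "\<And>p q. p \<in> S \<Longrightarrow> q \<in> ch p \<Longrightarrow> q \<in> S" "\<And>p. p \<in> S \<Longrightarrow> cube p \<subseteq> cube p0"
    "disjoint_family_on (\<lambda>p. cube p - \<Union>(cube ` ch p)) S" "AE x in lebesgue. finite {p\<in>S. x \<in> cube p}"
    by (rule sparse_family[of ch p0, OF ch(1,2,3)]) (assumption | rule that)+
  have cnt: "countable X" for X :: "'n gidx set" by (rule countable_subset[OF subset_UNIV]) simp
  have W: "\<Union>(cube ` ch p) \<in> sets lebesgue" for p using cnt by (intro sets.countable_UN') auto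
  show thesis
  proof (rule that[of S "\<lambda>p. cube p - \<Union>(cube ` ch p)"])
    fix p assume "p \<in> S"
    show "vol p \<le> 2 * measure lebesgue (cube p - \<Union>(cube ` ch p))"
    proof -
      have fin: "emeasure lebesgue (cube p - \<Union>(cube ` ch p)) < \<infinity>"
        using emeasure_mono[of "cube p - \<Union>(cube ` ch p)" "cube p" lebesgue]
        by (simp add: emeasure_cube le_less_trans[OF _ ennreal_less_top])
      have "ennreal (vol p) = emeasure lebesgue (cube p)" by (simp add: emeasure_cube)
      also have "\<dots> \<le> emeasure lebesgue ((cube p - \<Union>(cube ` ch p)) \<union> \<Union>(cube ` ch p))"
        using W by (intro emeasure_mono) auto
      also have "\<dots> \<le> emeasure lebesgue (cube p - \<Union>(cube ` ch p)) + emeasure lebesgue (\<Union>(cube ` ch p))"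
        using W by (intro emeasure_subadditive) auto
      also have "\<dots> \<le> ennreal (measure lebesgue (cube p - \<Union>(cube ` ch p))) + ennreal (vol p / 2)"
        using ch(3)[of p] fin by (intro add_mono) (simp_all add: emeasure_eq_ennreal_measure less_top)
      also have "\<dots> = ennreal (measure lebesgue (cube p - \<Union>(cube ` ch p)) + vol p / 2)"
        by (rule ennreal_plus[symmetric]) auto
      finally have "vol p \<le> measure lebesgue (cube p - \<Union>(cube ` ch p)) + vol p / 2"
        by (subst (asm) ennreal_le_iff) auto
      then show ?thesis by simp
    qed
  next
    have A1: "AE x in lebesgue. \<forall>p. x \<in> cube p \<longrightarrow> x \<notin> \<Union>(cube ` ch p) \<longrightarrow> H p x \<le> C * a p"
      by (intro AE_all_countable[THEN iffD2] allI ch(4))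
    have A2: "AE x in lebesgue. \<forall>p q. q \<in> ch p \<longrightarrow> x \<in> cube q \<longrightarrow> H p x \<le> C * a p + H q x"
    proof (intro AE_all_countable[THEN iffD2] allI)
      fix p q
      show "AE x in lebesgue. q \<in> ch p \<longrightarrow> x \<in> cube q \<longrightarrow> H p x \<le> C * a p + H q x"
        using ch(5)[of q p] by (cases "q \<in> ch p") auto
    qed
    have "AE x in lebesgue. x \<in> cube p0 \<longrightarrow> finite {p\<in>S. x \<in> cube p} \<and> H p0 x \<le> (\<Sum>p\<in>{p\<in>S. x \<in> cube p}. C * a p)"
      using A1 A2 S(5)
    proof eventually_elim
      case (elim x)
      let ?D = "\<lambda>p. {q\<in>S. x \<in> cube q \<and> fst p \<le> fst q}"
      have fin: "finite (?D p)" for p by (rule finite_subset[OF _ elim(3)]) auto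
      have "p \<in> S \<Longrightarrow> x \<in> cube p \<Longrightarrow> H p x \<le> (\<Sum>q\<in>?D p. C * a q)" for p
      \<comment> \<open>The induction runs upwards along the chain, from its smallest cube.\<close>
      proof (induction "card (?D p)" arbitrary: p rule: less_induct)
        case less
        have pD: "p \<in> ?D p" using less by simp
        have one: "C * a p \<le> (\<Sum>q\<in>?D p. C * a q)" by (rule member_le_sum[OF pD a0 fin])
        show ?case
        proof (cases "x \<in> \<Union>(cube ` ch p)")
          case False
          then have "H p x \<le> C * a p" using elim(1) less.prems(2) by blast
          then show ?thesis using one by linarith
        next
          case True
          then obtain q where q: "q \<in> ch p" "x \<in> cube q" by blast
          have lt: "fst p < fst q" using ch(1)[OF q(1)] by simp
          have sub: "?D q \<subseteq> ?D p - {p}" using lt by auto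
          have "card (?D q) < card (?D p)"
            using sub pD by (intro psubset_card_mono fin) blast
          then have "H q x \<le> (\<Sum>q\<in>?D q. C * a q)" using S(2)[OF less.prems(1) q(1)] q(2) by (rule less.hyps)
          also have "\<dots> \<le> (\<Sum>q\<in>?D p - {p}. C * a q)" by (rule sum_mono2[OF _ sub a0]) (use fin in simp)
          also have "\<dots> = (\<Sum>q\<in>?D p. C * a q) - C * a p" using sum.remove[OF fin pD, of "\<lambda>q. C * a q"] by linarith
          finally have "H q x \<le> (\<Sum>q\<in>?D p. C * a q) - C * a p" .
          moreover have "H p x \<le> C * a p + H q x" using elim(2) q by blast
          ultimately show ?thesis by linarith
        qed
      qed
      note * = this
      show ?case
      proof
        assume x: "x \<in> cube p0"
        have "H p0 x \<le> (\<Sum>q\<in>?D p0. C * a q)" by (rule *[OF S(1) x])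
        also have "\<dots> \<le> (\<Sum>p\<in>{p\<in>S. x \<in> cube p}. C * a p)" by (rule sum_mono2[OF elim(3) _ a0]) auto
        finally show "finite {p\<in>S. x \<in> cube p} \<and> H p0 x \<le> (\<Sum>p\<in>{p\<in>S. x \<in> cube p}. C * a p)" using elim(3) by simp
      qed
    qed
    then show "AE x in lebesgue. x \<in> cube p0 \<longrightarrow> finite {p\<in>S. x \<in> cube p} \<and>
        fin_norm J r (\<lambda>j. T (cutoff (triple p0) (f j)) x) \<le> (\<Sum>p\<in>{p\<in>S. x \<in> cube p}. step_const s B * triple_avg J r f p)"
      by (simp only: H_def C_def a_def)
  qed (use S W in auto)
qed

end

lemma nn_integral_count_space_le_finite:
  fixes h :: "'i \<Rightarrow> ennreal"
  assumes S: "countable S" and le: "\<And>S'. finite S' \<Longrightarrow> S' \<subseteq> S \<Longrightarrow> (\<Sum>p\<in>S'. h p) \<le> M"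
  shows "(\<integral>\<^sup>+p. h p \<partial>count_space S) \<le> M"
proof (cases "finite S")
  case True
  then show ?thesis using le[of S] by (simp add: nn_integral_count_space_finite)
next
  case False
  let ?e = "from_nat_into S"
  have bij: "bij_betw ?e UNIV S" by (rule bij_betw_from_nat_into[OF S False])
  have "(\<integral>\<^sup>+p. h p \<partial>count_space S) = (\<integral>\<^sup>+n. h (?e n) \<partial>count_space UNIV)"
    by (rule nn_integral_bij_count_space[OF bij, symmetric])
  also have "\<dots> = (\<Sum>n. h (?e n))" by (rule nn_integral_count_space_nat)
  also have "\<dots> = (SUP n. \<Sum>i<n. h (?e i))" by (rule suminf_eq_SUP)
  also have "\<dots> \<le> M"
  proof (rule SUP_least)
    fix n
    have inj: "inj_on ?e {..<n}" using bij by (auto simp: bij_betw_def inj_on_def)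
    have "(\<Sum>i<n. h (?e i)) = (\<Sum>p\<in>?e ` {..<n}. h p)" by (rule sum.reindex_cong[OF inj refl refl, symmetric])
    also have "\<dots> \<le> M" using bij by (intro le) (auto simp: bij_betw_def)
    finally show "(\<Sum>i<n. h (?e i)) \<le> M" .
  qed
  finally show ?thesis .
qed

section \<open>Weighted bounds\<close>

definition form_const :: "nat \<Rightarrow> real \<Rightarrow> real \<Rightarrow> real" where
  "form_const n p q = 2 ^ n * (16 ^ n * (bilin_const p q * (2 * 16 ^ n) powr (max p q - 1)))"

lemma form_const_nonneg: "0 \<le> form_const n p q"
  by (simp add: form_const_def bilin_const_nonneg)

text \<open>The Muckenhoupt condition in terms of real integrals, for weights that are positive everywhere. Every weight in the class agrees
  almost everywhere with one of these.\<close>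

definition Ap_bound :: "real \<Rightarrow> (real^'n::finite \<Rightarrow> real) \<Rightarrow> real \<Rightarrow> bool" where
  "Ap_bound p w \<Lambda> \<longleftrightarrow> w \<in> borel_measurable lebesgue \<and> (\<forall>x. 0 < w x) \<and> 0 \<le> \<Lambda> \<and>
     (\<forall>Q\<in>cubes. set_integrable lebesgue Q w \<and> set_integrable lebesgue Q (\<lambda>x. w x powr (- 1 / (p - 1))) \<and>
        (LINT x:Q|lebesgue. w x) * (LINT x:Q|lebesgue. w x powr (- 1 / (p - 1))) powr (p - 1)
          \<le> \<Lambda> * measure lebesgue Q powr p)"

lemma LINT_subset_mono:
  fixes h :: "'a \<Rightarrow> real"
  assumes "\<And>x. 0 \<le> h x" "set_integrable M B h" "A \<in> sets M" "A \<subseteq> B"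
  shows "(LINT x:A|M. h x) \<le> (LINT x:B|M. h x)"
proof -
  have "set_integrable M A h" using assms by (auto intro: set_integrable_subset)
  then show ?thesis unfolding set_lebesgue_integral_def using assms unfolding set_integrable_def
    by (intro integral_mono) (auto simp: indicator_def)
qed

context dyadic_grid begin

lemma Ap_bound_cube:
  assumes "Ap_bound p w \<Lambda>" "1 < p"
  shows "set_integrable lebesgue (cube q) w" "set_integrable lebesgue (cube q) (\<lambda>x. w x powr (- 1 / (p - 1)))"
    "(LINT x:cube q|lebesgue. w x) * (LINT x:cube q|lebesgue. w x powr (- 1 / (p - 1))) powr (p - 1)
       \<le> \<Lambda> * measure lebesgue (cube q) powr p"
proof -
  let ?Q = "cbox (corner q) (\<chi> i. corner q $ i + side q)"
  let ?\<sigma> = "\<lambda>x. w x powr (- 1 / (p - 1))"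
  have Q: "?Q \<in> cubes" unfolding cubes_def using side_pos[of q] by blast
  have mQ: "measure lebesgue ?Q = vol q"
    using emeasure_cube_side(1)[of "side q" "corner q"] by (simp add: measure_def vol_def)
  note A = assms(1)[unfolded Ap_bound_def]
  have w0: "0 \<le> w x" for x using A by (simp add: less_imp_le)
  have iw: "set_integrable lebesgue ?Q w" and isg: "set_integrable lebesgue ?Q ?\<sigma>" using A Q by blast+
  show "set_integrable lebesgue (cube q) w" "set_integrable lebesgue (cube q) ?\<sigma>"
    using iw isg box_cube_cbox(2)[of q] by (auto intro: set_integrable_subset)
  have "(LINT x:cube q|lebesgue. w x) * (LINT x:cube q|lebesgue. ?\<sigma> x) powr (p - 1)
      \<le> (LINT x:?Q|lebesgue. w x) * (LINT x:?Q|lebesgue. ?\<sigma> x) powr (p - 1)"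
    using w0 assms(2)
    by (intro mult_mono powr_mono2 LINT_subset_mono iw isg box_cube_cbox(2) cube_measurable LINT_nonneg) auto
  also have "\<dots> \<le> \<Lambda> * vol q powr p" using A Q mQ by metis
  finally show "(LINT x:cube q|lebesgue. w x) * (LINT x:cube q|lebesgue. ?\<sigma> x) powr (p - 1)
       \<le> \<Lambda> * measure lebesgue (cube q) powr p" by simp
qed

text \<open>The family is split into \<open>2\<^sup>n\<close> parts according to the shifted grid whose cube contains the
  triple. In each part the enlarged cubes are nested, and the sets \<open>E i\<close> still witness
  sparseness, with a constant that is larger by the factor \<open>16\<^sup>n\<close>.\<close>

lemma sparse_form_bound:
  fixes F g w :: "real^'n \<Rightarrow> real"
  assumes p: "1 < p" and pq: "1/p + 1/q = 1" and Ap: "Ap_bound p w \<Lambda>" and fin: "finite S"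
    and E: "\<And>i. i \<in> S \<Longrightarrow> E i \<in> sets lebesgue" "\<And>i. i \<in> S \<Longrightarrow> E i \<subseteq> cube i"
      "\<And>i. i \<in> S \<Longrightarrow> vol i \<le> 2 * measure lebesgue (E i)" "disjoint_family_on E S"
    and F: "F \<in> borel_measurable lebesgue" "\<And>x. 0 \<le> F x" "integrable lebesgue F" "integrable lebesgue (\<lambda>x. w x * F x powr p)"
    and g: "g \<in> borel_measurable lebesgue" "\<And>x. 0 \<le> g x" "integrable lebesgue (\<lambda>x. w x * g x)" "integrable lebesgue (\<lambda>x. w x * g x powr q)"
  shows "(\<Sum>i\<in>S. (LINT y:triple i|lebesgue. F y) / vol i * (LINT x:cube i|lebesgue. w x * g x))
    \<le> form_const CARD('n) p q * \<Lambda> powr (max 1 (1 / (p - 1))) *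
       ((\<integral>x. w x * F x powr p \<partial>lebesgue) powr (1/p) * (\<integral>x. w x * g x powr q \<partial>lebesgue) powr (1/q))"
proof -
  note A = Ap[unfolded Ap_bound_def]
  have w: "w \<in> borel_measurable lebesgue" "\<And>x. 0 < w x" and L0: "0 \<le> \<Lambda>" using A by blast+
  define s where "s x = w x powr (- 1 / (p - 1))" for x
  define f where "f x = F x * w x powr (1 / (p - 1))" for x
  have s: "s \<in> borel_measurable lebesgue" "\<And>x. 0 < s x"
    unfolding s_def[abs_def] using w(1) by (measurable, simp add: w(2) less_imp_neq[THEN not_sym])
  have f: "f \<in> borel_measurable lebesgue" "\<And>x. 0 \<le> f x" unfolding f_def[abs_def] using w(1) F(1,2) by auto
  have sf: "s x * f x = F x" for x
    using w(2)[of x] by (simp add: s_def f_def flip: powr_add)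
  have sfp: "s x * f x powr p = w x * F x powr p" for x
  proof -
    have "s x * f x powr p = F x powr p * (w x powr (- 1 / (p - 1)) * w x powr (p / (p - 1)))"
      by (simp add: s_def f_def powr_mult powr_powr)
    also have "w x powr (- 1 / (p - 1)) * w x powr (p / (p - 1)) = w x powr 1"
    proof -
      have "(p - 1) / (p - 1) = p / (p - 1) - 1 / (p - 1)" by (rule diff_divide_distrib)
      moreover have "(p - 1) / (p - 1) = 1" using p by simp
      moreover have "- 1 / (p - 1) = - (1 / (p - 1))" by (rule minus_divide_left[symmetric])
      ultimately have "- 1 / (p - 1) + p / (p - 1) = 1" by linarith
      then show ?thesis by (simp only: powr_add[symmetric])
    qed
    finally show ?thesis using p w(2)[of x] by (simp add: mult.commute)
  qed
  have ws: "w x * s x powr (p - 1) = 1" for x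
  proof -
    have "- 1 / (p - 1) * (p - 1) = - 1" using p by simp
    then have "s x powr (p - 1) = w x powr (- 1)" by (simp only: s_def powr_powr)
    then show ?thesis using w(2)[of x] by simp
  qed
  have "\<forall>i. \<exists>t m. triple i \<subseteq> dyadic_grid.cube (16 * L) (third_shift t) (fst i, m)"
    using one_third_trick[OF L_pos] by metis
  then obtain \<tau> \<mu> where R: "\<And>i. triple i \<subseteq> dyadic_grid.cube (16 * L) (third_shift (\<tau> i)) (fst i, \<mu> i)" by metis
  let ?X = "(\<integral>x. w x * F x powr p \<partial>lebesgue) powr (1/p) * (\<integral>x. w x * g x powr q \<partial>lebesgue) powr (1/q)"
  let ?term = "\<lambda>i. (LINT y:triple i|lebesgue. F y) / vol i * (LINT x:cube i|lebesgue. w x * g x)"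
  define c where "c = bilin_const p q * (2 * 16 ^ CARD('n)) powr (max p q - 1)"
  have part: "(\<Sum>i\<in>{i\<in>S. \<tau> i = t}. ?term i) \<le> 16 ^ CARD('n) * (c * \<Lambda> powr (max 1 (1 / (p - 1))) * ?X)" for t
  proof -
    interpret B: dyadic_grid "16 * L" "third_shift t" using L_pos by unfold_locales auto
    let ?S = "{i\<in>S. \<tau> i = t}"
    define Q where "Q i = B.cube (fst i, \<mu> i)" for i
    have Bvol: "B.vol (fst i, \<mu> i) = 16 ^ CARD('n) * vol i" for i
      by (simp add: B.vol_def vol_def B.side_def side_def flip: power_mult_distrib)
    have TQ: "triple i \<subseteq> Q i" if "i \<in> ?S" for i using R[of i] that by (simp add: Q_def)
    have CQ: "cube i \<subseteq> Q i" if "i \<in> ?S" for i using TQ[OF that] cube_subset_triple by blast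
    have tle: "?term i \<le> 16 ^ CARD('n) * ((LINT x:Q i|lebesgue. s x * f x) * (LINT x:Q i|lebesgue. w x * g x) / measure lebesgue (Q i))"
      if i: "i \<in> ?S" for i
    proof -
      have 1: "(LINT y:triple i|lebesgue. F y) \<le> (LINT x:Q i|lebesgue. s x * f x)"
        unfolding sf using F TQ[OF i] by (intro LINT_subset_mono) (auto simp: set_integrable_def Q_def intro!: integrable_mult_indicator[of _ _ F, simplified])
      have 2: "(LINT x:cube i|lebesgue. w x * g x) \<le> (LINT x:Q i|lebesgue. w x * g x)"
        using g w(2) CQ[OF i] by (intro LINT_subset_mono) (auto simp: set_integrable_def Q_def less_imp_le intro!: integrable_mult_indicator[of _ _ "\<lambda>x. w x * g x", simplified])
      have "?term i = (LINT y:triple i|lebesgue. F y) * (LINT x:cube i|lebesgue. w x * g x) / vol i" by simp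
      also have "\<dots> \<le> (LINT x:Q i|lebesgue. s x * f x) * (LINT x:Q i|lebesgue. w x * g x) / vol i"
        using F(2) g(2) w(2) by (intro divide_right_mono mult_mono 1 2 LINT_nonneg) (auto simp: less_imp_le sf)
      also have "\<dots> = 16 ^ CARD('n) * ((LINT x:Q i|lebesgue. s x * f x) * (LINT x:Q i|lebesgue. w x * g x) / measure lebesgue (Q i))"
        by (simp add: Q_def Bvol)
      finally show ?thesis .
    qed
    have "(\<Sum>i\<in>?S. ?term i) \<le> (\<Sum>i\<in>?S. 16 ^ CARD('n) * ((LINT x:Q i|lebesgue. s x * f x) * (LINT x:Q i|lebesgue. w x * g x) / measure lebesgue (Q i)))"
      by (rule sum_mono) (rule tle)
    also have "\<dots> = 16 ^ CARD('n) * (\<Sum>i\<in>?S. (LINT x:Q i|lebesgue. s x * f x) * (LINT x:Q i|lebesgue. w x * g x) / measure lebesgue (Q i))"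
      by (simp add: sum_distrib_left)
    also have "\<dots> \<le> 16 ^ CARD('n) * (bilin_const p q * (2 * 16 ^ CARD('n)) powr (max p q - 1) * \<Lambda> powr (max 1 (1 / (p - 1))) *
       ((\<integral>x. s x * f x powr p \<partial>lebesgue) powr (1/p) * (\<integral>x. w x * g x powr q \<partial>lebesgue) powr (1/q)))"
    proof (rule mult_left_mono[OF sparse_bilinear[OF p pq]])
      show "finite ?S" using fin by simp
      show "laminar_on ?S Q" using B.cube_laminar[of UNIV] unfolding laminar_on_def Q_def by blast
      show "disjoint_family_on E ?S" using E(4) by (rule disjoint_family_on_mono[rotated]) auto
      fix i assume i: "i \<in> ?S"
      show "Q i \<in> sets lebesgue" "0 < measure lebesgue (Q i)" by (simp_all add: Q_def)
      show "E i \<in> sets lebesgue" using E i by simp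
      show "E i \<subseteq> Q i" using E(2)[of i] CQ[OF i] i by blast
      have "16 ^ CARD('n) * vol i \<le> 16 ^ CARD('n) * (2 * measure lebesgue (E i))" using E(3)[of i] i by (intro mult_left_mono) auto
      then show "measure lebesgue (Q i) \<le> 2 * 16 ^ CARD('n) * measure lebesgue (E i)" by (simp add: Q_def Bvol)
      show "set_integrable lebesgue (Q i) w" unfolding Q_def by (rule B.Ap_bound_cube[OF Ap p])
      show "set_integrable lebesgue (Q i) s" unfolding Q_def s_def[abs_def] by (rule B.Ap_bound_cube[OF Ap p])
      show "(LINT x:Q i|lebesgue. w x) * (LINT x:Q i|lebesgue. s x) powr (p - 1) \<le> \<Lambda> * measure lebesgue (Q i) powr p"
        unfolding Q_def s_def by (rule B.Ap_bound_cube[OF Ap p])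
    qed (use w s f g F L0 ws in \<open>simp_all add: sf sfp\<close>)
    finally show ?thesis by (simp only: sfp c_def)
  qed
  have "(\<Sum>i\<in>S. ?term i) = (\<Sum>t\<in>UNIV. \<Sum>i\<in>{i\<in>S. \<tau> i = t}. ?term i)"
    by (rule sum.group[OF fin, symmetric]) auto
  also have "\<dots> \<le> (\<Sum>t\<in>(UNIV :: ('n \<Rightarrow> bool) set). 16 ^ CARD('n) * (c * \<Lambda> powr (max 1 (1 / (p - 1))) * ?X))"
    by (rule sum_mono) (rule part)
  also have "\<dots> = form_const CARD('n) p q * \<Lambda> powr (max 1 (1 / (p - 1))) * ?X"
    by (simp add: form_const_def c_def card_fun)
  finally show ?thesis .
qed

end

context cz_grid begin

text \<open>Duality with an explicit test function. If \<open>H = N(T f)\<close>, the sparse form is tested with \<open>G\<^bsup>p-1\<^esup>\<close> for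
  a truncation \<open>G\<close> of \<open>H\<close>, which gives an inequality \<open>X \<le> C Y\<^bsup>1/p\<^esup> X\<^bsup>1/q\<^esup>\<close> for the integral \<open>X\<close> of \<open>G\<^sup>p w\<close>.
  The truncation makes \<open>X\<close> finite, so that it can be cancelled.\<close>

lemma weighted_cube_bound:
  assumes r: "1 < r" and s: "1 < s" and B: "0 \<le> B" and SB: "strong_type J r s B"
    and f: "\<And>j. f j \<in> Linfc" and supp: "\<And>j. cutoff (triple p0) (f j) = f j"
    and p: "1 < p" and pq: "1/p + 1/q = 1" and Ap: "Ap_bound p w \<Lambda>"
  shows "(\<integral>\<^sup>+x\<in>cube p0. ennreal (w x * fin_norm J r (\<lambda>j. T (f j) x) powr p) \<partial>lebesgue)
    \<le> ennreal ((step_const s B * form_const CARD('n) p q * \<Lambda> powr (max 1 (1 / (p - 1)))) powr p) *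
       (\<integral>\<^sup>+x. ennreal (w x * fin_norm J r (\<lambda>j. f j x) powr p) \<partial>lebesgue)"
proof -
  note ce = conj_exponent[OF p pq]
  have r0: "0 < r" using r by simp
  have w: "w \<in> borel_measurable lebesgue" "\<And>x. 0 < w x" and L0: "0 \<le> \<Lambda>" using Ap[unfolded Ap_bound_def] by blast+
  note wm[measurable] = w(1)
  have w0: "0 \<le> w x" for x using w(2) by (simp add: less_imp_le)
  define F where "F y = fin_norm J r (\<lambda>j. f j y)" for y
  have F0: "0 \<le> F y" for y by (simp add: F_def)
  have Fm[measurable]: "F \<in> borel_measurable lebesgue" unfolding F_def[abs_def] by (rule fin_norm_Linfc(1)[of f, OF f r0])
  have Fi: "integrable lebesgue F" unfolding F_def[abs_def] by (rule fin_norm_integrable[of f, OF f r0])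
  obtain M where M: "\<And>y. F y \<le> M" unfolding F_def using fin_norm_Linfc(2)[of f, OF f r0] by blast
  have Foff: "F y = 0" if "y \<notin> triple p0" for y
  proof -
    have "F y = fin_norm J r (\<lambda>j. cutoff (triple p0) (f j) y)" unfolding F_def supp ..
    then show ?thesis using that by (simp add: fin_norm_cutoff)
  qed
  have w_triple: "set_integrable lebesgue (triple p0) w"
  proof -
    obtain t m where tm: "triple p0 \<subseteq> dyadic_grid.cube (16 * L) (third_shift t) (fst p0, m)"
      by (rule one_third_trick[OF L_pos])
    interpret D: dyadic_grid "16 * L" "third_shift t" using L_pos by unfold_locales auto
    show ?thesis by (rule set_integrable_subset[OF D.Ap_bound_cube(1)[OF Ap p] triple_measurable tm])
  qed
  have FI: "integrable lebesgue (\<lambda>x. w x * F x powr p)"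
  proof (rule Bochner_Integration.integrable_bound)
    show "integrable lebesgue (\<lambda>x. M powr p * (indicator (triple p0) x *\<^sub>R w x))"
      using w_triple unfolding set_integrable_def by (rule integrable_mult_right)
    show "AE x in lebesgue. norm (w x * F x powr p) \<le> norm (M powr p * (indicator (triple p0) x *\<^sub>R w x))"
    proof (intro AE_I2)
      fix x
      show "norm (w x * F x powr p) \<le> norm (M powr p * (indicator (triple p0) x *\<^sub>R w x))"
      proof (cases "x \<in> triple p0")
        case True
        have "F x powr p \<le> M powr p" using M F0 p by (intro powr_mono2) auto
        then have "w x * F x powr p \<le> w x * M powr p" by (intro mult_left_mono w0)
        then show ?thesis using True w0[of x] by (simp add: abs_mult mult.commute)
      qed (simp add: Foff)
    qed
  qed measurable
  define H where "H x = fin_norm J r (\<lambda>j. T (f j) x)" for x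
  have H0: "0 \<le> H x" for x by (simp add: H_def)
  have Hm[measurable]: "H \<in> borel_measurable lebesgue" unfolding H_def[abs_def] by (rule fin_norm_T_meas[OF f])
  define C1 where "C1 = step_const s B"
  have C10: "0 \<le> C1" unfolding C1_def by (rule step_const_ge)
  define Kc where "Kc = C1 * form_const CARD('n) p q * \<Lambda> powr (max 1 (1 / (p - 1)))"
  have fc0: "0 \<le> form_const CARD('n) p q" by (rule form_const_nonneg)
  have Kc0: "0 \<le> Kc" unfolding Kc_def using C10 fc0 by simp
  define NF where "NF = (\<integral>x. w x * F x powr p \<partial>lebesgue)"
  have NF0: "0 \<le> NF" unfolding NF_def using w0 by (intro Bochner_Integration.integral_nonneg) simp
  obtain S E where S: "\<And>i. i \<in> S \<Longrightarrow> cube i \<subseteq> cube p0" "\<And>i. i \<in> S \<Longrightarrow> E i \<in> sets lebesgue" "\<And>i. i \<in> S \<Longrightarrow> E i \<subseteq> cube i"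
    "\<And>i. i \<in> S \<Longrightarrow> vol i \<le> 2 * measure lebesgue (E i)" "disjoint_family_on E S"
    "AE x in lebesgue. x \<in> cube p0 \<longrightarrow> finite {i\<in>S. x \<in> cube i} \<and>
        fin_norm J r (\<lambda>j. T (cutoff (triple p0) (f j)) x) \<le> (\<Sum>i\<in>{i\<in>S. x \<in> cube i}. C1 * triple_avg J r f i)"
    unfolding C1_def
    by (rule sparse_domination[where f = f, OF r s B SB f, of p0]) (assumption | rule that[unfolded C1_def])+
  have cS: "countable S" by (rule countable_subset[OF subset_UNIV]) simp
  define a where "a i = C1 * triple_avg J r f i" for i
  have a0: "0 \<le> a i" for i using C10 triple_avg_nonneg[of J r f i] by (simp add: a_def)
  have trunc: "(\<integral>\<^sup>+x\<in>cube p0. ennreal (w x * min (H x) (real n) powr p) \<partial>lebesgue) \<le> ennreal (Kc powr p * NF)" for n :: nat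
  proof -
    define G where "G x = min (H x) (real n)" for x
    have G0: "0 \<le> G x" and GH: "G x \<le> H x" and Gn: "G x \<le> real n" for x using H0 by (auto simp: G_def)
    have Gm[measurable]: "G \<in> borel_measurable lebesgue" unfolding G_def[abs_def] by measurable
    define g where "g x = indicator (cube p0) x * G x powr (p - 1)" for x
    have g0: "0 \<le> g x" for x by (simp add: g_def)
    have gm[measurable]: "g \<in> borel_measurable lebesgue" unfolding g_def[abs_def] by measurable
    have wcube: "set_integrable lebesgue (cube p0) w" by (rule Ap_bound_cube[OF Ap p])
    have gw: "integrable lebesgue (\<lambda>x. w x * (indicator (cube p0) x * G x powr e))" if "0 \<le> e" for e
    proof (rule Bochner_Integration.integrable_bound)
      show "integrable lebesgue (\<lambda>x. real n powr e * (indicator (cube p0) x *\<^sub>R w x))"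
        using wcube unfolding set_integrable_def by (rule integrable_mult_right)
      show "AE x in lebesgue. norm (w x * (indicator (cube p0) x * G x powr e)) \<le> norm (real n powr e * (indicator (cube p0) x *\<^sub>R w x))"
      proof (intro AE_I2)
        fix x
        have "G x powr e \<le> real n powr e" using G0 Gn that by (intro powr_mono2) auto
        then have "w x * G x powr e \<le> w x * real n powr e" by (intro mult_left_mono w0)
        then show "norm (w x * (indicator (cube p0) x * G x powr e)) \<le> norm (real n powr e * (indicator (cube p0) x *\<^sub>R w x))"
          using w0[of x] by (auto simp: abs_mult mult.commute indicator_def)
      qed
    qed measurable
    have gq: "g x powr q = indicator (cube p0) x * G x powr p" for x
      using ce by (simp add: g_def powr_mult powr_powr mult.commute indicator_def)
    have giw: "integrable lebesgue (\<lambda>x. w x * g x)" using gw[of "p - 1"] p by (simp add: g_def)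
    have giq: "integrable lebesgue (\<lambda>x. w x * g x powr q)" using gw[of p] p by (simp add: gq)
    define X where "X = (\<integral>x. w x * g x powr q \<partial>lebesgue)"
    have X0: "0 \<le> X" unfolding X_def using w0 by (intro Bochner_Integration.integral_nonneg) simp
    have Xe: "(\<integral>\<^sup>+x\<in>cube p0. ennreal (w x * G x powr p) \<partial>lebesgue) = ennreal X"
    proof -
      have "(\<integral>\<^sup>+x\<in>cube p0. ennreal (w x * G x powr p) \<partial>lebesgue) = (\<integral>\<^sup>+x. ennreal (w x * g x powr q) \<partial>lebesgue)"
        unfolding gq by (intro nn_integral_cong) (simp add: indicator_def)
      also have "\<dots> = ennreal X" unfolding X_def using w0 by (intro nn_integral_eq_integral[OF giq]) simp
      finally show ?thesis .
    qed
    have pt: "AE x in lebesgue. ennreal (w x * G x powr p) * indicator (cube p0) x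
        \<le> (\<integral>\<^sup>+i. ennreal (a i) * (ennreal (w x * g x) * indicator (cube i) x) \<partial>count_space S)"
      using S(6)
    proof eventually_elim
      case (elim x)
      show ?case
      proof (cases "x \<in> cube p0")
        case True
        let ?D = "{i\<in>S. x \<in> cube i}"
        have D: "finite ?D" "H x \<le> (\<Sum>i\<in>?D. a i)" using elim True unfolding supp H_def a_def by auto
        have "w x * G x powr p = G x * (w x * g x)"
          using True G0[of x] powr_mult_base[of "G x" "p - 1"] by (simp add: g_def mult_ac)
        also have "\<dots> \<le> (\<Sum>i\<in>?D. a i) * (w x * g x)"
          using GH[of x] D(2) w0 g0 by (intro mult_right_mono) auto
        finally have "ennreal (w x * G x powr p) \<le> ennreal (\<Sum>i\<in>?D. a i * (w x * g x))"
          by (intro ennreal_leI) (simp add: sum_distrib_right)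
        also have "\<dots> = (\<Sum>i\<in>?D. ennreal (a i * (w x * g x)))"
          using a0 w0 g0 by (intro sum_ennreal[symmetric]) simp
        also have "\<dots> = (\<Sum>i\<in>?D. ennreal (a i) * (ennreal (w x * g x) * indicator (cube i) x))"
          using a0 w0 g0 by (intro sum.cong refl) (simp add: ennreal_mult)
        also have "\<dots> = (\<integral>\<^sup>+i. ennreal (a i) * (ennreal (w x * g x) * indicator (cube i) x) \<partial>count_space S)"
          using D(1) by (intro nn_integral_count_space'[symmetric]) auto
        finally show ?thesis using True by simp
      qed simp
    qed
    have "ennreal X \<le> (\<integral>\<^sup>+x. (\<integral>\<^sup>+i. ennreal (a i) * (ennreal (w x * g x) * indicator (cube i) x) \<partial>count_space S) \<partial>lebesgue)"
      unfolding Xe[symmetric] by (rule nn_integral_mono_AE[OF pt])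
    also have "\<dots> = (\<integral>\<^sup>+i. (\<integral>\<^sup>+x. ennreal (a i) * (ennreal (w x * g x) * indicator (cube i) x) \<partial>lebesgue) \<partial>count_space S)"
      by (intro nn_integral_count_space_nn_integral cS) measurable
    also have "\<dots> = (\<integral>\<^sup>+i. ennreal (a i * (LINT x:cube i|lebesgue. w x * g x)) \<partial>count_space S)"
    proof (rule nn_integral_cong)
      fix i
      have nn: "0 \<le> w x * g x" for x using w0 g0 by simp
      have "(\<integral>\<^sup>+x. ennreal (a i) * (ennreal (w x * g x) * indicator (cube i) x) \<partial>lebesgue) = ennreal (a i) * (\<integral>\<^sup>+x\<in>cube i. ennreal (w x * g x) \<partial>lebesgue)"
        by (intro nn_integral_cmult) measurable
      also have "\<dots> = ennreal (a i * (LINT x:cube i|lebesgue. w x * g x))"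
        unfolding set_nn_integral_eq_LINT[OF giw nn cube_measurable]
        using a0 LINT_nonneg[of "\<lambda>x. w x * g x", OF nn] by (simp add: ennreal_mult)
      finally show "(\<integral>\<^sup>+x. ennreal (a i) * (ennreal (w x * g x) * indicator (cube i) x) \<partial>lebesgue) = ennreal (a i * (LINT x:cube i|lebesgue. w x * g x))" .
    qed
    also have "\<dots> \<le> ennreal (Kc * (NF powr (1/p) * X powr (1/q)))"
    proof (rule nn_integral_count_space_le_finite[OF cS])
      fix S' assume S': "finite S'" "S' \<subseteq> S"
      have nn: "0 \<le> w x * g x" for x using w0 g0 by simp
      have "(\<Sum>i\<in>S'. ennreal (a i * (LINT x:cube i|lebesgue. w x * g x))) = ennreal (\<Sum>i\<in>S'. a i * (LINT x:cube i|lebesgue. w x * g x))"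
        using a0 LINT_nonneg[of "\<lambda>x. w x * g x", OF nn] by (intro sum_ennreal) simp
      also have "(\<Sum>i\<in>S'. a i * (LINT x:cube i|lebesgue. w x * g x)) = C1 * (\<Sum>i\<in>S'. (LINT y:triple i|lebesgue. F y) / vol i * (LINT x:cube i|lebesgue. w x * g x))"
        by (simp add: a_def triple_avg_def F_def sum_distrib_left mult.assoc)
      also have "ennreal \<dots> \<le> ennreal (C1 * (form_const CARD('n) p q * \<Lambda> powr (max 1 (1 / (p - 1))) * (NF powr (1/p) * X powr (1/q))))"
        unfolding NF_def X_def
      proof (intro ennreal_leI mult_left_mono[OF _ C10] sparse_form_bound[OF p pq Ap S'(1), where E = E])
        show "disjoint_family_on E S'" using S(5) S'(2) by (rule disjoint_family_on_mono[rotated])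
        fix i assume "i \<in> S'"
        then have i: "i \<in> S" using S'(2) by (rule subsetD[rotated])
        show "E i \<in> sets lebesgue" "E i \<subseteq> cube i" "vol i \<le> 2 * measure lebesgue (E i)"
          by (rule S(2)[OF i], rule S(3)[OF i], rule S(4)[OF i])
      qed (rule Fm F0 Fi FI gm g0 giw giq)+
      finally show "(\<Sum>i\<in>S'. ennreal (a i * (LINT x:cube i|lebesgue. w x * g x))) \<le> ennreal (Kc * (NF powr (1/p) * X powr (1/q)))"
        by (simp add: Kc_def mult.assoc)
    qed
    finally have le: "X \<le> Kc * NF powr (1/p) * X powr (1/q)"
      using Kc0 by (subst (asm) ennreal_le_iff) (auto simp: mult.assoc)
    have "X \<le> Kc powr p * NF"
    proof (cases "X = 0")
      case True
      then show ?thesis using Kc0 NF0 by simp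
    next
      case False
      then have Xp: "0 < X" using X0 by simp
      have "X powr (1/p) * X powr (1/q) = X" using pq Xp by (simp flip: powr_add)
      then have "X powr (1/p) * X powr (1/q) \<le> (Kc * NF powr (1/p)) * X powr (1/q)" using le by simp
      then have "X powr (1/p) \<le> Kc * NF powr (1/p)" using Xp by (simp only: mult_le_cancel_right_pos powr_gt_zero)
      then have "(X powr (1/p)) powr p \<le> (Kc * NF powr (1/p)) powr p" using p by (intro powr_mono2) auto
      then show ?thesis using p X0 NF0 by (simp add: powr_mult powr_powr)
    qed
    then show ?thesis using Xe by (simp add: G_def ennreal_leI)
  qed
  have "(\<integral>\<^sup>+x\<in>cube p0. ennreal (w x * H x powr p) \<partial>lebesgue)
      \<le> (\<integral>\<^sup>+x. (SUP n. ennreal (w x * min (H x) (real n) powr p) * indicator (cube p0) x) \<partial>lebesgue)"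
  proof (rule nn_integral_mono)
    fix x
    obtain n where n: "H x \<le> real n" using real_arch_simple by blast
    then have "ennreal (w x * H x powr p) * indicator (cube p0) x = ennreal (w x * min (H x) (real n) powr p) * indicator (cube p0) x"
      by (simp add: min_absorb1)
    also have "\<dots> \<le> (SUP n. ennreal (w x * min (H x) (real n) powr p) * indicator (cube p0) x)" by (rule SUP_upper) simp
    finally show "ennreal (w x * H x powr p) * indicator (cube p0) x \<le> (SUP n. ennreal (w x * min (H x) (real n) powr p) * indicator (cube p0) x)" .
  qed
  also have "\<dots> = (SUP n. (\<integral>\<^sup>+x. ennreal (w x * min (H x) (real n) powr p) * indicator (cube p0) x \<partial>lebesgue))"
  proof (rule nn_integral_monotone_convergence_SUP)
    show "incseq (\<lambda>n x. ennreal (w x * min (H x) (real n) powr p) * indicator (cube p0) x)"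
    proof (intro incseq_SucI le_funI mult_right_mono ennreal_leI mult_left_mono w0 powr_mono2)
      show "0 \<le> min (H x) (real n)" for n x using H0 by simp
    qed (use p in auto)
  qed measurable
  also have "\<dots> \<le> ennreal (Kc powr p * NF)" by (rule SUP_least) (rule trunc)
  also have "\<dots> = ennreal (Kc powr p) * (\<integral>\<^sup>+x. ennreal (w x * F x powr p) \<partial>lebesgue)"
    unfolding NF_def using w0 NF0 by (subst nn_integral_eq_integral[OF FI]) (auto simp: ennreal_mult NF_def)
  finally show ?thesis by (simp add: H_def F_def Kc_def C1_def)
qed

end

context cz_operator begin

definition weighted_const :: "real \<Rightarrow> real \<Rightarrow> real \<Rightarrow> real \<Rightarrow> real" where
  "weighted_const s B p q = step_const s B * form_const CARD('n) p q"

lemma weighted_const_nonneg: "0 \<le> weighted_const s B p q"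
  unfolding weighted_const_def using step_const_ge form_const_nonneg by simp

text \<open>Let the grid be centred at the origin and its scale tend to infinity; the constant does not depend on the
  scale.\<close>

theorem weighted_bound:
  assumes r: "1 < r" and s: "1 < s" and B: "0 \<le> B" and SB: "strong_type J r s B"
    and f: "\<And>j. f j \<in> Linfc"
    and p: "1 < p" and pq: "1/p + 1/q = 1" and Ap: "Ap_bound p w \<Lambda>"
  shows "(\<integral>\<^sup>+x. ennreal (w x * fin_norm J r (\<lambda>j. T (f j) x) powr p) \<partial>lebesgue)
    \<le> ennreal ((weighted_const s B p q * \<Lambda> powr (max 1 (1 / (p - 1)))) powr p) *
       (\<integral>\<^sup>+x. ennreal (w x * fin_norm J r (\<lambda>j. f j x) powr p) \<partial>lebesgue)"
proof -
  \<comment> \<open>With finitely many nonzero components all supports lie in one ball.\<close>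
  define f' where "f' j = (if j < J then f j else (\<lambda>x. 0))" for j
  have f'L: "f' j \<in> Linfc" for j by (simp add: f'_def f Linfc_zero)
  have eq: "fin_norm J r (\<lambda>j. T (f' j) x) = fin_norm J r (\<lambda>j. T (f j) x)" "fin_norm J r (\<lambda>j. f' j x) = fin_norm J r (\<lambda>j. f j x)" for x
    by (auto simp: f'_def intro!: fin_norm_cong)
  have "bounded (\<Union>j<J. {x. f j x \<noteq> 0})" by (intro bounded_UN finite_lessThan ballI Linfc_supp[OF f])
  then obtain b where b: "\<And>x. x \<in> (\<Union>j<J. {x. f j x \<noteq> 0}) \<Longrightarrow> norm x \<le> b" unfolding bounded_iff by blast
  obtain k0 :: nat where k0: "2 * b + 1 < real k0" using reals_Archimedean2 by blast
  \<comment> \<open>The central cube of generation 0 in the grid of scale \<open>k\<close>; it contains all supports if \<open>k \<ge> k0\<close>.\<close>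
  define Q where "Q k = {x::real^'n. \<forall>i. - (real k / 2) \<le> x $ i \<and> x $ i < real k / 2}" for k :: nat
  define h where "h x = ennreal (w x * fin_norm J r (\<lambda>j. T (f j) x) powr p)" for x
  let ?RHS = "ennreal ((weighted_const s B p q * \<Lambda> powr (max 1 (1 / (p - 1)))) powr p) *
       (\<integral>\<^sup>+x. ennreal (w x * fin_norm J r (\<lambda>j. f j x) powr p) \<partial>lebesgue)"
  have wm[measurable]: "w \<in> borel_measurable lebesgue" using Ap by (simp add: Ap_bound_def)
  have [measurable]: "(\<lambda>x. fin_norm J r (\<lambda>j. T (f j) x)) \<in> borel_measurable lebesgue"
    by (rule fin_norm_measurable) (rule T_meas[OF f])
  have hm[measurable]: "h \<in> borel_measurable lebesgue" unfolding h_def[abs_def] by measurable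
  have loc: "(\<integral>\<^sup>+x\<in>Q k. h x \<partial>lebesgue) \<le> ?RHS" and Qm: "Q k \<in> sets lebesgue" if k: "k \<ge> max k0 1" for k
  proof -
    have kpos: "0 < real k" using k by simp
    interpret cz_grid T K CK \<alpha> "real k" "\<chi> i. - (1/2)" using kpos by unfold_locales
    define p0 :: "'n gidx" where "p0 = (0, \<lambda>i. 0)"
    have Qc: "Q k = cube p0"
      by (auto simp: Q_def cube_iff corner_def side_def p0_def)
    show "Q k \<in> sets lebesgue" unfolding Qc by simp
    have supp: "cutoff (triple p0) (f' j) = f' j" for j
    proof
      fix x
      have "f' j x = 0" if x: "x \<notin> triple p0"
      proof (rule ccontr)
        assume "f' j x \<noteq> 0"
        then have "norm x \<le> b" by (intro b) (auto simp: f'_def split: if_splits)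
        then have lt: "norm x < real k / 2" using k k0 by simp
        have "- (real k / 2) \<le> x $ i \<and> x $ i < real k / 2" for i
          using component_le_norm_cart[of x i] lt by linarith
        then have "x \<in> Q k" by (simp add: Q_def)
        then show False using x cube_subset_triple[of p0] Qc by blast
      qed
      then show "cutoff (triple p0) (f' j) x = f' j x" by (auto simp: cutoff_def)
    qed
    show "(\<integral>\<^sup>+x\<in>Q k. h x \<partial>lebesgue) \<le> ?RHS"
      using weighted_cube_bound[where f = f', OF r s B SB f'L supp p pq Ap]
      by (simp add: Qc h_def eq weighted_const_def)
  qed
  define Q' where "Q' k = Q (k + max k0 1)" for k
  have "(\<integral>\<^sup>+x. h x \<partial>lebesgue) \<le> (\<integral>\<^sup>+x. (SUP k. h x * indicator (Q' k) x) \<partial>lebesgue)"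
  proof (rule nn_integral_mono)
    fix x :: "real^'n"
    obtain k :: nat where "2 * norm x < real k" using reals_Archimedean2 by blast
    then have lt: "norm x < real (k + max k0 1) / 2" by simp
    have "- (real (k + max k0 1) / 2) \<le> x $ i \<and> x $ i < real (k + max k0 1) / 2" for i
      using component_le_norm_cart[of x i] lt by linarith
    then have "x \<in> Q' k" unfolding Q'_def Q_def by simp
    then have "h x = h x * indicator (Q' k) x" by simp
    also have "\<dots> \<le> (SUP k. h x * indicator (Q' k) x)" by (rule SUP_upper) simp
    finally show "h x \<le> (SUP k. h x * indicator (Q' k) x)" .
  qed
  also have "\<dots> = (SUP k. \<integral>\<^sup>+x. h x * indicator (Q' k) x \<partial>lebesgue)"
  proof (rule nn_integral_monotone_convergence_SUP)
    show "incseq (\<lambda>k x. h x * indicator (Q' k) x)"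
    proof (intro incseq_SucI le_funI mult_left_mono)
      fix k and x :: "real^'n"
      have "Q' k \<subseteq> Q' (Suc k)"
      proof
        fix x :: "real^'n" assume "x \<in> Q' k"
        then have "- (real (k + max k0 1) / 2) \<le> x $ i \<and> x $ i < real (k + max k0 1) / 2" for i
          by (simp add: Q'_def Q_def)
        moreover have "real (k + max k0 1) / 2 \<le> real (Suc k + max k0 1) / 2" by simp
        ultimately have "- (real (Suc k + max k0 1) / 2) \<le> x $ i \<and> x $ i < real (Suc k + max k0 1) / 2" for i
          by (smt (verit))
        then show "x \<in> Q' (Suc k)" unfolding Q'_def Q_def by blast
      qed
      then show "(indicator (Q' k) x :: ennreal) \<le> indicator (Q' (Suc k)) x" by (auto simp: indicator_def)
    qed simp
    show "(\<lambda>x. h x * indicator (Q' k) x) \<in> borel_measurable lebesgue" for k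
      using hm Qm[of "k + max k0 1"] by (intro borel_measurable_times_ennreal borel_measurable_indicator) (auto simp: Q'_def)
  qed
  also have "\<dots> \<le> ?RHS" by (rule SUP_least) (unfold Q'_def, rule loc, simp)
  finally show ?thesis by (simp add: h_def)
qed

end

section \<open>Bounds without a weight\<close>

lemma fin_norm_1: "0 < r \<Longrightarrow> fin_norm (Suc 0) r a = cmod (a 0)"
  by (simp add: fin_norm_def powr_powr)

lemma Ap_bound_one:
  assumes "1 < p" shows "Ap_bound p (\<lambda>x::real^'n::finite. 1) 1"
  unfolding Ap_bound_def
proof (intro conjI ballI)
  fix Q :: "(real^'n) set" assume "Q \<in> cubes"
  then obtain a l where Q: "Q = cbox a (\<chi> i. a $ i + l)" unfolding cubes_def by blast
  have fin: "Q \<in> lmeasurable" unfolding Q by simp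
  then have "integrable lebesgue (indicat_real Q)"
    by (intro integrable_real_indicator) (auto simp: fmeasurable_def)
  then show "set_integrable lebesgue Q (\<lambda>x. 1)" "set_integrable lebesgue Q (\<lambda>x. 1 powr (- 1 / (p - 1)))"
    unfolding set_integrable_def by simp_all
  have "measure lebesgue Q * measure lebesgue Q powr (p - 1) = measure lebesgue Q powr p"
    using assms by (subst powr_mult_base) auto
  then show "(LINT x:Q|lebesgue. 1) * (LINT x:Q|lebesgue. 1 powr (- 1 / (p - 1))) powr (p - 1) \<le> 1 * measure lebesgue Q powr p"
    by (simp add: set_lebesgue_integral_def)
qed auto

context cz_operator begin

lemma L2_bound_nn:
  obtains B where "0 \<le> B" "\<And>f. f \<in> L2_fun \<Longrightarrow>
     (\<integral>\<^sup>+x. ennreal ((cmod (T f x))\<^sup>2) \<partial>lebesgue) \<le> ennreal B * (\<integral>\<^sup>+x. ennreal ((cmod (f x))\<^sup>2) \<partial>lebesgue)"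
proof -
  obtain B where B: "\<And>f. f \<in> L2_fun \<Longrightarrow> L2_fun_norm (T f) \<le> B * L2_fun_norm f"
    using lin unfolding L2_bounded_linear_def by blast
  show thesis
  proof (rule that[of "B\<^sup>2"])
    fix f assume f: "f \<in> (L2_fun :: (real^'n \<Rightarrow> complex) set)"
    have Tf: "T f \<in> L2_fun" using lin f unfolding L2_bounded_linear_def by blast
    have eq: "(\<integral>\<^sup>+x. ennreal ((cmod (g x))\<^sup>2) \<partial>lebesgue) = ennreal ((L2_fun_norm g)\<^sup>2)" if "g \<in> L2_fun" for g :: "real^'n \<Rightarrow> complex"
    proof -
      have "integrable lebesgue (\<lambda>x. (cmod (g x))\<^sup>2)" using that by (simp add: L2_fun_def)
      then show ?thesis unfolding L2_fun_norm_def by (subst nn_integral_eq_integral) auto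
    qed
    have "0 \<le> L2_fun_norm (T f)" by (simp add: L2_fun_norm_def)
    then have "(L2_fun_norm (T f))\<^sup>2 \<le> (B * L2_fun_norm f)\<^sup>2" by (intro power_mono B f)
    then show "(\<integral>\<^sup>+x. ennreal ((cmod (T f x))\<^sup>2) \<partial>lebesgue) \<le> ennreal (B\<^sup>2) * (\<integral>\<^sup>+x. ennreal ((cmod (f x))\<^sup>2) \<partial>lebesgue)"
      unfolding eq[OF f] eq[OF Tf] by (simp add: ennreal_mult[symmetric] power_mult_distrib ennreal_leI)
  qed simp
qed

lemma strong_type_L2: obtains B where "0 \<le> B" "strong_type 1 2 2 B"
proof -
  obtain B where B: "0 \<le> B" "\<And>f. f \<in> L2_fun \<Longrightarrow>
     (\<integral>\<^sup>+x. ennreal ((cmod (T f x))\<^sup>2) \<partial>lebesgue) \<le> ennreal B * (\<integral>\<^sup>+x. ennreal ((cmod (f x))\<^sup>2) \<partial>lebesgue)"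
    by (rule L2_bound_nn) (rule that)
  have "strong_type 1 2 2 B" unfolding strong_type_def by (auto simp: fin_norm_1 intro!: B(2) Linfc_L2)
  then show thesis using B(1) that by blast
qed

text \<open>With one component and the constant weight the weighted bound holds for every exponent, in
  particular for \<open>r\<close>. For equal exponents the vector-valued bound is the sum of the scalar ones.\<close>

lemma strong_type_Lr:
  assumes r: "1 < r"
  obtains B where "0 \<le> B" "\<And>J. strong_type J r r B"
proof -
  obtain B2 where B2: "0 \<le> B2" "strong_type 1 2 2 B2" by (rule strong_type_L2)
  define q where "q = r / (r - 1)"
  have pq: "1/r + 1/q = 1" using r by (simp add: q_def field_simps)
  define B where "B = (weighted_const 2 B2 r q * 1 powr (max 1 (1 / (r - 1)))) powr r"
  have scal: "(\<integral>\<^sup>+x. ennreal (cmod (T f x) powr r) \<partial>lebesgue) \<le> ennreal B * (\<integral>\<^sup>+x. ennreal (cmod (f x) powr r) \<partial>lebesgue)"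
    if f: "f \<in> Linfc" for f
    using weighted_bound[where f = "\<lambda>j. f" and w = "\<lambda>x. 1", OF _ _ B2 f r pq Ap_bound_one[OF r]]
    by (simp add: B_def fin_norm_1)
  have "strong_type J r r B" for J unfolding strong_type_def
  proof (intro allI impI)
    fix f :: "nat \<Rightarrow> real^'n \<Rightarrow> complex" assume f: "\<forall>j. f j \<in> Linfc"
    have r0: "0 < r" using r by simp
    have m: "(\<lambda>x. ennreal (cmod (g x) powr r)) \<in> borel_measurable lebesgue" if "g \<in> borel_measurable lebesgue" for g :: "real^'n \<Rightarrow> complex"
      using that by measurable
    have "(\<integral>\<^sup>+x. ennreal (fin_norm J r (\<lambda>j. T (f j) x) powr r) \<partial>lebesgue) = (\<integral>\<^sup>+x. (\<Sum>j<J. ennreal (cmod (T (f j) x) powr r)) \<partial>lebesgue)"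
      using r0 by (intro nn_integral_cong) (simp add: fin_norm_powr)
    also have "\<dots> = (\<Sum>j<J. \<integral>\<^sup>+x. ennreal (cmod (T (f j) x) powr r) \<partial>lebesgue)"
      using f by (intro nn_integral_sum m T_meas) auto
    also have "\<dots> \<le> (\<Sum>j<J. ennreal B * (\<integral>\<^sup>+x. ennreal (cmod (f j x) powr r) \<partial>lebesgue))"
      using f by (intro sum_mono scal) auto
    also have "\<dots> = ennreal B * (\<Sum>j<J. \<integral>\<^sup>+x. ennreal (cmod (f j x) powr r) \<partial>lebesgue)" by (simp add: sum_distrib_left)
    also have "(\<Sum>j<J. \<integral>\<^sup>+x. ennreal (cmod (f j x) powr r) \<partial>lebesgue) = (\<integral>\<^sup>+x. (\<Sum>j<J. ennreal (cmod (f j x) powr r)) \<partial>lebesgue)"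
      using f by (intro nn_integral_sum[symmetric] m Linfc_meas) auto
    also have "\<dots> = (\<integral>\<^sup>+x. ennreal (fin_norm J r (\<lambda>j. f j x) powr r) \<partial>lebesgue)"
      using r0 by (intro nn_integral_cong) (simp add: fin_norm_powr)
    finally show "(\<integral>\<^sup>+x. ennreal (fin_norm J r (\<lambda>j. T (f j) x) powr r) \<partial>lebesgue)
       \<le> ennreal B * (\<integral>\<^sup>+x. ennreal (fin_norm J r (\<lambda>j. f j x) powr r) \<partial>lebesgue)" .
  qed
  moreover have "0 \<le> B" by (simp add: B_def)
  ultimately show thesis using that by blast
qed

section \<open>From test functions to square integrable functions\<close>

lemma cutoff_L2: assumes "f \<in> L2_fun" "A \<in> sets lebesgue" shows "cutoff A f \<in> (L2_fun :: (real^'n \<Rightarrow> complex) set)"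
proof -
  have fm: "f \<in> borel_measurable lebesgue" and fi: "integrable lebesgue (\<lambda>x. (cmod (f x))\<^sup>2)"
    using assms(1) by (simp_all add: L2_fun_def)
  have m: "cutoff A f \<in> borel_measurable lebesgue" unfolding cutoff_def[abs_def] using fm assms(2) by measurable
  have "integrable lebesgue (\<lambda>x. (cmod (cutoff A f x))\<^sup>2)"
  proof (rule Bochner_Integration.integrable_bound[OF fi])
    show "(\<lambda>x. (cmod (cutoff A f x))\<^sup>2) \<in> borel_measurable lebesgue" using m by measurable
    show "AE x in lebesgue. norm ((cmod (cutoff A f x))\<^sup>2) \<le> norm ((cmod (f x))\<^sup>2)"
      by (intro AE_I2) (simp add: cutoff_def)
  qed
  then show ?thesis using m by (simp add: L2_fun_def)
qed

text \<open>The \<open>L\<^sup>2\<close> bound makes the images converge in \<open>L\<^sup>2\<close>. The radii are chosen such that the squared errors have a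
  finite sum, which gives convergence almost everywhere for finitely many components at once.\<close>

lemma approximating_cutoffs:
  fixes f :: "nat \<Rightarrow> real^'n \<Rightarrow> complex"
  assumes f: "\<And>j. f j \<in> L2_fun"
  obtains m :: "nat \<Rightarrow> nat" where "AE x in lebesgue. \<forall>j<J. (\<lambda>i. T (cutoff (cball 0 (real (m i))) (f j)) x) \<longlonglongrightarrow> T (f j) x"
proof -
  obtain B where B: "0 \<le> B" "\<And>f. f \<in> L2_fun \<Longrightarrow>
     (\<integral>\<^sup>+x. ennreal ((cmod (T f x))\<^sup>2) \<partial>lebesgue) \<le> ennreal B * (\<integral>\<^sup>+x. ennreal ((cmod (f x))\<^sup>2) \<partial>lebesgue)"
    by (rule L2_bound_nn) (rule that)
  have fm[measurable]: "f j \<in> borel_measurable lebesgue" for j using f by (simp add: L2_fun_def)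
  define h where "h x = (\<Sum>j<J. ennreal ((cmod (f j x))\<^sup>2))" for x
  have hm[measurable]: "h \<in> borel_measurable lebesgue" unfolding h_def[abs_def] by measurable
  have fj: "(\<integral>\<^sup>+x. ennreal ((cmod (f j x))\<^sup>2) \<partial>lebesgue) < \<infinity>" for j
    using f[of j] unfolding L2_fun_def by (simp add: nn_integral_eq_integral)
  have "(\<integral>\<^sup>+x. h x \<partial>lebesgue) = (\<Sum>j<J. \<integral>\<^sup>+x. ennreal ((cmod (f j x))\<^sup>2) \<partial>lebesgue)"
    unfolding h_def by (intro nn_integral_sum) measurable
  also have "\<dots> < \<infinity>" using fj by (simp add: ennreal_sum_less_top)
  finally have hfin: "(\<integral>\<^sup>+x. h x \<partial>lebesgue) < \<infinity>" .
  have cb: "cball (0::real^'n) b \<in> sets lebesgue" for b by (intro fmeasurableD lmeasurable_cball)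
  have cbc: "- cball (0::real^'n) b \<in> sets lebesgue" for b using cb by (simp only: Compl_in_sets_lebesgue)
  have "\<exists>m::nat. (\<integral>\<^sup>+x\<in>- cball 0 (real m). h x \<partial>lebesgue) \<le> ennreal ((1/2) ^ i)" for i :: nat
  proof -
    have d: "0 < ennreal ((1/2) ^ i)" by simp
    obtain P' where P': "finite P'" "P' \<subseteq> (UNIV :: nat set)"
      "(\<integral>\<^sup>+x\<in>(\<Union>((\<lambda>k. cball (0::real^'n) (real k)) ` UNIV) - \<Union>((\<lambda>k. cball 0 (real k)) ` P')). h x \<partial>lebesgue) < ennreal ((1/2) ^ i)"
      by (rule finite_tail_small[where A = "\<lambda>k. cball (0::real^'n) (real k)" and P = "UNIV :: nat set", OF hm hfin _ cb d]) (simp, rule that)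
    define m where "m = Max (insert 0 P')"
    have sub: "\<Union>((\<lambda>k. cball (0::real^'n) (real k)) ` P') \<subseteq> cball 0 (real m)"
    proof
      fix x :: "real^'n" assume "x \<in> \<Union>((\<lambda>k. cball 0 (real k)) ` P')"
      then obtain k where k: "k \<in> P'" "norm x \<le> real k" by auto
      have "k \<le> m" unfolding m_def using P'(1) k by (intro Max_ge) auto
      then show "x \<in> cball 0 (real m)" using k by simp
    qed
    have all: "x \<in> \<Union>((\<lambda>k. cball 0 (real k)) ` UNIV)" for x :: "real^'n"
      using real_arch_simple[of "norm x"] by auto
    have "(\<integral>\<^sup>+x\<in>- cball 0 (real m). h x \<partial>lebesgue) \<le>
      (\<integral>\<^sup>+x\<in>(\<Union>((\<lambda>k. cball (0::real^'n) (real k)) ` UNIV) - \<Union>((\<lambda>k. cball 0 (real k)) ` P')). h x \<partial>lebesgue)"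
    proof (intro nn_integral_mono mult_left_mono)
      fix x :: "real^'n"
      show "(indicator (- cball 0 (real m)) x :: ennreal) \<le> indicator (\<Union>((\<lambda>k. cball 0 (real k)) ` UNIV) - \<Union>((\<lambda>k. cball 0 (real k)) ` P')) x"
      proof (cases "x \<in> cball 0 (real m)")
        case False
        then have "x \<in> \<Union>((\<lambda>k. cball 0 (real k)) ` UNIV) - \<Union>((\<lambda>k. cball 0 (real k)) ` P')" using sub all[of x] by blast
        then have "(indicator (\<Union>((\<lambda>k. cball 0 (real k)) ` UNIV) - \<Union>((\<lambda>k. cball 0 (real k)) ` P')) x :: ennreal) = 1"
          by (rule indicator_simps(1))
        then show ?thesis by (simp only:) (simp add: indicator_def)
      qed simp
    qed simp
    then show ?thesis using P'(3) by (intro exI[of _ m]) (meson less_imp_le order_trans)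
  qed
  then obtain m :: "nat \<Rightarrow> nat" where m: "\<And>i. (\<integral>\<^sup>+x\<in>- cball 0 (real (m i)). h x \<partial>lebesgue) \<le> ennreal ((1/2) ^ i)"
    by metis
  define g where "g i j = cutoff (- cball 0 (real (m i))) (f j)" for i j
  have gL: "g i j \<in> L2_fun" for i j unfolding g_def by (intro cutoff_L2 f cbc)
  have cL: "cutoff (cball 0 (real (m i))) (f j) \<in> L2_fun" for i j by (intro cutoff_L2 f cb)
  have Tgm[measurable]: "T (g i j) \<in> borel_measurable lebesgue" for i j
    using lin gL[of i j] unfolding L2_bounded_linear_def L2_fun_def by blast
  have split: "f j = (\<lambda>x. cutoff (cball 0 (real (m i))) (f j) x + g i j x)" for i j
    by (auto simp: g_def cutoff_def)
  have lin': "AE x in lebesgue. T (\<lambda>x. u x + v x) x = T u x + T v x" if "u \<in> L2_fun" "v \<in> L2_fun" for u v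
    using lin that unfolding L2_bounded_linear_def by blast
  have A1: "AE x in lebesgue. \<forall>i j. T (f j) x = T (cutoff (cball 0 (real (m i))) (f j)) x + T (g i j) x"
  proof (intro AE_all_countable[THEN iffD2] allI)
    fix i j
    show "AE x in lebesgue. T (f j) x = T (cutoff (cball 0 (real (m i))) (f j)) x + T (g i j) x"
      using lin'[OF cL[of i j] gL[of i j]] by (simp only: split[of j i, symmetric])
  qed
  define V where "V i x = (\<Sum>j<J. ennreal ((cmod (T (g i j) x))\<^sup>2))" for i x
  have Vm[measurable]: "V i \<in> borel_measurable lebesgue" for i unfolding V_def[abs_def] by measurable
  have V: "(\<integral>\<^sup>+x. V i x \<partial>lebesgue) \<le> ennreal B * ennreal ((1/2) ^ i)" for i
  proof -
    have "(\<integral>\<^sup>+x. V i x \<partial>lebesgue) = (\<Sum>j<J. \<integral>\<^sup>+x. ennreal ((cmod (T (g i j) x))\<^sup>2) \<partial>lebesgue)"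
      unfolding V_def by (intro nn_integral_sum) measurable
    also have "\<dots> \<le> (\<Sum>j<J. ennreal B * (\<integral>\<^sup>+x. ennreal ((cmod (g i j x))\<^sup>2) \<partial>lebesgue))"
      by (intro sum_mono B gL)
    also have "\<dots> = ennreal B * (\<Sum>j<J. \<integral>\<^sup>+x. ennreal ((cmod (g i j x))\<^sup>2) \<partial>lebesgue)" by (simp add: sum_distrib_left)
    also have "(\<Sum>j<J. \<integral>\<^sup>+x. ennreal ((cmod (g i j x))\<^sup>2) \<partial>lebesgue) = (\<integral>\<^sup>+x. (\<Sum>j<J. ennreal ((cmod (g i j x))\<^sup>2)) \<partial>lebesgue)"
    proof (rule nn_integral_sum[symmetric])
      show "(\<lambda>x. ennreal ((cmod (g i j x))\<^sup>2)) \<in> borel_measurable lebesgue" for j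
      proof -
        have "g i j \<in> borel_measurable lebesgue" using gL[of i j] by (simp add: L2_fun_def)
        then show ?thesis by measurable
      qed
    qed
    also have "\<dots> = (\<integral>\<^sup>+x\<in>- cball 0 (real (m i)). h x \<partial>lebesgue)"
      unfolding h_def g_def cutoff_def by (intro nn_integral_cong) (simp add: indicator_def)
    also have "ennreal B * \<dots> \<le> ennreal B * ennreal ((1/2) ^ i)" by (intro mult_left_mono m) simp
    finally show ?thesis .
  qed
  have "(\<integral>\<^sup>+x. (\<Sum>i. V i x) \<partial>lebesgue) = (\<Sum>i. \<integral>\<^sup>+x. V i x \<partial>lebesgue)" by (intro nn_integral_suminf Vm)
  also have "\<dots> \<le> (\<Sum>i. ennreal (B * (1/2) ^ i))"
    using V B(1) by (intro suminf_le) (auto simp: ennreal_mult)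
  also have "\<dots> = ennreal (B * 2)"
  proof (rule suminf_ennreal_eq)
    show "(\<lambda>i. B * (1/2) ^ i) sums (B * 2)" using sums_mult[OF geometric_sums[of "1/2 :: real"], of B] by simp
  qed (use B(1) in simp)
  finally have "(\<integral>\<^sup>+x. (\<Sum>i. V i x) \<partial>lebesgue) \<noteq> \<infinity>" by (auto simp: top_unique)
  then have A2: "AE x in lebesgue. (\<Sum>i. V i x) \<noteq> \<infinity>" by (intro nn_integral_noteq_infinite) measurable
  show thesis
  proof (rule that[of m])
    show "AE x in lebesgue. \<forall>j<J. (\<lambda>i. T (cutoff (cball 0 (real (m i))) (f j)) x) \<longlonglongrightarrow> T (f j) x"
      using A1 A2
    proof eventually_elim
      case (elim x)
      show ?case
      proof (intro allI impI)
        fix j assume j: "j < J"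
        have "(\<Sum>i. ennreal ((cmod (T (g i j) x))\<^sup>2)) \<le> (\<Sum>i. V i x)"
          unfolding V_def by (intro suminf_le member_le_sum) (use j in auto)
        then have "(\<Sum>i. ennreal ((cmod (T (g i j) x))\<^sup>2)) \<noteq> top" using elim(2) by (auto simp: top_unique)
        then have "summable (\<lambda>i. (cmod (T (g i j) x))\<^sup>2)" by (intro summable_suminf_not_top) auto
        then have "(\<lambda>i. (cmod (T (g i j) x))\<^sup>2) \<longlonglongrightarrow> 0" by (rule summable_LIMSEQ_zero)
        then have "(\<lambda>i. sqrt ((cmod (T (g i j) x))\<^sup>2)) \<longlonglongrightarrow> sqrt 0" by (rule tendsto_real_sqrt)
        then have "(\<lambda>i. T (g i j) x) \<longlonglongrightarrow> 0" by (simp add: tendsto_norm_zero_iff)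
        then have "(\<lambda>i. T (f j) x - T (g i j) x) \<longlonglongrightarrow> T (f j) x - 0" by (intro tendsto_diff tendsto_const)
        moreover have "T (f j) x - T (g i j) x = T (cutoff (cball 0 (real (m i))) (f j)) x" for i
          using elim(1) by (simp add: algebra_simps)
        ultimately show "(\<lambda>i. T (cutoff (cball 0 (real (m i))) (f j)) x) \<longlonglongrightarrow> T (f j) x" by simp
      qed
    qed
  qed
qed

text \<open>Fatou's lemma along the cut-off functions, whose norms are pointwise at most those of the given ones.\<close>

lemma weighted_bound_L2:
  assumes r: "1 < r" and s: "1 < s" and B: "0 \<le> B" and SB: "strong_type J r s B"
    and f: "\<And>j. f j \<in> L2_fun" and bdd: "\<And>j. \<exists>M. \<forall>x. cmod (f j x) \<le> M"
    and p: "1 < p" and pq: "1/p + 1/q = 1" and Ap: "Ap_bound p w \<Lambda>"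
  shows "(\<integral>\<^sup>+x. ennreal (w x * fin_norm J r (\<lambda>j. T (f j) x) powr p) \<partial>lebesgue)
    \<le> ennreal ((weighted_const s B p q * \<Lambda> powr (max 1 (1 / (p - 1)))) powr p) *
       (\<integral>\<^sup>+x. ennreal (w x * fin_norm J r (\<lambda>j. f j x) powr p) \<partial>lebesgue)"
proof -
  have r0: "0 < r" using r by simp
  have w: "w \<in> borel_measurable lebesgue" "\<And>x. 0 < w x" using Ap[unfolded Ap_bound_def] by blast+
  note wm[measurable] = w(1)
  have w0: "0 \<le> w x" for x using w(2) by (simp add: less_imp_le)
  have fm: "f j \<in> borel_measurable lebesgue" for j using f by (simp add: L2_fun_def)
  obtain m :: "nat \<Rightarrow> nat" where m: "AE x in lebesgue. \<forall>j<J. (\<lambda>i. T (cutoff (cball 0 (real (m i))) (f j)) x) \<longlonglongrightarrow> T (f j) x"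
    by (rule approximating_cutoffs[where f = f and J = J, OF f]) (rule that)
  define g where "g i j = cutoff (cball 0 (real (m i))) (f j)" for i j
  have gL: "g i j \<in> Linfc" for i j
  proof -
    obtain M where M: "\<And>x. cmod (f j x) \<le> M" using bdd by blast
    have M0: "0 \<le> M" using M norm_ge_zero order_trans by blast
    have cb: "cball (0::real^'n) b \<in> sets lebesgue" for b by (intro fmeasurableD lmeasurable_cball)
    show ?thesis unfolding g_def
    proof (rule LinfcI)
      show "cutoff (cball 0 (real (m i))) (f j) \<in> borel_measurable lebesgue"
        unfolding cutoff_def[abs_def] using fm[of j] cb by measurable
      show "cmod (cutoff (cball 0 (real (m i))) (f j) x) \<le> M" for x using M M0 by (simp add: cutoff_def)
      show "bounded (cball (0::real^'n) (real (m i)))" by simp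
    qed (simp add: cutoff_def)
  qed
  let ?h = "\<lambda>i x. ennreal (w x * fin_norm J r (\<lambda>j. T (g i j) x) powr p)"
  let ?D = "ennreal ((weighted_const s B p q * \<Lambda> powr (max 1 (1 / (p - 1)))) powr p)"
  have Tm: "(\<lambda>x. fin_norm J r (\<lambda>j. T (g i j) x)) \<in> borel_measurable lebesgue" for i
    by (rule fin_norm_measurable) (rule T_meas[OF gL])
  have hm: "?h i \<in> borel_measurable lebesgue" for i using Tm[of i] by measurable
  have "(\<integral>\<^sup>+x. ennreal (w x * fin_norm J r (\<lambda>j. T (f j) x) powr p) \<partial>lebesgue) \<le> (\<integral>\<^sup>+x. liminf (\<lambda>i. ?h i x) \<partial>lebesgue)"
  proof (rule nn_integral_mono_AE)
    show "AE x in lebesgue. ennreal (w x * fin_norm J r (\<lambda>j. T (f j) x) powr p) \<le> liminf (\<lambda>i. ?h i x)"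
      using m
    proof eventually_elim
      case (elim x)
      have "(\<lambda>i. fin_norm J r (\<lambda>j. T (g i j) x)) \<longlonglongrightarrow> fin_norm J r (\<lambda>j. T (f j) x)"
        unfolding fin_norm_def
      proof (intro tendsto_powr' tendsto_sum tendsto_norm)
        show "(\<lambda>i. T (g i j) x) \<longlonglongrightarrow> T (f j) x" if "j \<in> {..<J}" for j using elim that by (simp add: g_def)
      qed (use r0 in \<open>auto intro!: always_eventually sum_nonneg\<close>)
      then have "(\<lambda>i. ?h i x) \<longlonglongrightarrow> ennreal (w x * fin_norm J r (\<lambda>j. T (f j) x) powr p)"
        using p by (intro tendsto_ennrealI tendsto_mult tendsto_const tendsto_powr') (auto intro!: always_eventually)
      then show ?case by (simp add: lim_imp_Liminf)
    qed
  qed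
  also have "\<dots> \<le> liminf (\<lambda>i. \<integral>\<^sup>+x. ?h i x \<partial>lebesgue)" by (rule nn_integral_liminf) (rule hm)
  also have "\<dots> \<le> ?D * (\<integral>\<^sup>+x. ennreal (w x * fin_norm J r (\<lambda>j. f j x) powr p) \<partial>lebesgue)"
  proof (rule Liminf_le)
    have "(\<integral>\<^sup>+x. ?h i x \<partial>lebesgue) \<le> ?D * (\<integral>\<^sup>+x. ennreal (w x * fin_norm J r (\<lambda>j. f j x) powr p) \<partial>lebesgue)" for i
    proof -
      have "(\<integral>\<^sup>+x. ?h i x \<partial>lebesgue) \<le> ?D * (\<integral>\<^sup>+x. ennreal (w x * fin_norm J r (\<lambda>j. g i j x) powr p) \<partial>lebesgue)"
        by (rule weighted_bound[OF r s B SB gL p pq Ap])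
      also have "\<dots> \<le> ?D * (\<integral>\<^sup>+x. ennreal (w x * fin_norm J r (\<lambda>j. f j x) powr p) \<partial>lebesgue)"
        using w0 p by (intro mult_left_mono nn_integral_mono ennreal_leI powr_mono2) (auto simp: g_def fin_norm_cutoff)
      finally show ?thesis .
    qed
    then show "\<forall>\<^sub>F i in sequentially. (\<integral>\<^sup>+x. ?h i x \<partial>lebesgue) \<le> ?D * (\<integral>\<^sup>+x. ennreal (w x * fin_norm J r (\<lambda>j. f j x) powr p) \<partial>lebesgue)"
      by (intro always_eventually) blast
  qed simp
  finally show ?thesis .
qed

end

section \<open>Schwartz functions\<close>

lemma norm_power_le_sum:
  fixes x :: "real^'n::finite"
  shows "norm x ^ k \<le> real CARD('n) ^ k * (\<Sum>i\<in>UNIV. \<bar>x $ i\<bar> ^ k)"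
proof -
  have "Max (range (\<lambda>i. \<bar>x $ i\<bar>)) \<in> range (\<lambda>i. \<bar>x $ i\<bar>)" by (intro Max_in) auto
  then obtain i where i: "Max (range (\<lambda>i. \<bar>x $ i\<bar>)) = \<bar>x $ i\<bar>" by blast
  have mx: "\<bar>x $ j\<bar> \<le> \<bar>x $ i\<bar>" for j unfolding i[symmetric] by (intro Max_ge) auto
  have "norm x \<le> (\<Sum>j\<in>UNIV. \<bar>x $ j\<bar>)" by (rule norm_le_l1_cart)
  also have "\<dots> \<le> (\<Sum>j\<in>(UNIV::'n set). \<bar>x $ i\<bar>)" by (rule sum_mono) (rule mx)
  finally have "norm x \<le> real CARD('n) * \<bar>x $ i\<bar>" by simp
  then have "norm x ^ k \<le> (real CARD('n) * \<bar>x $ i\<bar>) ^ k" by (intro power_mono) auto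
  also have "\<dots> = real CARD('n) ^ k * \<bar>x $ i\<bar> ^ k" by (simp add: power_mult_distrib)
  also have "\<dots> \<le> real CARD('n) ^ k * (\<Sum>i\<in>UNIV. \<bar>x $ i\<bar> ^ k)"
    by (intro mult_left_mono member_le_sum) auto
  finally show ?thesis .
qed

lemma schwartz_coord_power_bounded:
  fixes f :: "real^'n::finite \<Rightarrow> complex"
  assumes "f \<in> schwartz" shows "\<exists>M. \<forall>x. \<bar>x $ i\<bar> ^ k * cmod (f x) \<le> M"
proof -
  let ?\<beta> = "\<lambda>j. if j = i then k else 0"
  have "bounded (range (\<lambda>x. (\<Prod>j\<in>UNIV. x $ j ^ ?\<beta> j) *\<^sub>R iter_deriv [] f x))"
  proof -
    have "\<forall>(\<beta> :: 'n \<Rightarrow> nat) is. bounded (range (\<lambda>x. (\<Prod>j\<in>UNIV. x $ j ^ \<beta> j) *\<^sub>R iter_deriv is f x))"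
      using assms by (simp add: schwartz_def)
    then show ?thesis by (elim allE)
  qed
  then obtain M where M: "\<And>x. norm ((\<Prod>j\<in>UNIV. x $ j ^ ?\<beta> j) *\<^sub>R iter_deriv [] f x) \<le> M"
    unfolding bounded_iff by blast
  have pr: "(\<Prod>j\<in>UNIV. x $ j ^ ?\<beta> j) = x $ i ^ k" for x :: "real^'n"
  proof -
    have "(\<Prod>j\<in>UNIV. x $ j ^ ?\<beta> j) = (\<Prod>j\<in>UNIV. if j = i then x $ i ^ k else 1)" by (intro prod.cong) auto
    then show ?thesis by simp
  qed
  have "\<bar>x $ i\<bar> ^ k * cmod (f x) \<le> M" for x
    using M[of x] unfolding pr by (simp add: iter_deriv_def power_abs abs_mult)
  then show ?thesis by blast
qed

text \<open>Decay of order \<open>n + 1\<close> of \<open>f\<close> times boundedness of \<open>f\<close> shows that \<open>|f|\<^sup>2\<close> is at most a multiple of the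
  integrable function \<open>(1 + |x|)\<^bsup>-n-1\<^esup>\<close>, which is \<open>bump\<close> for \<open>\<alpha> = l = 1\<close>.\<close>

lemma schwartz_bounded_L2:
  fixes f :: "real^'n::finite \<Rightarrow> complex"
  assumes f: "f \<in> schwartz"
  shows "\<exists>M. \<forall>x. cmod (f x) \<le> M" "f \<in> L2_fun"
proof -
  obtain M where M': "\<And>x. \<bar>x $ undefined\<bar> ^ 0 * cmod (f x) \<le> M" using schwartz_coord_power_bounded[OF f] by blast
  then have M: "cmod (f x) \<le> M" for x by (metis mult_1 power_0)
  have M0: "0 \<le> M" using M norm_ge_zero order_trans by blast
  show "\<exists>M. \<forall>x. cmod (f x) \<le> M" using M by blast
  let ?k = "CARD('n) + 1"
  have "\<forall>i. \<exists>M. \<forall>x. \<bar>x $ i\<bar> ^ ?k * cmod (f x) \<le> M" using schwartz_coord_power_bounded[OF f] by blast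
  then obtain Mi where Mi: "\<And>i x. \<bar>x $ i\<bar> ^ ?k * cmod (f x) \<le> Mi i" by metis
  define D where "D = M * (2 ^ ?k * (M + real CARD('n) ^ ?k * (\<Sum>i\<in>UNIV. Mi i)))"
  have le: "(cmod (f x))\<^sup>2 \<le> D * bump 1 1 (0 - x)" for x
  proof -
    have "(1 + norm x) ^ ?k \<le> (2 * max 1 (norm x)) ^ ?k" by (intro power_mono) auto
    also have "\<dots> = 2 ^ ?k * max 1 (norm x) ^ ?k" by (rule power_mult_distrib)
    also have "max 1 (norm x) ^ ?k \<le> 1 + norm x ^ ?k" by (cases "norm x \<le> 1") (auto simp: max_def)
    finally have "(1 + norm x) ^ ?k \<le> 2 ^ ?k * (1 + norm x ^ ?k)" by simp
    then have "(1 + norm x) ^ ?k * cmod (f x) \<le> 2 ^ ?k * (1 + norm x ^ ?k) * cmod (f x)" by (intro mult_right_mono) auto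
    also have "\<dots> = 2 ^ ?k * (cmod (f x) + norm x ^ ?k * cmod (f x))" by (simp add: algebra_simps)
    also have "\<dots> \<le> 2 ^ ?k * (M + real CARD('n) ^ ?k * (\<Sum>i\<in>UNIV. Mi i))"
    proof (intro mult_left_mono add_mono M)
      have "norm x ^ ?k * cmod (f x) \<le> (real CARD('n) ^ ?k * (\<Sum>i\<in>UNIV. \<bar>x $ i\<bar> ^ ?k)) * cmod (f x)"
        by (intro mult_right_mono norm_power_le_sum) simp
      also have "\<dots> = real CARD('n) ^ ?k * (\<Sum>i\<in>UNIV. \<bar>x $ i\<bar> ^ ?k * cmod (f x))" by (simp only: sum_distrib_right mult.assoc)
      also have "\<dots> \<le> real CARD('n) ^ ?k * (\<Sum>i\<in>UNIV. Mi i)" by (intro mult_left_mono sum_mono Mi) simp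
      finally show "norm x ^ ?k * cmod (f x) \<le> real CARD('n) ^ ?k * (\<Sum>i\<in>UNIV. Mi i)" .
    qed simp
    finally have b: "(1 + norm x) ^ ?k * cmod (f x) \<le> 2 ^ ?k * (M + real CARD('n) ^ ?k * (\<Sum>i\<in>UNIV. Mi i))" .
    have "(1 + norm x) ^ ?k * (cmod (f x))\<^sup>2 = cmod (f x) * ((1 + norm x) ^ ?k * cmod (f x))" by (simp add: power2_eq_square)
    also have "\<dots> \<le> D" unfolding D_def by (rule mult_mono[OF M b M0]) simp
    finally have "(1 + norm x) ^ ?k * (cmod (f x))\<^sup>2 \<le> D" .
    moreover have "bump 1 1 (0 - x) = 1 / (1 + norm x) ^ ?k"
    proof -
      have "0 < 1 + norm x" using norm_ge_zero[of x] by linarith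
      from powr_realpow[OF this, of ?k] show ?thesis by (simp add: bump_def add.commute)
    qed
    moreover have "0 < (1 + norm x) ^ ?k" using norm_ge_zero[of x] by (intro zero_less_power) linarith
    ultimately show ?thesis by (simp add: pos_le_divide_eq mult.commute)
  qed
  have "f differentiable_on UNIV"
  proof -
    have "smooth_fun f" using f by (simp add: schwartz_def)
    then have "iter_deriv [] f differentiable_on UNIV" unfolding smooth_fun_def by blast
    then show ?thesis by (simp add: iter_deriv_def)
  qed
  then have "f \<in> borel_measurable borel"
    by (intro borel_measurable_continuous_onI differentiable_imp_continuous_on)
  then have fm: "f \<in> borel_measurable lebesgue" by (intro measurable_completion) simp
  obtain C where C: "0 < C" "\<And>l (x::real^'n). 0 < l \<Longrightarrow> (\<integral>\<^sup>+y. ennreal (bump 1 l (x - y)) \<partial>lebesgue) \<le> ennreal C"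
    by (rule bump_integral_bound[of 1]) (simp, rule that)
  have bm: "(\<lambda>y. bump 1 1 (0 - y :: real^'n)) \<in> borel_measurable lebesgue" by (intro measurable_completion) simp
  have bi: "integrable lebesgue (\<lambda>y. bump 1 1 (0 - y :: real^'n))"
    by (rule integral_le_of_nn_integral[OF bm _ C(2)]) (use C(1) in auto)
  have "integrable lebesgue (\<lambda>x. (cmod (f x))\<^sup>2)"
  proof (rule Bochner_Integration.integrable_bound[OF integrable_mult_right[OF bi, of D]])
    show "(\<lambda>x. (cmod (f x))\<^sup>2) \<in> borel_measurable lebesgue" using fm by measurable
    show "AE x in lebesgue. norm ((cmod (f x))\<^sup>2) \<le> norm (D * bump 1 1 (0 - x))"
      using le by (intro AE_I2) (simp add: order_trans[OF _ abs_ge_self])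
  qed
  then show "f \<in> L2_fun" using fm by (simp add: L2_fun_def)
qed

section \<open>Muckenhoupt weights and mixed norms\<close>

lemma enn_powr_mono: "0 \<le> a \<Longrightarrow> x \<le> y \<Longrightarrow> enn_powr x a \<le> enn_powr y a"
  unfolding enn_powr_def
  by (auto simp: top_unique intro!: ennreal_leI powr_mono2 enn2real_mono simp: less_top)

lemma enn_powr_ennreal: "0 \<le> x \<Longrightarrow> enn_powr (ennreal x) a = ennreal (x powr a)"
  by (simp add: enn_powr_def)

lemma enn_powr_mult_ennreal:
  assumes "0 \<le> D" "0 < a"
  shows "enn_powr (ennreal D * x) a = ennreal (D powr a) * enn_powr x a"
proof (cases x)
  case (real c)
  then show ?thesis using assms by (simp add: ennreal_mult[symmetric] enn_powr_ennreal powr_mult)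
next
  case top
  then show ?thesis using assms by (cases "D = 0") (simp_all add: enn_powr_def ennreal_mult_top)
qed

text \<open>Continuity of the power function from below, which reduces mixed norms of sequences to finitely many components.\<close>

lemma enn_powr_SUP_le:
  assumes c: "\<And>J. 0 \<le> c J" and a: "0 < a"
  shows "enn_powr (SUP J. ennreal (c J)) a \<le> (SUP J. ennreal (c J powr a))"
proof (cases "SUP J. ennreal (c J powr a)")
  case (real y)
  have "c J \<le> y powr (1/a)" for J
  proof -
    have "ennreal (c J powr a) \<le> ennreal y" unfolding real(2)[symmetric] by (rule SUP_upper) simp
    then have "c J powr a \<le> y" using real(1) by (simp add: ennreal_le_iff)
    then have "(c J powr a) powr (1/a) \<le> y powr (1/a)" using a by (intro powr_mono2) auto
    then show ?thesis using a c[of J] by (simp add: powr_powr)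
  qed
  then have "(SUP J. ennreal (c J)) \<le> ennreal (y powr (1/a))" by (intro SUP_least ennreal_leI)
  then have "enn_powr (SUP J. ennreal (c J)) a \<le> enn_powr (ennreal (y powr (1/a))) a" using a by (intro enn_powr_mono) auto
  also have "\<dots> = ennreal y" using a real(1) by (simp add: enn_powr_ennreal powr_powr)
  finally show ?thesis using real by simp
next
  case top
  then show ?thesis by (simp only: top_greatest)
qed

lemma lr_norm_bounds:
  assumes r: "0 < r"
  shows "ennreal (fin_norm J r a) \<le> lr_norm r a" "lr_norm r a \<le> (SUP J. ennreal (fin_norm J r a))"
proof -
  define c where "c J = (\<Sum>j<J. cmod (a j) powr r)" for J
  have c0: "0 \<le> c J" for J by (simp add: c_def sum_nonneg)
  have ce: "(\<Sum>j<J. ennreal (cmod (a j) powr r)) = ennreal (c J)" for J by (simp add: c_def)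
  have cp: "fin_norm J r a = c J powr (1/r)" for J by (simp add: fin_norm_def c_def)
  have S: "(\<Sum>j. ennreal (cmod (a j) powr r)) = (SUP J. ennreal (c J))" by (simp add: suminf_eq_SUP ce)
  have "ennreal (fin_norm J r a) = enn_powr (ennreal (c J)) (1/r)" by (simp add: cp enn_powr_ennreal c0)
  also have "\<dots> \<le> lr_norm r a" unfolding lr_norm_def S using r by (intro enn_powr_mono SUP_upper) auto
  finally show "ennreal (fin_norm J r a) \<le> lr_norm r a" .
  show "lr_norm r a \<le> (SUP J. ennreal (fin_norm J r a))"
    unfolding lr_norm_def S cp using r by (intro enn_powr_SUP_le c0) auto
qed

text \<open>The mean of \<open>w\<close> over a cube is positive, so finiteness of the \<open>A\<^sub>p\<close> constant makes the dual weight integrable on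
  every cube.\<close>

lemma Ap_bound_of_Ap_weight:
  fixes w :: "real^'n::finite \<Rightarrow> real"
  assumes p: "1 < p" and w: "w \<in> Ap_weights p"
  obtains w' where "AE x in lebesgue. w x = w' x" "Ap_bound p w' (enn2real (Ap_const p w))"
proof -
  define \<Lambda> where "\<Lambda> = enn2real (Ap_const p w)"
  have Ae: "Ap_const p w = ennreal \<Lambda>" using w by (simp add: Ap_weights_def \<Lambda>_def less_top)
  have wm[measurable]: "w \<in> borel_measurable lebesgue" and wpos: "AE x in lebesgue. 0 < w x"
    and wint: "\<And>S. compact S \<Longrightarrow> set_integrable lebesgue S w"
    using w by (auto simp: Ap_weights_def weight_def)
  define w' where "w' x = (if 0 < w x then w x else 1)" for x
  define \<sigma> where "\<sigma> x = w' x powr (- 1 / (p - 1))" for x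
  have w'm[measurable]: "w' \<in> borel_measurable lebesgue" unfolding w'_def[abs_def] by measurable
  have sm[measurable]: "\<sigma> \<in> borel_measurable lebesgue" unfolding \<sigma>_def[abs_def] by measurable
  have w'0: "0 < w' x" for x by (simp add: w'_def)
  have s0: "0 < \<sigma> x" for x using w'0[of x] by (simp add: \<sigma>_def)
  have AEw: "AE x in lebesgue. w x = w' x" using wpos by eventually_elim (simp add: w'_def)
  have "Ap_bound p w' \<Lambda>" unfolding Ap_bound_def
  proof (intro conjI ballI allI)
    fix Q :: "(real^'n) set" assume Q: "Q \<in> cubes"
    then obtain a l where Ql: "Q = cbox a (\<chi> i. a $ i + l)" "0 < l" unfolding cubes_def by blast
    have Qm[measurable]: "Q \<in> sets lebesgue" unfolding Ql by simp
    interpret dyadic_grid 1 "0 :: real^'n" by unfold_locales simp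
    define \<mu> where "\<mu> = l ^ CARD('n)"
    have \<mu>0: "0 < \<mu>" using Ql by (simp add: \<mu>_def)
    have eQ: "emeasure lebesgue Q = ennreal \<mu>" unfolding Ql \<mu>_def using Ql by (intro emeasure_cube_side) simp
    then have mQ: "measure lebesgue Q = \<mu>" using \<mu>0 by (simp add: measure_def)
    have "set_integrable lebesgue Q w" unfolding Ql by (rule wint) simp
    then have iw: "set_integrable lebesgue Q w'"
      unfolding set_integrable_def
    proof (rule integrable_cong_AE_imp)
      show "AE x in lebesgue. indicator Q x *\<^sub>R w x = indicator Q x *\<^sub>R w' x"
        using AEw by eventually_elim simp
    qed measurable
    define W where "W = (LINT x:Q|lebesgue. w' x)"
    have We: "(\<integral>\<^sup>+x\<in>Q. ennreal (w' x) \<partial>lebesgue) = ennreal W"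
    proof -
      have "(\<integral>\<^sup>+x\<in>Q. ennreal (w' x) \<partial>lebesgue) = (\<integral>\<^sup>+x. ennreal (indicator Q x *\<^sub>R w' x) \<partial>lebesgue)"
        by (intro nn_integral_cong) (simp split: split_indicator)
      also have "\<dots> = ennreal W" unfolding W_def set_lebesgue_integral_def
        using iw w'0 unfolding set_integrable_def by (intro nn_integral_eq_integral) (auto simp: less_imp_le)
      finally show ?thesis .
    qed
    have W0: "0 < W"
    proof -
      have "(\<integral>\<^sup>+x\<in>Q. ennreal (w' x) \<partial>lebesgue) \<noteq> 0"
      proof
        assume "(\<integral>\<^sup>+x\<in>Q. ennreal (w' x) \<partial>lebesgue) = 0"
        then have "AE x in lebesgue. ennreal (w' x) * indicator Q x = 0" by (subst (asm) nn_integral_0_iff_AE) measurable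
        then have "AE x in lebesgue. x \<notin> Q"
        proof eventually_elim
          case (elim x)
          then show ?case using w'0[of x] by (cases "x \<in> Q") (simp_all add: ennreal_eq_0_iff)
        qed
        then have "emeasure lebesgue Q = 0" using Qm AE_iff_measurable[of Q lebesgue "\<lambda>x. x \<notin> Q"] by auto
        then show False using eQ \<mu>0 by simp
      qed
      then show ?thesis unfolding We by (simp add: ennreal_eq_0_iff)
    qed
    have avw: "average Q w = ennreal (W / \<mu>)"
    proof -
      have "(\<integral>\<^sup>+x\<in>Q. ennreal (w x) \<partial>lebesgue) = (\<integral>\<^sup>+x\<in>Q. ennreal (w' x) \<partial>lebesgue)"
        by (rule nn_integral_cong_AE) (use AEw in \<open>eventually_elim, simp\<close>)
      then show ?thesis using W0 \<mu>0 by (simp add: average_def We eQ divide_ennreal)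
    qed
    have avs: "average Q (\<lambda>x. w x powr (- 1 / (p - 1))) = (\<integral>\<^sup>+x\<in>Q. ennreal (\<sigma> x) \<partial>lebesgue) / ennreal \<mu>"
    proof -
      have "(\<integral>\<^sup>+x\<in>Q. ennreal (w x powr (- 1 / (p - 1))) \<partial>lebesgue) = (\<integral>\<^sup>+x\<in>Q. ennreal (\<sigma> x) \<partial>lebesgue)"
        by (rule nn_integral_cong_AE) (use AEw in \<open>eventually_elim, simp add: \<sigma>_def\<close>)
      then show ?thesis by (simp add: average_def eQ)
    qed
    have le: "average Q w * enn_powr (average Q (\<lambda>x. w x powr (- 1 / (p - 1)))) (p - 1) \<le> ennreal \<Lambda>"
      unfolding Ae[symmetric] Ap_const_def by (rule SUP_upper[OF Q])
    have sfin: "(\<integral>\<^sup>+x\<in>Q. ennreal (\<sigma> x) \<partial>lebesgue) < \<infinity>"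
    proof (rule ccontr)
      assume "\<not> (\<integral>\<^sup>+x\<in>Q. ennreal (\<sigma> x) \<partial>lebesgue) < \<infinity>"
      then have "(\<integral>\<^sup>+x\<in>Q. ennreal (\<sigma> x) \<partial>lebesgue) = top" by (simp add: not_less top_unique)
      then have avT: "average Q (\<lambda>x. w x powr (- 1 / (p - 1))) = top"
        unfolding avs using \<mu>0 by (simp add: ennreal_top_divide)
      have "average Q w * enn_powr (average Q (\<lambda>x. w x powr (- 1 / (p - 1)))) (p - 1) = top"
        unfolding avT avw using W0 \<mu>0 by (simp add: enn_powr_def ennreal_mult_top)
      then show False using le by (simp add: top_unique)
    qed
    have sI: "(\<integral>\<^sup>+x. ennreal (indicator Q x *\<^sub>R \<sigma> x) \<partial>lebesgue) = (\<integral>\<^sup>+x\<in>Q. ennreal (\<sigma> x) \<partial>lebesgue)"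
      by (intro nn_integral_cong) (simp split: split_indicator)
    have is': "integrable lebesgue (\<lambda>x. indicator Q x *\<^sub>R \<sigma> x)"
      using sfin s0 unfolding sI[symmetric] by (intro integrableI_nonneg) (auto simp: less_imp_le)
    define S where "S = (LINT x:Q|lebesgue. \<sigma> x)"
    have Se: "(\<integral>\<^sup>+x\<in>Q. ennreal (\<sigma> x) \<partial>lebesgue) = ennreal S"
      unfolding sI[symmetric] S_def set_lebesgue_integral_def
      using s0 by (intro nn_integral_eq_integral is') (auto simp: less_imp_le)
    have S0: "0 \<le> S" unfolding S_def using s0 by (intro LINT_nonneg) (simp add: less_imp_le)
    have "ennreal (W / \<mu>) * ennreal ((S / \<mu>) powr (p - 1)) \<le> ennreal \<Lambda>"
      using le unfolding avw avs Se using W0 S0 \<mu>0 by (simp add: divide_ennreal enn_powr_ennreal)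
    moreover have "ennreal (W / \<mu>) * ennreal ((S / \<mu>) powr (p - 1)) = ennreal (W / \<mu> * (S / \<mu>) powr (p - 1))"
      using W0 \<mu>0 by (intro ennreal_mult[symmetric]) auto
    ultimately have "ennreal (W / \<mu> * (S / \<mu>) powr (p - 1)) \<le> ennreal \<Lambda>" by simp
    then have "W / \<mu> * (S / \<mu>) powr (p - 1) \<le> \<Lambda>"
      by (subst (asm) ennreal_le_iff) (auto simp: \<Lambda>_def)
    then have "W * S powr (p - 1) / (\<mu> * \<mu> powr (p - 1)) \<le> \<Lambda>" by (simp add: powr_divide)
    moreover have "\<mu> * \<mu> powr (p - 1) = \<mu> powr p" using \<mu>0 by (subst powr_mult_base) auto
    ultimately have "W * S powr (p - 1) \<le> \<Lambda> * \<mu> powr p" using \<mu>0 by (simp add: pos_divide_le_eq)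
    then show "(LINT x:Q|lebesgue. w' x) * (LINT x:Q|lebesgue. w' x powr (- 1 / (p - 1))) powr (p - 1) \<le> \<Lambda> * measure lebesgue Q powr p"
      by (simp add: W_def S_def \<sigma>_def mQ)
    show "set_integrable lebesgue Q w'" by (rule iw)
    show "set_integrable lebesgue Q (\<lambda>x. w' x powr (- 1 / (p - 1)))" using is' by (simp add: set_integrable_def \<sigma>_def)
  qed (use w'm w'0 in \<open>auto simp: \<Lambda>_def\<close>)
  then show thesis using AEw that unfolding \<Lambda>_def by blast
qed

lemma (in cz_operator) weighted_bound_sequences:
  assumes r: "1 < r" and s: "1 < s" and B: "0 \<le> B" and SB: "\<And>J. strong_type J r s B"
    and f: "\<And>j. f j \<in> L2_fun" and bdd: "\<And>j. \<exists>M. \<forall>x. cmod (f j x) \<le> M"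
    and p: "1 < p" and pq: "1/p + 1/q = 1" and Ap: "Ap_bound p w \<Lambda>"
  shows "(\<integral>\<^sup>+x. enn_powr (lr_norm r (\<lambda>j. T (f j) x)) p * ennreal (w x) \<partial>lebesgue)
    \<le> ennreal ((weighted_const s B p q * \<Lambda> powr (max 1 (1 / (p - 1)))) powr p) *
       (\<integral>\<^sup>+x. enn_powr (lr_norm r (\<lambda>j. f j x)) p * ennreal (w x) \<partial>lebesgue)"
proof -
  have r0: "0 < r" using r by simp
  have w: "w \<in> borel_measurable lebesgue" "\<And>x. 0 < w x" using Ap[unfolded Ap_bound_def] by blast+
  note wm[measurable] = w(1)
  have w0: "0 \<le> w x" for x using w(2) by (simp add: less_imp_le)
  have Tm[measurable]: "T (f j) \<in> borel_measurable lebesgue" for j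
    using lin f[of j] unfolding L2_bounded_linear_def L2_fun_def by blast
  let ?N = "\<lambda>J x. fin_norm J r (\<lambda>j. T (f j) x)"
  let ?D = "ennreal ((weighted_const s B p q * \<Lambda> powr (max 1 (1 / (p - 1)))) powr p)"
  have Nmono: "?N J x \<le> ?N (Suc J) x" for J x
    unfolding fin_norm_def using r0 by (intro powr_mono2) (auto intro: sum_nonneg)
  have "(\<integral>\<^sup>+x. enn_powr (lr_norm r (\<lambda>j. T (f j) x)) p * ennreal (w x) \<partial>lebesgue)
     \<le> (\<integral>\<^sup>+x. (SUP J. ennreal (w x * ?N J x powr p)) \<partial>lebesgue)"
  proof (rule nn_integral_mono)
    fix x
    have "enn_powr (lr_norm r (\<lambda>j. T (f j) x)) p \<le> enn_powr (SUP J. ennreal (?N J x)) p"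
      using p by (intro enn_powr_mono lr_norm_bounds r0) simp
    also have "\<dots> \<le> (SUP J. ennreal (?N J x powr p))" using p by (intro enn_powr_SUP_le) auto
    finally have "enn_powr (lr_norm r (\<lambda>j. T (f j) x)) p * ennreal (w x) \<le> (SUP J. ennreal (?N J x powr p)) * ennreal (w x)"
      by (rule mult_right_mono) simp
    also have "\<dots> = (SUP J. ennreal (w x * ?N J x powr p))"
      using w0[of x] by (simp add: mult.commute[of _ "ennreal (w x)"] SUP_mult_left_ennreal ennreal_mult)
    finally show "enn_powr (lr_norm r (\<lambda>j. T (f j) x)) p * ennreal (w x) \<le> (SUP J. ennreal (w x * ?N J x powr p))" .
  qed
  also have "\<dots> = (SUP J. \<integral>\<^sup>+x. ennreal (w x * ?N J x powr p) \<partial>lebesgue)"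
  proof (rule nn_integral_monotone_convergence_SUP)
    show "incseq (\<lambda>J x. ennreal (w x * ?N J x powr p))"
      using p by (intro incseq_SucI le_funI ennreal_leI mult_left_mono powr_mono2 Nmono w0) auto
  qed measurable
  also have "\<dots> \<le> ?D * (\<integral>\<^sup>+x. enn_powr (lr_norm r (\<lambda>j. f j x)) p * ennreal (w x) \<partial>lebesgue)"
  proof (rule SUP_least)
    fix J
    have "(\<integral>\<^sup>+x. ennreal (w x * ?N J x powr p) \<partial>lebesgue) \<le> ?D * (\<integral>\<^sup>+x. ennreal (w x * fin_norm J r (\<lambda>j. f j x) powr p) \<partial>lebesgue)"
      by (rule weighted_bound_L2[OF r s B SB f bdd p pq Ap])
    also have "\<dots> \<le> ?D * (\<integral>\<^sup>+x. enn_powr (lr_norm r (\<lambda>j. f j x)) p * ennreal (w x) \<partial>lebesgue)"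
    proof (intro mult_left_mono nn_integral_mono)
      fix x
      have "ennreal (w x * fin_norm J r (\<lambda>j. f j x) powr p) = enn_powr (ennreal (fin_norm J r (\<lambda>j. f j x))) p * ennreal (w x)"
        using w0[of x] by (simp add: enn_powr_ennreal ennreal_mult mult.commute)
      also have "\<dots> \<le> enn_powr (lr_norm r (\<lambda>j. f j x)) p * ennreal (w x)"
        using p by (intro mult_right_mono enn_powr_mono lr_norm_bounds r0) auto
      finally show "ennreal (w x * fin_norm J r (\<lambda>j. f j x) powr p) \<le> enn_powr (lr_norm r (\<lambda>j. f j x)) p * ennreal (w x)" .
    qed simp
    finally show "(\<integral>\<^sup>+x. ennreal (w x * ?N J x powr p) \<partial>lebesgue) \<le> ?D * (\<integral>\<^sup>+x. enn_powr (lr_norm r (\<lambda>j. f j x)) p * ennreal (w x) \<partial>lebesgue)" .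
  qed
  finally show ?thesis .
qed

section \<open>The sharp vector-valued weighted inequality\<close>

theorem theorem1p3:
  fixes T :: "(real^'n::finite \<Rightarrow> complex) \<Rightarrow> (real^'n \<Rightarrow> complex)"
    and p r :: real
  assumes "calderon_zygmund T"
    and "1 < r" and "1 < p"
  shows "\<exists>C::real. 0 \<le> C \<and>
    (\<forall>w \<in> Ap_weights p.
       vv_op_norm T p r w \<le> ennreal C * enn_powr (Ap_const p w) (max 1 (1 / (p - 1))))"
proof -
  note r = \<open>1 < r\<close> and p = \<open>1 < p\<close>
  obtain K CK \<alpha> where K: "\<alpha> > 0" "CZ_kernel K CK \<alpha>"
    "\<forall>f\<in>L2_fun. compact (ess_support f) \<longrightarrow>
           (AE x in lebesgue. x \<notin> ess_support f \<longrightarrow> T f x = (\<integral>y. K x y * f y \<partial>lebesgue))"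
    and lin: "L2_bounded_linear T"
    using \<open>calderon_zygmund T\<close> unfolding calderon_zygmund_def by blast
  interpret cz_operator T K CK \<alpha> using K lin by unfold_locales auto
  obtain B where B: "0 \<le> B" "\<And>J. strong_type J r r B" by (rule strong_type_Lr[OF r]) (rule that)
  define q where "q = p / (p - 1)"
  have pq: "1/p + 1/q = 1" using p by (simp add: q_def field_simps)
  define C where "C = weighted_const r B p q"
  have C0: "0 \<le> C" unfolding C_def by (rule weighted_const_nonneg)
  show ?thesis
  proof (intro exI[of _ C] conjI C0 ballI)
    fix w :: "real^'n \<Rightarrow> real" assume w: "w \<in> Ap_weights p"
    obtain w' where w': "AE x in lebesgue. w x = w' x" "Ap_bound p w' (enn2real (Ap_const p w))"
      by (rule Ap_bound_of_Ap_weight[OF p w]) (rule that)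
    define D where "D = C * enn2real (Ap_const p w) powr (max 1 (1 / (p - 1)))"
    have D0: "0 \<le> D" using C0 by (simp add: D_def)
    have Deq: "ennreal C * enn_powr (Ap_const p w) (max 1 (1 / (p - 1))) = ennreal D"
    proof -
      have "Ap_const p w \<noteq> top" using w by (auto simp: Ap_weights_def)
      then show ?thesis using C0 by (simp add: D_def enn_powr_def ennreal_mult)
    qed
    have "Lp_norm p w (vv_op T r f) \<le> ennreal D * Lp_lr_norm p r w f"
      if f: "\<forall>j. f j \<in> schwartz" for f
    proof -
      have cong: "(\<integral>\<^sup>+x. h x * ennreal (w x) \<partial>lebesgue) = (\<integral>\<^sup>+x. h x * ennreal (w' x) \<partial>lebesgue)" for h
        by (rule nn_integral_cong_AE) (use w'(1) in \<open>eventually_elim, simp\<close>)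
      have "(\<integral>\<^sup>+x. enn_powr (lr_norm r (\<lambda>j. T (f j) x)) p * ennreal (w' x) \<partial>lebesgue)
        \<le> ennreal (D powr p) * (\<integral>\<^sup>+x. enn_powr (lr_norm r (\<lambda>j. f j x)) p * ennreal (w' x) \<partial>lebesgue)"
        unfolding D_def C_def
        using f by (intro weighted_bound_sequences[OF r r B _ _ p pq w'(2)] schwartz_bounded_L2) auto
      then have "Lp_norm p w (vv_op T r f) \<le> enn_powr (ennreal (D powr p) * (\<integral>\<^sup>+x. enn_powr (lr_norm r (\<lambda>j. f j x)) p * ennreal (w x) \<partial>lebesgue)) (1/p)"
        unfolding Lp_norm_def vv_op_def cong using p by (intro enn_powr_mono) auto
      also have "\<dots> = ennreal D * Lp_lr_norm p r w f"
        unfolding Lp_lr_norm_def Lp_norm_def using p D0 by (subst enn_powr_mult_ennreal) (auto simp: powr_powr)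
      finally show ?thesis .
    qed
    then show "vv_op_norm T p r w \<le> ennreal C * enn_powr (Ap_const p w) (max 1 (1 / (p - 1)))"
      unfolding vv_op_norm_def Deq by (intro Inf_lower) auto
  qed
qed

end
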